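(* Let $k$ be a field of characteristic $0$ and let $\mathfrak a$ be an abelian Lie algebra over $k$ with $\dim_k\mathfrak a=2$ (in homological degree $0$). For a finite-dimensional reductive Lie algebra $\mathfrak g$ over $k$, let $G$ be the associated reductive group, $\mathfrak h\subset\mathfrak g$ a Cartan subalgebra and $W$ the Weyl group. The following conjecture (1) is equivalent to statement (2). (1) For any reductive Lie algebra $\mathfrak g$ over $k$, the derived Harish-Chandra homomorphism $$\Phi_{\mathfrak g}:\mathrm{DRep}_{\mathfrak g}(\mathfrak a)^G\to\mathbf{Sym}(\mathfrak h^*\oplus\mathfrak h^*\oplus\mathfrak h^*[1])^W$$ is a quasi-isomorphism (at least when the quotient commuting scheme $\mathrm{Rep}_{\mathfrak g}(\mathfrak a)/\!/G$ is reduced). (2) For $\mathfrak g$ as in (1) (that is, any reductive $\mathfrak g$, with the same proviso), the DG algebra map given by restriction of functions from $\mathfrak g$ to $\mathfrak h$, $$\Phi_{\mathfrak g}:\big(k[\mathfrak g\times\mathfrak g]\otimes\wedge\mathfrak g^*,\,d\big)^G\to\big(k[\mathfrak h\times\mathfrak h]\otimes\wedge\mathfrak h^*\big)^W,$$ is a quasi-isomorphism. Here $k[\mathfrak g\times\mathfrak g]$ is in homological degree $0$, $\mathfrak g^*\subset\wedge\mathfrak g^*$ is in homological degree $1$, the differential is determined by $d\varphi(\xi,\eta):=\varphi([\xi,\eta])$ for $\varphi\in\mathfrak g^*$ and $\xi,\eta\in\mathfrak g$, the group $G$ acts diagonally via the adjoint action, and the target has zero differential.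
   Context: DG objects are homologically graded (differential of degree $-1$), $V[i]_j=V_{j-i}$; $\mathbf{Sym}$ (resp. $\mathbf{Sym}^c$) is the graded symmetric algebra (resp. coalgebra). $\mathrm{Rep}_{\mathfrak g}(\mathfrak a)$ is the affine scheme of Lie algebra homomorphisms $\mathfrak a\to\mathfrak g$ (for $\mathfrak a$ two-dimensional abelian, the classical commuting scheme of $\mathfrak g$), and $\mathrm{Rep}_{\mathfrak g}(\mathfrak a)/\!/G=\mathrm{Spec}\,k[\mathrm{Rep}_{\mathfrak g}(\mathfrak a)]^G$. For a DG Lie algebra $\mathfrak L$, $\mathfrak L_{\mathfrak g}$ is the commutative DG algebra (co)representing $B\mapsto\mathrm{Hom}(\mathfrak L,\mathfrak g\otimes B)$ (DG Lie homomorphisms) on commutative DG algebras $B$; $G$ acts on it via the adjoint action on $\mathfrak g$, and $\mathrm{DRep}_{\mathfrak g}(\mathfrak a)^G:=(Q\mathfrak a)_{\mathfrak g}^G$ for a cofibrant resolution $Q\mathfrak a\to\mathfrak a$ of DG Lie algebras. Derived Harish-Chandra homomorphism: for a cocommutative coaugmented conilpotent DG coalgebra $C$ Koszul dual to $\mathfrak a$ (i.e. with a quasi-isomorphism to $\mathfrak a$ from the free graded Lie algebra on $\bar C[-1]$, with differential induced by $d_C$ and the coproduct) one has $\mathrm{DRep}_{\mathfrak g}(\mathfrak a)^G\cong\mathcal C^c(\mathfrak g^*(C),\mathfrak g^*;k)$, where $\mathcal C^c(\mathfrak g^*(C),\mathfrak g^*;k)$ is the $\mathfrak g$-invariant subalgebra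 of the Chevalley–Eilenberg algebra $(\mathbf{Sym}(\mathfrak g^*\otimes\bar C[-1]),d_1+d_2)$ of the DG Lie coalgebra $\mathfrak g^*\otimes\bar C$ ($\bar C$ the cokernel of the coaugmentation; $d_1$ induced by the differential of $C$; $d_2$ the derivation induced by minus the Lie cobracket). The projection $\mathfrak g^*\twoheadrightarrow\mathfrak h^*$ dual to $\mathfrak h\hookrightarrow\mathfrak g$ induces a DG algebra map $\Phi_{\mathfrak g}:\mathcal C^c(\mathfrak g^*(C),\mathfrak g^*;k)\to\mathcal C^c(\mathfrak h^*(C),\mathfrak h^*;k)^W$, which is the derived Harish-Chandra homomorphism. For $\mathfrak a$ abelian of dimension $2$ one takes $C=\mathbf{Sym}^c(\mathfrak a[1])=k\oplus\mathfrak a\oplus\wedge^2\mathfrak a$ ($\wedge^i\mathfrak a$ in degree $i$), and the target is $\mathbf{Sym}(\mathfrak h^*\otimes(\mathfrak a\oplus\wedge^2\mathfrak a))^W\cong\mathbf{Sym}(\mathfrak h^*\oplus\mathfrak h^*\oplus\mathfrak h^*[1])^W$, with $\wedge^i\mathfrak a$ in degree $i-1$ and zero differential. *)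

theory Defs
  imports
    "Jordan_Normal_Form.Determinant"
    "HOL-Algebra.Algebraic_Closure_Type"
    "HOL-Library.Poly_Mapping"
    "HOL-Library.Function_Algebras"
    "HOL-Library.Nat_Bijection"
begin

section \<open>Finite-dimensional reductive Lie algebras\<close>

text \<open>A finite-dimensional Lie algebra is given in coordinates: its underlying vector space
  is \<^term>\<open>carrier_vec n\<close>, so the dimension can be quantified over, and its bracket is a
  function on vectors, of which only the values on \<^term>\<open>carrier_vec n\<close> matter.\<close>

definition lie_algebra :: "nat \<Rightarrow> ('k::field vec \<Rightarrow> 'k vec \<Rightarrow> 'k vec) \<Rightarrow> bool" where
  "lie_algebra n br \<longleftrightarrow>
     (\<forall>x\<in>carrier_vec n. \<forall>y\<in>carrier_vec n. br x y \<in> carrier_vec n) \<and>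
     (\<forall>x\<in>carrier_vec n. \<forall>y\<in>carrier_vec n. \<forall>z\<in>carrier_vec n.
        br (x + y) z = br x z + br y z \<and> br x (y + z) = br x y + br x z) \<and>
     (\<forall>a. \<forall>x\<in>carrier_vec n. \<forall>y\<in>carrier_vec n.
        br (a \<cdot>\<^sub>v x) y = a \<cdot>\<^sub>v br x y \<and> br x (a \<cdot>\<^sub>v y) = a \<cdot>\<^sub>v br x y) \<and>
     (\<forall>x\<in>carrier_vec n. br x x = 0\<^sub>v n) \<and>
     (\<forall>x\<in>carrier_vec n. \<forall>y\<in>carrier_vec n. \<forall>z\<in>carrier_vec n.
        br x (br y z) + br y (br z x) + br z (br x y) = 0\<^sub>v n)"

definition linear_subspace :: "nat \<Rightarrow> 'k::field vec set \<Rightarrow> bool" where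
  "linear_subspace n U \<longleftrightarrow> U \<subseteq> carrier_vec n \<and> 0\<^sub>v n \<in> U \<and>
     (\<forall>x\<in>U. \<forall>y\<in>U. x + y \<in> U) \<and> (\<forall>a. \<forall>x\<in>U. a \<cdot>\<^sub>v x \<in> U)"

definition lie_ideal :: "nat \<Rightarrow> ('k::field vec \<Rightarrow> 'k vec \<Rightarrow> 'k vec) \<Rightarrow> 'k vec set \<Rightarrow> bool" where
  "lie_ideal n br I \<longleftrightarrow> linear_subspace n I \<and> (\<forall>x\<in>carrier_vec n. \<forall>u\<in>I. br x u \<in> I)"

text \<open>Reductive: the adjoint representation is semisimple. Its subrepresentations are the ideals.\<close>

definition reductive :: "nat \<Rightarrow> ('k::field vec \<Rightarrow> 'k vec \<Rightarrow> 'k vec) \<Rightarrow> bool" where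
  "reductive n br \<longleftrightarrow> lie_algebra n br \<and>
     (\<forall>I. lie_ideal n br I \<longrightarrow>
        (\<exists>J. lie_ideal n br J \<and> I \<inter> J = {0\<^sub>v n} \<and>
             (\<forall>x\<in>carrier_vec n. \<exists>u\<in>I. \<exists>v\<in>J. x = u + v)))"

text \<open>Cartan subalgebra: a nilpotent subalgebra that equals its own normalizer. Nilpotency says
  that all iterated brackets \<open>[x\<^sub>1, [x\<^sub>2, \<dots> [x\<^sub>r, y]]]\<close> vanish for some \<open>r\<close>.\<close>

definition cartan_subalgebra ::
    "nat \<Rightarrow> ('k::field vec \<Rightarrow> 'k vec \<Rightarrow> 'k vec) \<Rightarrow> 'k vec set \<Rightarrow> bool" where
  "cartan_subalgebra n br h \<longleftrightarrow>
     linear_subspace n h \<and> (\<forall>x\<in>h. \<forall>y\<in>h. br x y \<in> h) \<and>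
     (\<exists>r. \<forall>xs y. length xs = r \<and> set xs \<subseteq> h \<and> y \<in> h \<longrightarrow> foldr br xs y = 0\<^sub>v n) \<and>
     (\<forall>x\<in>carrier_vec n. (\<forall>y\<in>h. br x y \<in> h) \<longrightarrow> x \<in> h)"

definition dual_space :: "'k::field vec set \<Rightarrow> ('k vec \<Rightarrow> 'k) set" where
  "dual_space V = {\<phi>. (\<forall>u\<in>V. \<forall>v\<in>V. \<phi> (u + v) = \<phi> u + \<phi> v) \<and>
                      (\<forall>a. \<forall>u\<in>V. \<phi> (a \<cdot>\<^sub>v u) = a * \<phi> u)}"

text \<open>The columns of \<open>B\<close> form a basis of \<open>U\<close>.\<close>

definition is_basis :: "nat \<Rightarrow> 'k::field vec set \<Rightarrow> nat \<Rightarrow> 'k mat \<Rightarrow> bool" where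
  "is_basis n U m B \<longleftrightarrow> B \<in> carrier_mat n m \<and> U = (\<lambda>v. B *\<^sub>v v) ` carrier_vec m \<and>
     (\<forall>v\<in>carrier_vec m. B *\<^sub>v v = 0\<^sub>v n \<longrightarrow> v = 0\<^sub>v m)"


section \<open>The reductive group and the Weyl group\<close>

text \<open>The field \<open>k\<close> need not be algebraically closed. The groups \<open>G\<close> and \<open>W\<close> are therefore taken
  over the algebraic closure \<open>K\<close> of \<open>k\<close>, and an object over \<open>k\<close> is invariant if its base change
  to \<open>K\<close> is; these are the invariants of the group schemes.\<close>

definition bracket_ac ::
    "nat \<Rightarrow> ('k::field vec \<Rightarrow> 'k vec \<Rightarrow> 'k vec) \<Rightarrow>
     'k alg_closure vec \<Rightarrow> 'k alg_closure vec \<Rightarrow> 'k alg_closure vec" where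
  "bracket_ac n br x y =
     vec n (\<lambda>l. \<Sum>i<n. \<Sum>j<n. x $ i * y $ j * to_ac (br (unit_vec n i) (unit_vec n j) $ l))"

definition span_ac :: "nat \<Rightarrow> 'k::field vec set \<Rightarrow> 'k alg_closure vec set" where
  "span_ac n U = {vec n (\<lambda>i. \<Sum>u\<in>S. a u * to_ac (u $ i)) | S a. finite S \<and> S \<subseteq> U}"

definition ad_mat :: "nat \<Rightarrow> ('k::field vec \<Rightarrow> 'k vec \<Rightarrow> 'k vec) \<Rightarrow> 'k vec \<Rightarrow> 'k mat" where
  "ad_mat n br x = mat n n (\<lambda>(l, j). br x (unit_vec n j) $ l)"

text \<open>A nilpotent \<open>n \<times> n\<close> matrix satisfies \<open>A\<^sup>n = 0\<close>, so this sum is the whole exponential series.\<close>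

definition exp_nilpotent :: "nat \<Rightarrow> 'k::field_char_0 mat \<Rightarrow> 'k mat" where
  "exp_nilpotent n A = mat n n (\<lambda>(i, j). \<Sum>r\<le>n. (A ^\<^sub>m r) $$ (i, j) / fact r)"

text \<open>\<open>G\<close> acts only through its image \<open>Ad(G)\<close> in \<open>GL(\<gg>)\<close>. Over an algebraically closed field of
  characteristic zero, this image is the group of inner automorphisms, generated by the
  \<open>exp(ad x)\<close> with \<open>ad x\<close> nilpotent (inverses are provided by \<open>-x\<close>).\<close>

inductive_set inner_auts ::
    "nat \<Rightarrow> ('k::field_char_0 vec \<Rightarrow> 'k vec \<Rightarrow> 'k vec) \<Rightarrow> 'k mat set"
  for n :: nat and br :: "'k::field_char_0 vec \<Rightarrow> 'k vec \<Rightarrow> 'k vec" where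
  one: "1\<^sub>m n \<in> inner_auts n br"
| exp: "\<lbrakk>A \<in> inner_auts n br; x \<in> carrier_vec n; \<exists>r. ad_mat n br x ^\<^sub>m r = 0\<^sub>m n n\<rbrakk>
        \<Longrightarrow> exp_nilpotent n (ad_mat n br x) * A \<in> inner_auts n br"

definition Ad_group ::
    "nat \<Rightarrow> ('k::field_char_0 vec \<Rightarrow> 'k vec \<Rightarrow> 'k vec) \<Rightarrow> 'k alg_closure mat set" where
  "Ad_group n br = inner_auts n (bracket_ac n br)"

text \<open>The elements normalizing a Cartan subalgebra; \<open>W\<close> is the group of their restrictions to it.\<close>

definition cartan_normalizer ::
    "nat \<Rightarrow> ('k::field_char_0 vec \<Rightarrow> 'k vec \<Rightarrow> 'k vec) \<Rightarrow> 'k vec set \<Rightarrow> 'k alg_closure mat set" where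
  "cartan_normalizer n br h =
     {\<gamma> \<in> Ad_group n br. (\<lambda>v. \<gamma> *\<^sub>v v) ` span_ac n h = span_ac n h}"

text \<open>\<open>W\<close> written as matrices in the basis of the Cartan subalgebra given by the columns of \<open>B\<close>.\<close>

definition weyl_group ::
    "nat \<Rightarrow> ('k::field_char_0 vec \<Rightarrow> 'k vec \<Rightarrow> 'k vec) \<Rightarrow> 'k vec set \<Rightarrow> nat \<Rightarrow> 'k mat \<Rightarrow>
     'k alg_closure mat set" where
  "weyl_group n br h m B =
     {w \<in> carrier_mat m m. \<exists>\<gamma>\<in>cartan_normalizer n br h. \<gamma> * map_mat to_ac B = map_mat to_ac B * w}"


section \<open>Quasi-isomorphisms\<close>

text \<open>A non-negatively graded complex is given by its components \<open>A i\<close> and a differential of degree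
  \<open>-1\<close> that vanishes on \<open>A 0\<close>.\<close>

definition cycles :: "(nat \<Rightarrow> 'a::ab_group_add set) \<Rightarrow> ('a \<Rightarrow> 'a) \<Rightarrow> nat \<Rightarrow> 'a set" where
  "cycles A d i = {a \<in> A i. d a = 0}"

definition homologous ::
    "(nat \<Rightarrow> 'a::ab_group_add set) \<Rightarrow> ('a \<Rightarrow> 'a) \<Rightarrow> nat \<Rightarrow> ('a \<times> 'a) set" where
  "homologous A d i =
     {(a, b). a \<in> cycles A d i \<and> b \<in> cycles A d i \<and> a - b \<in> d ` A (Suc i)}"

definition homology :: "(nat \<Rightarrow> 'a::ab_group_add set) \<Rightarrow> ('a \<Rightarrow> 'a) \<Rightarrow> nat \<Rightarrow> 'a set set" where
  "homology A d i = cycles A d i // homologous A d i"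

definition quasi_iso ::
    "(nat \<Rightarrow> 'a::ab_group_add set) \<Rightarrow> ('a \<Rightarrow> 'a) \<Rightarrow>
     (nat \<Rightarrow> 'b::ab_group_add set) \<Rightarrow> ('b \<Rightarrow> 'b) \<Rightarrow> ('a \<Rightarrow> 'b) \<Rightarrow> bool" where
  "quasi_iso A dA B dB \<Phi> \<longleftrightarrow>
     (\<forall>i. \<forall>a\<in>A i. \<Phi> a \<in> B i \<and> \<Phi> (dA a) = dB (\<Phi> a)) \<and>
     (\<forall>i. bij_betw (\<lambda>c. homologous B dB i `` (\<Phi> ` c)) (homology A dA i) (homology B dB i))"


section \<open>The Chevalley--Eilenberg algebra and the derived Harish-Chandra homomorphism\<close>

text \<open>A coaugmented DG coalgebra \<open>C\<close> is given by a finite homogeneous basis of the cokernel of its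
  coaugmentation, with \<open>d(c) = \<Sum>\<^sub>p diff c p \<cdot> p\<close> and reduced coproduct
  \<open>\<Sum>\<^sub>p\<^sub>,\<^sub>q cop c p q \<cdot> p \<otimes> q\<close>.\<close>

record 'k dg_coalgebra =
  cbasis :: "nat set"
  cdeg :: "nat \<Rightarrow> nat"
  cdiff :: "nat \<Rightarrow> nat \<Rightarrow> 'k"
  cop :: "nat \<Rightarrow> nat \<Rightarrow> nat \<Rightarrow> 'k"

text \<open>\<open>Sym\<^sup>c(\<aa>[1])\<close> for \<open>\<aa>\<close> abelian with basis \<open>x, y\<close>. The basis elements \<open>x\<close>, \<open>y\<close>, \<open>x \<and> y\<close> are
  numbered \<open>0\<close>, \<open>1\<close>, \<open>2\<close>; the generators \<open>x, y\<close> are primitive and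
  \<open>x \<and> y \<mapsto> x \<otimes> y - y \<otimes> x\<close>.\<close>

definition sym_coalgebra2 :: "'k::field dg_coalgebra" where
  "sym_coalgebra2 = \<lparr>cbasis = {0, 1, 2}, cdeg = (\<lambda>c. if c = 2 then 2 else 1), cdiff = (\<lambda>_ _. 0),
     cop = (\<lambda>c p q. if (c, p, q) = (2, 0, 1) then 1 else if (c, p, q) = (2, 1, 0) then - 1 else 0)\<rparr>"

text \<open>Let \<open>V\<close> have the basis \<open>e\<^sub>0, \<dots>, e\<^sub>N\<^sub>-\<^sub>1\<close>, with dual basis \<open>e\<^sub>0\<^sup>*, \<dots>\<close>. The generator \<open>(i, c)\<close> of
  \<open>Sym(V\<^sup>* \<otimes> C[-1])\<close> stands for \<open>e\<^sub>i\<^sup>* \<otimes> c\<close>, in degree \<open>|c| - 1\<close>. Elements of the symmetric algebra are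
  linear combinations of monomials, i.e. words in the generators that are sorted (with respect to
  an arbitrary fixed order) and contain no odd generator twice.\<close>

type_synonym gen = "nat \<times> nat"
type_synonym 'k salg = "gen list \<Rightarrow>\<^sub>0 'k"

definition gdeg :: "'k dg_coalgebra \<Rightarrow> gen \<Rightarrow> nat" where
  "gdeg C x = cdeg C (snd x) - 1"

definition monomials :: "'k dg_coalgebra \<Rightarrow> nat \<Rightarrow> gen list set" where
  "monomials C N =
     {w. set w \<subseteq> {..<N} \<times> cbasis C \<and> sorted (map prod_encode w) \<and>
         (\<forall>x. odd (gdeg C x) \<longrightarrow> count_list w x \<le> 1)}"

definition sym_alg :: "'k::zero dg_coalgebra \<Rightarrow> nat \<Rightarrow> nat \<Rightarrow> 'k salg set" where
  "sym_alg C N p = {f. \<forall>w\<in>Poly_Mapping.keys f. w \<in> monomials C N \<and> sum_list (map (gdeg C) w) = p}"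

definition scale :: "'k::field \<Rightarrow> 'k salg \<Rightarrow> 'k salg" where
  "scale a f = Poly_Mapping.map (\<lambda>b. a * b) f"

text \<open>The product of the letters of an arbitrary word. Sorting the word introduces a factor \<open>-1\<close>
  for each inversion of two odd letters; squares of odd letters are zero.\<close>

definition word_prod :: "'k::field dg_coalgebra \<Rightarrow> gen list \<Rightarrow> 'k salg" where
  "word_prod C w =
     (if \<exists>x. odd (gdeg C x) \<and> count_list w x > 1 then 0
      else Poly_Mapping.single (sort_key prod_encode w)
        ((- 1) ^ card {(a, b). a < b \<and> b < length w \<and> odd (gdeg C (w ! a)) \<and> odd (gdeg C (w ! b)) \<and>
                               prod_encode (w ! b) < prod_encode (w ! a)}))"

definition smul :: "'k::field dg_coalgebra \<Rightarrow> 'k salg \<Rightarrow> 'k salg \<Rightarrow> 'k salg" where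
  "smul C f g = (\<Sum>u\<in>Poly_Mapping.keys f. \<Sum>v\<in>Poly_Mapping.keys g.
     scale (Poly_Mapping.lookup f u * Poly_Mapping.lookup g v) (word_prod C (u @ v)))"

definition gen_elem :: "gen \<Rightarrow> 'k::field salg" where
  "gen_elem x = Poly_Mapping.single [x] 1"

text \<open>The algebra map that is induced by a linear map with matrix \<open>A\<close> from a space with \<open>dim_col A\<close>
  basis vectors to one with \<open>dim_row A\<close> basis vectors: it is the transpose of \<open>A\<close> on generators,
  i.e. composition of linear forms with \<open>A\<close>.\<close>

definition gen_map :: "'k::field mat \<Rightarrow> gen \<Rightarrow> 'k salg" where
  "gen_map A x = (\<Sum>j<dim_col A. scale (A $$ (fst x, j)) (gen_elem (j, snd x)))"

definition sym_map :: "'k::field dg_coalgebra \<Rightarrow> 'k mat \<Rightarrow> 'k salg \<Rightarrow> 'k salg" where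
  "sym_map C A f = (\<Sum>w\<in>Poly_Mapping.keys f. scale (Poly_Mapping.lookup f w)
     (foldr (\<lambda>x g. smul C (gen_map A x) g) w (Poly_Mapping.single [] 1)))"

text \<open>The derivation of degree congruent to \<open>e\<close> modulo 2 that extends \<open>\<delta>\<close> on generators.\<close>

fun derivation_word ::
    "'k::field dg_coalgebra \<Rightarrow> nat \<Rightarrow> (gen \<Rightarrow> 'k salg) \<Rightarrow> gen list \<Rightarrow> 'k salg" where
  "derivation_word C e \<delta> [] = 0"
| "derivation_word C e \<delta> (x # w) =
     smul C (\<delta> x) (Poly_Mapping.single w 1) +
     scale ((- 1) ^ (e * gdeg C x)) (smul C (gen_elem x) (derivation_word C e \<delta> w))"

definition derivation ::
    "'k::field dg_coalgebra \<Rightarrow> nat \<Rightarrow> (gen \<Rightarrow> 'k salg) \<Rightarrow> 'k salg \<Rightarrow> 'k salg" where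
  "derivation C e \<delta> f =
     (\<Sum>w\<in>Poly_Mapping.keys f. scale (Poly_Mapping.lookup f w) (derivation_word C e \<delta> w))"

text \<open>Write \<open>s\<^sup>-\<^sup>1\<close> for the shift \<open>[-1]\<close>. The cobracket of \<open>\<gg>\<^sup>* \<otimes> C\<close> sends \<open>\<phi> \<otimes> c\<close> to
  \<open>\<Sum> (\<phi>' \<otimes> c') \<otimes> (\<phi>'' \<otimes> c'')\<close>, where \<open>\<Sum> \<phi>'(\<xi>) \<phi>''(\<eta>) = \<phi>([\<xi>,\<eta>])\<close>. An element
  \<open>\<Sum> v' \<otimes> v''\<close> of the exterior square, viewed inside the tensor square, corresponds to
  \<open>1/2 \<Sum> (-1)\<^sup>|\<^sup>v\<^sup>'\<^sup>| s\<^sup>-\<^sup>1v' \<cdot> s\<^sup>-\<^sup>1v''\<close> in the symmetric square of the shift; \<open>d\<^sub>2\<close> carries a further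
  minus sign. For an ordinary Lie algebra, the factor 1/2 gives the usual
  Chevalley--Eilenberg differential. In \<open>d\<^sub>1\<close> the sign comes from \<open>d s\<^sup>-\<^sup>1 = - s\<^sup>-\<^sup>1 d\<close>.\<close>

definition ce_gen_d1 :: "'k::field dg_coalgebra \<Rightarrow> gen \<Rightarrow> 'k salg" where
  "ce_gen_d1 C = (\<lambda>(i, c). - (\<Sum>p\<in>cbasis C. scale (cdiff C c p) (gen_elem (i, p))))"

definition ce_gen_d2 ::
    "'k::field dg_coalgebra \<Rightarrow> nat \<Rightarrow> ('k vec \<Rightarrow> 'k vec \<Rightarrow> 'k vec) \<Rightarrow> gen \<Rightarrow> 'k salg" where
  "ce_gen_d2 C n br = (\<lambda>(i, c). - (\<Sum>p\<in>cbasis C. \<Sum>q\<in>cbasis C. \<Sum>j<n. \<Sum>l<n.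
     scale ((- 1) ^ cdeg C p * cop C c p q * (br (unit_vec n j) (unit_vec n l) $ i) / 2)
       (smul C (gen_elem (j, p)) (gen_elem (l, q)))))"

definition ce_diff ::
    "'k::field dg_coalgebra \<Rightarrow> nat \<Rightarrow> ('k vec \<Rightarrow> 'k vec \<Rightarrow> 'k vec) \<Rightarrow> 'k salg \<Rightarrow> 'k salg" where
  "ce_diff C n br = derivation C 1 (\<lambda>x. ce_gen_d1 C x + ce_gen_d2 C n br x)"

text \<open>The coadjoint action, \<open>(x \<cdot> \<phi>)(y) = - \<phi>([x, y])\<close>, extended by derivations.\<close>

definition coad_action ::
    "'k::field dg_coalgebra \<Rightarrow> nat \<Rightarrow> ('k vec \<Rightarrow> 'k vec \<Rightarrow> 'k vec) \<Rightarrow> 'k vec \<Rightarrow> 'k salg \<Rightarrow> 'k salg" where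
  "coad_action C n br x =
     derivation C 0 (\<lambda>(i, c). \<Sum>j<n. scale (- (br x (unit_vec n j) $ i)) (gen_elem (j, c)))"

text \<open>The components of the complex \<open>\<C>\<^sup>c(\<gg>\<^sup>*(C), \<gg>\<^sup>*; k)\<close>, with differential \<^const>\<open>ce_diff\<close>. This is
  the model of \<open>DRep\<^sub>\<gg>(\<aa>)\<^sup>G\<close> on which the derived Harish-Chandra homomorphism is defined.\<close>

definition ce_rel ::
    "'k::field dg_coalgebra \<Rightarrow> nat \<Rightarrow> ('k vec \<Rightarrow> 'k vec \<Rightarrow> 'k vec) \<Rightarrow> nat \<Rightarrow> 'k salg set" where
  "ce_rel C n br p = {f \<in> sym_alg C n p. \<forall>x\<in>carrier_vec n. coad_action C n br x f = 0}"

text \<open>\<open>Sym(\<hh>\<^sup>* \<otimes> (\<aa> \<oplus> \<and>\<^sup>2\<aa>))\<^sup>W\<close>, in the basis \<open>B\<close> of \<open>\<hh>\<close>.\<close>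

definition sym_weyl_inv ::
    "nat \<Rightarrow> ('k::field_char_0 vec \<Rightarrow> 'k vec \<Rightarrow> 'k vec) \<Rightarrow> 'k vec set \<Rightarrow> nat \<Rightarrow> 'k mat \<Rightarrow>
     nat \<Rightarrow> 'k salg set" where
  "sym_weyl_inv n br h m B p =
     {f \<in> sym_alg sym_coalgebra2 m p. \<forall>w\<in>weyl_group n br h m B.
        sym_map sym_coalgebra2 w (Poly_Mapping.map to_ac f) = Poly_Mapping.map to_ac f}"

definition derived_hc_quasi_iso ::
    "nat \<Rightarrow> ('k::field_char_0 vec \<Rightarrow> 'k vec \<Rightarrow> 'k vec) \<Rightarrow> 'k vec set \<Rightarrow> bool" where
  "derived_hc_quasi_iso n br h \<longleftrightarrow>
     (\<forall>m B. is_basis n h m B \<longrightarrow>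
        quasi_iso (ce_rel sym_coalgebra2 n br) (ce_diff sym_coalgebra2 n br)
                  (sym_weyl_inv n br h m B) (\<lambda>_. 0)
                  (sym_map sym_coalgebra2 B))"


section \<open>Polynomial functions with values in an exterior algebra\<close>

text \<open>Since \<open>k\<close> is infinite, elements of \<open>k[V \<times> V]\<close> are the same as polynomial functions. An element
  of \<open>k[V \<times> V] \<otimes> \<and>\<^sup>pV\<^sup>*\<close> is represented by a function \<open>F \<xi> \<eta> \<zeta>s\<close> that is polynomial in
  \<open>\<xi>, \<eta> \<in> V\<close> and alternating multilinear in the list \<open>\<zeta>s\<close> of \<open>p\<close> vectors of \<open>V\<close>, and that is zero
  outside this domain.\<close>

type_synonym 'k form = "'k vec \<Rightarrow> 'k vec \<Rightarrow> 'k vec list \<Rightarrow> 'k"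

inductive_set poly_funs :: "'k::field vec set \<Rightarrow> ('k vec \<Rightarrow> 'k vec \<Rightarrow> 'k) set"
  for V :: "'k::field vec set" where
  const: "(\<lambda>\<xi> \<eta>. a) \<in> poly_funs V"
| coord1: "\<phi> \<in> dual_space V \<Longrightarrow> (\<lambda>\<xi> \<eta>. \<phi> \<xi>) \<in> poly_funs V"
| coord2: "\<phi> \<in> dual_space V \<Longrightarrow> (\<lambda>\<xi> \<eta>. \<phi> \<eta>) \<in> poly_funs V"
| add: "f \<in> poly_funs V \<Longrightarrow> g \<in> poly_funs V \<Longrightarrow> (\<lambda>\<xi> \<eta>. f \<xi> \<eta> + g \<xi> \<eta>) \<in> poly_funs V"
| mult: "f \<in> poly_funs V \<Longrightarrow> g \<in> poly_funs V \<Longrightarrow> (\<lambda>\<xi> \<eta>. f \<xi> \<eta> * g \<xi> \<eta>) \<in> poly_funs V"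

text \<open>\<open>f \<otimes> \<phi>\<^sub>1 \<and> \<dots> \<and> \<phi>\<^sub>p\<close>, where \<open>\<phi>\<^sub>1 \<and> \<dots> \<and> \<phi>\<^sub>p\<close> is the alternating form \<open>det(\<phi>\<^sub>i(\<zeta>\<^sub>j))\<close>.\<close>

definition decomposable ::
    "'k::field vec set \<Rightarrow> ('k vec \<Rightarrow> 'k vec \<Rightarrow> 'k) \<Rightarrow> ('k vec \<Rightarrow> 'k) list \<Rightarrow> 'k form" where
  "decomposable V f \<phi>s = (\<lambda>\<xi> \<eta> \<zeta>s.
     if \<xi> \<in> V \<and> \<eta> \<in> V \<and> set \<zeta>s \<subseteq> V \<and> length \<zeta>s = length \<phi>s
     then f \<xi> \<eta> * det (mat (length \<phi>s) (length \<phi>s) (\<lambda>(i, j). (\<phi>s ! i) (\<zeta>s ! j))) else 0)"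

inductive_set forms :: "'k::field vec set \<Rightarrow> nat \<Rightarrow> 'k form set"
  for V :: "'k::field vec set" and p :: nat where
  zero: "0 \<in> forms V p"
| add: "\<lbrakk>F \<in> forms V p; f \<in> poly_funs V; length \<phi>s = p; set \<phi>s \<subseteq> dual_space V\<rbrakk>
        \<Longrightarrow> F + decomposable V f \<phi>s \<in> forms V p"

text \<open>The derivation with \<open>d\<phi>(\<xi>, \<eta>) = \<phi>([\<xi>, \<eta>])\<close> that vanishes in degree zero is the contraction
  with \<open>[\<xi>, \<eta>]\<close>; the lemma below is the Leibniz rule on decomposable elements.\<close>

definition koszul_diff :: "('k vec \<Rightarrow> 'k vec \<Rightarrow> 'k vec) \<Rightarrow> 'k form \<Rightarrow> 'k form" where
  "koszul_diff br F = (\<lambda>\<xi> \<eta> \<zeta>s. F \<xi> \<eta> (br \<xi> \<eta> # \<zeta>s))"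

lemma koszul_diff_decomposable:
  fixes V :: "'k::field vec set"
  assumes "\<And>x y. x \<in> V \<Longrightarrow> y \<in> V \<Longrightarrow> br x y \<in> V"
  shows "koszul_diff br (decomposable V f \<phi>s) \<xi> \<eta> \<zeta>s =
    (\<Sum>i<length \<phi>s. decomposable V (\<lambda>\<xi> \<eta>. (- 1) ^ i * (\<phi>s ! i) (br \<xi> \<eta>) * f \<xi> \<eta>)
       (take i \<phi>s @ drop (Suc i) \<phi>s) \<xi> \<eta> \<zeta>s)"
proof (cases "\<xi> \<in> V \<and> \<eta> \<in> V \<and> set \<zeta>s \<subseteq> V \<and> Suc (length \<zeta>s) = length \<phi>s")
  case True
  define p where "p = length \<zeta>s"
  have len: "length \<phi>s = Suc p" using True p_def by simp
  define A where "A = mat (Suc p) (Suc p) (\<lambda>(i, j). (\<phi>s ! i) ((br \<xi> \<eta> # \<zeta>s) ! j))"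
  have A: "A \<in> carrier_mat (Suc p) (Suc p)" by (simp add: A_def)
  have del: "mat_delete A i 0 =
      mat p p (\<lambda>(i', j). ((take i \<phi>s @ drop (Suc i) \<phi>s) ! i') (\<zeta>s ! j))" if i: "i < Suc p" for i
  proof (rule eq_matI)
    fix i' j assume "i' < dim_row (mat p p (\<lambda>(i', j). ((take i \<phi>s @ drop (Suc i) \<phi>s) ! i') (\<zeta>s ! j)))"
      and "j < dim_col (mat p p (\<lambda>(i', j). ((take i \<phi>s @ drop (Suc i) \<phi>s) ! i') (\<zeta>s ! j)))"
    then have "i' < p" "j < p" by simp_all
    moreover from i len this have "(take i \<phi>s @ drop (Suc i) \<phi>s) ! i' = \<phi>s ! (if i' < i then i' else Suc i')"
      by (simp add: nth_append)
    ultimately show "mat_delete A i 0 $$ (i', j) =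
        mat p p (\<lambda>(i', j). ((take i \<phi>s @ drop (Suc i) \<phi>s) ! i') (\<zeta>s ! j)) $$ (i', j)"
      by (simp add: mat_delete_def A_def)
  qed (simp_all add: mat_delete_def A_def)
  have "koszul_diff br (decomposable V f \<phi>s) \<xi> \<eta> \<zeta>s = f \<xi> \<eta> * det A"
    using True assms len by (simp add: koszul_diff_def decomposable_def A_def p_def)
  also have "det A = (\<Sum>i<Suc p. A $$ (i, 0) * cofactor A i 0)"
    by (rule laplace_expansion_column[OF A]) simp
  also have "f \<xi> \<eta> * \<dots> = (\<Sum>i<Suc p. f \<xi> \<eta> * (A $$ (i, 0) * cofactor A i 0))"
    by (rule sum_distrib_left)
  also have "\<dots> = (\<Sum>i<length \<phi>s. decomposable V (\<lambda>\<xi> \<eta>. (- 1) ^ i * (\<phi>s ! i) (br \<xi> \<eta>) * f \<xi> \<eta>)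
       (take i \<phi>s @ drop (Suc i) \<phi>s) \<xi> \<eta> \<zeta>s)"
  proof (rule sum.cong)
    fix i assume "i \<in> {..<length \<phi>s}"
    then have i: "i < Suc p" using len by simp
    have l: "length (take i \<phi>s @ drop (Suc i) \<phi>s) = p" using i len by simp
    have A0: "A $$ (i, 0) = (\<phi>s ! i) (br \<xi> \<eta>)" using i by (simp add: A_def)
    show "f \<xi> \<eta> * (A $$ (i, 0) * cofactor A i 0) =
        decomposable V (\<lambda>\<xi> \<eta>. (- 1) ^ i * (\<phi>s ! i) (br \<xi> \<eta>) * f \<xi> \<eta>)
          (take i \<phi>s @ drop (Suc i) \<phi>s) \<xi> \<eta> \<zeta>s"
      unfolding decomposable_def l cofactor_def del[OF i] A0 using True by (simp add: p_def)
  qed (simp add: len)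
  finally show ?thesis .
next
  case False
  have "decomposable V g (take i \<phi>s @ drop (Suc i) \<phi>s) \<xi> \<eta> \<zeta>s = 0" if "i < length \<phi>s" for i g
    using False that by (auto simp: decomposable_def)
  moreover have "koszul_diff br (decomposable V f \<phi>s) \<xi> \<eta> \<zeta>s = 0"
    using False by (auto simp: koszul_diff_def decomposable_def)
  ultimately show ?thesis by simp
qed

text \<open>\<open>F'\<close> is the base change of \<open>F\<close> to the algebraic closure; it is unique since \<open>k\<close> is infinite.\<close>

definition extends_form :: "'k::field vec set \<Rightarrow> 'k form \<Rightarrow> 'k alg_closure form \<Rightarrow> bool" where
  "extends_form V F F' \<longleftrightarrow> (\<forall>\<xi>\<in>V. \<forall>\<eta>\<in>V. \<forall>\<zeta>s. set \<zeta>s \<subseteq> V \<longrightarrow>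
     F' (map_vec to_ac \<xi>) (map_vec to_ac \<eta>) (map (map_vec to_ac) \<zeta>s) = to_ac (F \<xi> \<eta> \<zeta>s))"

definition preserves_form :: "'k::field vec set \<Rightarrow> 'k mat \<Rightarrow> 'k form \<Rightarrow> bool" where
  "preserves_form V \<gamma> F \<longleftrightarrow> (\<forall>\<xi>\<in>V. \<forall>\<eta>\<in>V. \<forall>\<zeta>s. set \<zeta>s \<subseteq> V \<longrightarrow>
     F (\<gamma> *\<^sub>v \<xi>) (\<gamma> *\<^sub>v \<eta>) (map (\<lambda>\<zeta>. \<gamma> *\<^sub>v \<zeta>) \<zeta>s) = F \<xi> \<eta> \<zeta>s)"

definition forms_G ::
    "nat \<Rightarrow> ('k::field_char_0 vec \<Rightarrow> 'k vec \<Rightarrow> 'k vec) \<Rightarrow> nat \<Rightarrow> 'k form set" where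
  "forms_G n br p = {F \<in> forms (carrier_vec n) p.
     \<exists>F'\<in>forms (carrier_vec n) p. extends_form (carrier_vec n) F F' \<and>
       (\<forall>\<gamma>\<in>Ad_group n br. preserves_form (carrier_vec n) \<gamma> F')}"

definition forms_W ::
    "nat \<Rightarrow> ('k::field_char_0 vec \<Rightarrow> 'k vec \<Rightarrow> 'k vec) \<Rightarrow> 'k vec set \<Rightarrow> nat \<Rightarrow> 'k form set" where
  "forms_W n br h p = {F \<in> forms h p.
     \<exists>F'\<in>forms (span_ac n h) p. extends_form h F F' \<and>
       (\<forall>\<gamma>\<in>cartan_normalizer n br h. preserves_form (span_ac n h) \<gamma> F')}"

definition restrict_form :: "'k::field vec set \<Rightarrow> 'k form \<Rightarrow> 'k form" where
  "restrict_form h F = (\<lambda>\<xi> \<eta> \<zeta>s. if \<xi> \<in> h \<and> \<eta> \<in> h \<and> set \<zeta>s \<subseteq> h then F \<xi> \<eta> \<zeta>s else 0)"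

definition restriction_quasi_iso ::
    "nat \<Rightarrow> ('k::field_char_0 vec \<Rightarrow> 'k vec \<Rightarrow> 'k vec) \<Rightarrow> 'k vec set \<Rightarrow> bool" where
  "restriction_quasi_iso n br h \<longleftrightarrow>
     quasi_iso (forms_G n br) (koszul_diff br) (forms_W n br h) (\<lambda>_. 0) (restrict_form h)"


section \<open>The quotient commuting scheme\<close>

text \<open>The ideal of \<open>k[\<gg> \<times> \<gg>]\<close> generated by the functions \<open>(\<xi>, \<eta>) \<mapsto> \<phi>([\<xi>, \<eta>])\<close>, \<open>\<phi> \<in> \<gg>\<^sup>*\<close>; the
  quotient is \<open>k[Rep\<^sub>\<gg>(\<aa>)]\<close>. It suffices to take the coordinate functions for \<open>\<phi>\<close>.\<close>

definition commuting_ideal ::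
    "nat \<Rightarrow> ('k::field vec \<Rightarrow> 'k vec \<Rightarrow> 'k vec) \<Rightarrow> ('k vec \<Rightarrow> 'k vec \<Rightarrow> 'k) set" where
  "commuting_ideal n br = {f \<in> poly_funs (carrier_vec n).
     \<exists>q. (\<forall>i<n. q i \<in> poly_funs (carrier_vec n)) \<and>
         (\<forall>\<xi>\<in>carrier_vec n. \<forall>\<eta>\<in>carrier_vec n. f \<xi> \<eta> = (\<Sum>i<n. q i \<xi> \<eta> * (br \<xi> \<eta> $ i)))}"

text \<open>Representatives of the elements of \<open>k[Rep\<^sub>\<gg>(\<aa>)]\<^sup>G\<close>: polynomial functions whose class modulo the
  ideal becomes \<open>G\<close>-invariant over the algebraic closure.\<close>

definition commuting_inv ::
    "nat \<Rightarrow> ('k::field_char_0 vec \<Rightarrow> 'k vec \<Rightarrow> 'k vec) \<Rightarrow> ('k vec \<Rightarrow> 'k vec \<Rightarrow> 'k) set" where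
  "commuting_inv n br = {f \<in> poly_funs (carrier_vec n).
     \<exists>f'\<in>poly_funs (carrier_vec n).
       (\<forall>\<xi>\<in>carrier_vec n. \<forall>\<eta>\<in>carrier_vec n.
          f' (map_vec to_ac \<xi>) (map_vec to_ac \<eta>) = to_ac (f \<xi> \<eta>)) \<and>
       (\<forall>\<gamma>\<in>Ad_group n br.
          (\<lambda>\<xi> \<eta>. f' (\<gamma> *\<^sub>v \<xi>) (\<gamma> *\<^sub>v \<eta>) - f' \<xi> \<eta>) \<in> commuting_ideal n (bracket_ac n br))}"

text \<open>\<open>Spec A\<close> is reduced if and only if \<open>A\<close> has no nonzero nilpotent elements.\<close>

definition quotient_commuting_scheme_reduced ::
    "nat \<Rightarrow> ('k::field_char_0 vec \<Rightarrow> 'k vec \<Rightarrow> 'k vec) \<Rightarrow> bool" where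
  "quotient_commuting_scheme_reduced n br \<longleftrightarrow>
     (\<forall>f\<in>commuting_inv n br. \<forall>r. (\<lambda>\<xi> \<eta>. f \<xi> \<eta> ^ r) \<in> commuting_ideal n br \<longrightarrow>
        f \<in> commuting_ideal n br)"

end

theory Submission
  imports Defs "Jordan_Normal_Form.Char_Poly"
begin

text \<open>Modulo the coaugmentation, \<open>Sym\<^sup>c(\<aa>[1])\<close> has the basis \<open>x, y, x \<and> y\<close>, so the generators of the
  Chevalley--Eilenberg algebra are two copies of \<open>\<gg>\<^sup>*\<close> in degree 0, the coordinates of \<open>(\<xi>, \<eta>)\<close>, and one
  copy in degree 1. It is therefore \<open>k[\<gg> \<times> \<gg>] \<otimes> \<and>\<gg>\<^sup>*\<close>. The coproduct
  \<open>x \<and> y \<mapsto> x \<otimes> y - y \<otimes> x\<close> makes \<open>d\<^sub>2\<close> the contraction with \<open>[\<xi>, \<eta>]\<close>, and \<open>\<Phi>\<^sub>\<gg>\<close> becomes restriction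
  of functions to \<open>\<hh>\<close>. Hence for every single \<open>\<gg>\<close> the two maps are isomorphic as maps of complexes.

  What is left is that the \<open>\<gg>\<close>-invariants are the \<open>G\<close>-invariants. An ad-nilpotent \<open>x\<close> annihilates \<open>f\<close> if
  and only if \<open>f\<close> is invariant under all \<open>exp (t ad x)\<close>. The annihilator of \<open>f\<close> is a Lie subalgebra; over
  the algebraic closure it contains, for every \<open>x\<close>, the ideal generated by the generalized eigenspaces
  of \<open>ad x\<close> with nonzero eigenvalues, since these consist of ad-nilpotent elements. Let \<open>I\<close> be the largest
  ideal in the annihilator and \<open>J\<close> a complementary ideal. For \<open>x \<in> J\<close>, high powers of \<open>ad x\<close> map into
  \<open>I \<inter> J = 0\<close>, so \<open>x\<close> is itself ad-nilpotent and annihilates \<open>f\<close>. Therefore \<open>I\<close> is everything.\<close>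

section \<open>Linear functionals on the symmetric algebra\<close>

text \<open>The obstacle is bookkeeping: elements are combinations of sorted words with Koszul
  signs, which makes formulas awkward to check on them directly. They are therefore tested by
  functionals \<open>lin hm \<phi>\<close> with \<open>supersym \<phi>\<close>, which do not notice
  sorting; products, derivations and substitutions become operations on \<phi>, and the values
  \<open>ev a b zs\<close> at two points and a list of vectors separate elements. The coefficient
  map \<open>hm\<close> is a parameter because the same formulas serve k, the polynomials k[t]
  carrying one-parameter groups, and the closure K. Two fields have to interact: over k every
  ad-nilpotent element may be central (so(3) over the reals), hence the eigenspaces and exponentials
  are taken over K, while reductivity is given over k and complements of ideals exist there.
  Iterated brackets of vectors over k link the two: they can be followed into an ideal over K, and
  membership in the annihilator descends from K to k.\<close>

abbreviation lookup where "lookup \<equiv> Poly_Mapping.lookup"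
abbreviation keys where "keys \<equiv> Poly_Mapping.keys"
abbreviation single where "single \<equiv> Poly_Mapping.single"
abbreviation C2 :: "'k::field dg_coalgebra" where "C2 \<equiv> sym_coalgebra2"

text \<open>A functional given by its values on words, with coefficients carried into the value ring
  by \<open>hm\<close>. The instances of \<open>hm\<close> are the identity, the constants in k[t]
  and \<open>to_ac\<close>.\<close>

definition lin :: "('k::field \<Rightarrow> 'r::comm_ring_1) \<Rightarrow> (gen list \<Rightarrow> 'r) \<Rightarrow> 'k salg \<Rightarrow> 'r" where
  "lin hm \<phi> f = (\<Sum>w\<in>keys f. hm (lookup f w) * \<phi> w)"

lemma lookup_scale [simp]: "lookup (scale a f) w = a * lookup f w"
  by (simp add: scale_def Poly_Mapping.map.rep_eq when_def)

lemma keys_scale_subset: "keys (scale a f) \<subseteq> keys f"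
  by (auto simp: in_keys_iff)

lemma scale_0_left [simp]: "scale 0 f = 0"
  by (rule poly_mapping_eqI) simp

lemma gdeg_C2 [simp]: "gdeg C2 x = (if snd x = 2 then 1 else 0)"
  by (simp add: gdeg_def sym_coalgebra2_def)

lemma odd_gdeg_C2: "odd (gdeg C2 x) \<longleftrightarrow> snd x = 2"
  by simp

text \<open>Values lie in a domain of characteristic 0 so that \<phi> = - \<phi> forces vanishing on
  repeated odd letters, and so that a nonzero polynomial cannot vanish at all natural
  numbers.\<close>

locale coeff_hom = comm_ring_hom hm for hm :: "'k::field \<Rightarrow> 'r::{idom,ring_char_0}"
begin

lemma lin_superset:
  assumes "finite A" "keys f \<subseteq> A"
  shows "lin hm \<phi> f = (\<Sum>w\<in>A. hm (lookup f w) * \<phi> w)"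
  unfolding lin_def
  by (rule sum.mono_neutral_left) (use assms in \<open>auto simp: in_keys_iff\<close>)

lemma lin_0 [simp]: "lin hm \<phi> 0 = 0"
  by (simp add: lin_def)

lemma lin_add: "lin hm \<phi> (f + g) = lin hm \<phi> f + lin hm \<phi> g"
proof -
  define A where "A = keys f \<union> keys g"
  have A: "finite A" "keys f \<subseteq> A" "keys g \<subseteq> A" "keys (f + g) \<subseteq> A"
    using Poly_Mapping.keys_add[of f g] by (auto simp: A_def)
  show ?thesis
    unfolding lin_superset[OF A(1,2)] lin_superset[OF A(1,3)] lin_superset[OF A(1,4)]
    by (simp add: lookup_add hom_add distrib_right sum.distrib)
qed

lemma lin_scale: "lin hm \<phi> (scale a f) = hm a * lin hm \<phi> f"
  unfolding lin_superset[OF finite_keys[of f] keys_scale_subset] lin_superset[OF finite_keys[of f] order_refl]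
  by (simp add: hom_mult sum_distrib_left mult.assoc)

lemma lin_uminus: "lin hm \<phi> (- f) = - lin hm \<phi> f"
proof -
  have "lin hm \<phi> (- f) + lin hm \<phi> f = lin hm \<phi> (- f + f)" by (simp only: lin_add)
  then show ?thesis by (simp add: eq_neg_iff_add_eq_0)
qed

lemma lin_diff: "lin hm \<phi> (f - g) = lin hm \<phi> f - lin hm \<phi> g"
  using lin_add[of \<phi> f "- g"] by (simp add: lin_uminus)

lemma lin_sum: "lin hm \<phi> (\<Sum>i\<in>A. f i) = (\<Sum>i\<in>A. lin hm \<phi> (f i))"
  by (induction A rule: infinite_finite_induct) (simp_all add: lin_add)

lemma lin_single [simp]: "lin hm \<phi> (single w a) = hm a * \<phi> w"
  by (cases "a = 0") (simp_all add: lin_def)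

lemma lin_gen_elem [simp]: "lin hm \<phi> (gen_elem x) = \<phi> [x]"
  by (simp add: gen_elem_def)

lemma lin_gen_map:
  "lin hm \<phi> (gen_map A x) = (\<Sum>j<dim_col A. hm (A $$ (fst x, j)) * \<phi> [(j, snd x)])"
  by (simp add: gen_map_def lin_sum lin_scale)

end

lemma lin_fun_add: "lin hm (\<lambda>w. \<phi> w + \<psi> w) f = lin hm \<phi> f + lin hm \<psi> f"
  by (simp add: lin_def distrib_left sum.distrib)

lemma lin_fun_mult: "lin hm (\<lambda>w. c * \<phi> w) f = c * lin hm \<phi> f"
  by (simp add: lin_def sum_distrib_left mult.left_commute)

lemma lin_fun_sum: "lin hm (\<lambda>w. \<Sum>i\<in>A. \<phi> i w) f = (\<Sum>i\<in>A. lin hm (\<phi> i) f)"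
  by (simp add: lin_def sum_distrib_left sum.swap[of _ A])

lemma lin_cong: "(\<And>w. w \<in> keys f \<Longrightarrow> \<phi> w = \<psi> w) \<Longrightarrow> lin hm \<phi> f = lin hm \<psi> f"
  by (simp add: lin_def)

text \<open>The functionals on words that factor through the symmetric algebra.\<close>

definition supersym :: "(gen list \<Rightarrow> 'r::comm_ring_1) \<Rightarrow> bool" where
  "supersym \<phi> \<longleftrightarrow> (\<forall>p x y q. \<phi> (p @ x # y # q) =
     (if snd x = 2 \<and> snd y = 2 then - 1 else 1) * \<phi> (p @ y # x # q))"

lemma supersymD:
  "supersym \<phi> \<Longrightarrow> \<phi> (p @ x # y # q) = (if snd x = 2 \<and> snd y = 2 then - 1 else 1) * \<phi> (p @ y # x # q)"
  unfolding supersym_def by blast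

lemma supersym_prepend:
  assumes "supersym \<phi>"
  shows "supersym (\<lambda>w. \<phi> (u @ w))"
  unfolding supersym_def
proof (intro allI)
  fix p q x y
  show "\<phi> (u @ p @ x # y # q) = (if snd x = 2 \<and> snd y = 2 then - 1 else 1) * \<phi> (u @ p @ y # x # q)"
    using supersymD[OF assms, of "u @ p" x y q] by (simp only: append_assoc)
qed

lemma supersym_Cons: "supersym \<phi> \<Longrightarrow> supersym (\<lambda>w. \<phi> (x # w))"
  using supersym_prepend[of \<phi> "[x]"] by simp

lemma supersym_append:
  assumes "supersym \<phi>"
  shows "supersym (\<lambda>w. \<phi> (w @ u))"
  unfolding supersym_def
proof (intro allI)
  fix p q x y
  show "\<phi> ((p @ x # y # q) @ u) = (if snd x = 2 \<and> snd y = 2 then - 1 else 1) * \<phi> ((p @ y # x # q) @ u)"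
    using supersymD[OF assms, of p x y "q @ u"] by (simp only: append_assoc append_Cons)
qed

text \<open>Insertion carries x past exactly the letters with strictly smaller key, and each odd one
  among them costs a sign if x is odd. The functional is generalized because every letter passed
  becomes part of its fixed prefix.\<close>

lemma supersym_insort:
  assumes "sorted (map prod_encode w)" "supersym \<phi>"
  shows "\<phi> (x # w) =
    (- 1) ^ (if snd x = 2 then length (filter (\<lambda>y. snd y = 2 \<and> prod_encode y < prod_encode x) w) else 0)
      * \<phi> (insort_key prod_encode x w)"
  using assms
proof (induction w arbitrary: \<phi>)
  case Nil
  then show ?case by simp
next
  case (Cons y w)
  show ?case
  proof (cases "prod_encode x \<le> prod_encode y")
    case True
    have "\<not> prod_encode z < prod_encode x" if "z \<in> set (y # w)" for z
      using that Cons.prems(1) True by (auto simp: not_less intro: order_trans)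
    then have "filter (\<lambda>z. snd z = 2 \<and> prod_encode z < prod_encode x) (y # w) = []"
      by (auto simp: filter_empty_conv)
    then show ?thesis using True by simp
  next
    case False
    have "\<phi> (x # y # w) = (if snd x = 2 \<and> snd y = 2 then - 1 else 1) * \<phi> (y # x # w)"
      using supersymD[OF Cons.prems(2), of "[]" x y w] by simp
    also have "\<phi> (y # x # w) =
        (- 1) ^ (if snd x = 2 then length (filter (\<lambda>y. snd y = 2 \<and> prod_encode y < prod_encode x) w) else 0)
        * \<phi> (y # insort_key prod_encode x w)"
      using Cons.IH[OF _ supersym_Cons[OF Cons.prems(2), of y]] Cons.prems(1) by simp
    finally show ?thesis using False by (auto simp: not_le)
  qed
qed

text \<open>Swaps bring the two copies of x next to each other up to sign; exchanging neighbouring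
  equal odd letters shows that the value is its own negative.\<close>

lemma supersym_repeat:
  fixes \<phi> :: "gen list \<Rightarrow> 'r::{idom,ring_char_0}"
  assumes "supersym \<phi>" "snd x = 2" "count_list w x > 1"
  shows "\<phi> w = 0"
proof -
  have rep: "\<phi> (x # q @ x # r) = 0" if "supersym \<phi>" for q r and \<phi> :: "gen list \<Rightarrow> 'r"
    using that
  proof (induction q arbitrary: \<phi>)
    case Nil
    have "\<phi> (x # x # r) = - \<phi> (x # x # r)"
      using supersymD[OF Nil, of "[]" x x r] assms(2) by simp
    then have "2 * \<phi> (x # x # r) = 0" by (metis add.right_inverse mult_2)
    then show ?case by simp
  next
    case (Cons y q)
    have "\<phi> (y # x # q @ x # r) = 0"
      using Cons.IH[OF supersym_Cons[OF Cons.prems, of y]] by simp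
    then show ?case
      using supersymD[OF Cons.prems, of "[]" x y "q @ x # r"] by simp
  qed
  have "x \<in> set w" using assms(3) by (metis count_list_0_iff not_less_zero)
  then obtain p s where w: "w = p @ x # s" "x \<notin> set p" by (meson split_list_first)
  then have "count_list s x \<noteq> 0"
    using assms(3) by (simp add: count_notin)
  then have "x \<in> set s" by (metis count_notin)
  then obtain q r where s: "s = q @ x # r" by (meson split_list)
  show ?thesis unfolding w(1) s using rep[OF supersym_prepend[OF assms(1), of p]] by simp
qed

definition inversions :: "gen list \<Rightarrow> nat" where
  "inversions w = card {(a, b). a < b \<and> b < length w \<and> snd (w ! a) = 2 \<and> snd (w ! b) = 2 \<and>
                               prod_encode (w ! b) < prod_encode (w ! a)}"

lemma inversions_Nil [simp]: "inversions [] = 0"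
  by (simp add: inversions_def)

text \<open>An inversion either involves position 0 or is a shifted inversion of the tail; the
  number of the former is the sign exponent of one insertion step.\<close>

lemma inversions_Cons:
  "inversions (x # w) =
     (if snd x = 2 then length (filter (\<lambda>y. snd y = 2 \<and> prod_encode y < prod_encode x) w) else 0)
     + inversions w"
proof -
  let ?I = "\<lambda>w. {(a, b). a < b \<and> b < length w \<and> snd (w ! a) = 2 \<and> snd (w ! b) = 2 \<and>
                               prod_encode (w ! b) < prod_encode (w ! a)}"
  let ?A = "{b. b < length w \<and> snd x = 2 \<and> snd (w ! b) = 2 \<and> prod_encode (w ! b) < prod_encode x}"
  have fin: "finite (?I v)" for v :: "gen list"
    by (rule finite_subset[of _ "{..<length v} \<times> {..<length v}"]) auto
  have split: "?I (x # w) = (\<lambda>b. (0, Suc b)) ` ?A \<union> (\<lambda>(a, b). (Suc a, Suc b)) ` ?I w"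
  proof (intro Set.set_eqI iffI)
    fix z assume z: "z \<in> ?I (x # w)"
    obtain a b where ab: "z = (a, b)" by (cases z)
    from z ab obtain b' where b': "b = Suc b'" by (cases b) auto
    show "z \<in> (\<lambda>b. (0, Suc b)) ` ?A \<union> (\<lambda>(a, b). (Suc a, Suc b)) ` ?I w"
    proof (cases a)
      case 0
      then have "b' \<in> ?A" using z ab b' by simp
      then show ?thesis using ab b' 0 by blast
    next
      case (Suc a')
      then have "(a', b') \<in> ?I w" using z ab b' by simp
      then show ?thesis using ab b' Suc by force
    qed
  qed auto
  have "card (?I (x # w)) = card ((\<lambda>b. (0::nat, Suc b)) ` ?A) + card ((\<lambda>(a, b). (Suc a, Suc b)) ` ?I w)"
    unfolding split by (rule card_Un_disjoint) (use fin in auto)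
  also have "card ((\<lambda>b. (0::nat, Suc b)) ` ?A) = card ?A"
    by (rule card_image) (auto simp: inj_on_def)
  also have "card ((\<lambda>(a, b). (Suc a, Suc b)) ` ?I w) = card (?I w)"
    by (rule card_image) (auto simp: inj_on_def)
  also have "card ?A =
    (if snd x = 2 then length (filter (\<lambda>y. snd y = 2 \<and> prod_encode y < prod_encode x) w) else 0)"
    by (simp add: length_filter_conv_card)
  finally show ?thesis unfolding inversions_def .
qed

lemma word_prod_C2:
  "word_prod C2 w = (if \<exists>x. snd x = 2 \<and> count_list w x > 1 then 0
     else single (sort_key prod_encode w) ((- 1) ^ inversions w))"
  by (simp only: word_prod_def inversions_def odd_gdeg_C2)

text \<open>Insertion sort, one letter at a time: sort the tail, then insert the head. Sorting the
  tail leaves the number of smaller odd letters unchanged, so the exponents add up to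
  \<open>inversions\<close>.\<close>

lemma supersym_sort:
  assumes "supersym \<phi>"
  shows "\<phi> w = (- 1) ^ inversions w * \<phi> (sort_key prod_encode w)"
  using assms
proof (induction w arbitrary: \<phi>)
  case Nil
  then show ?case by simp
next
  case (Cons x w)
  have *: "length (filter P (sort_key prod_encode w)) = length (filter P w)" for P
    by (simp add: filter_sort)
  have "\<phi> (x # w) = (- 1) ^ inversions w * \<phi> (x # sort_key prod_encode w)"
    using Cons.IH[OF supersym_Cons[OF Cons.prems, of x]] .
  also have "\<phi> (x # sort_key prod_encode w) =
    (- 1) ^ (if snd x = 2 then length (filter (\<lambda>y. snd y = 2 \<and> prod_encode y < prod_encode x) w) else 0)
      * \<phi> (sort_key prod_encode (x # w))"
    using supersym_insort[OF sorted_sort_key Cons.prems, of x w] by (simp add: *)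
  finally show ?case by (simp add: inversions_Cons power_add mult_ac)
qed

context coeff_hom
begin

lemma hom_neg_one_power: "hm ((- 1) ^ n) = (- 1) ^ n"
  by (simp add: hom_power hom_uminus)

text \<open>The reason for \<open>supersym\<close>: the sign and the zero in the definition of
  \<open>word_prod\<close> are exactly those that \<phi> produces on the unsorted word.
  Multiplication thereby becomes concatenation.\<close>

lemma lin_word_prod: "supersym \<phi> \<Longrightarrow> lin hm \<phi> (word_prod C2 w) = \<phi> w"
  using supersym_repeat[of \<phi>] supersym_sort[of \<phi> w]
  by (auto simp: word_prod_C2 hom_neg_one_power)

lemma lin_smul:
  "supersym \<phi> \<Longrightarrow> lin hm \<phi> (smul C2 f g) = lin hm (\<lambda>u. lin hm (\<lambda>v. \<phi> (u @ v)) g) f"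
  by (simp add: smul_def lin_sum lin_scale lin_word_prod hom_mult)
     (simp add: lin_def sum_distrib_left mult.assoc)

end

section \<open>Evaluation of words\<close>

definition coord :: "gen \<Rightarrow> 'r vec \<Rightarrow> 'r vec \<Rightarrow> 'r" where
  "coord x a b = (if snd x = 0 then a $ fst x else b $ fst x)"

definition odds :: "gen list \<Rightarrow> nat list" where
  "odds w = map fst (filter (\<lambda>x. snd x = 2) w)"

definition evens :: "gen list \<Rightarrow> gen list" where
  "evens w = filter (\<lambda>x. snd x \<noteq> 2) w"

text \<open>The value at (a, b) and \<open>zs\<close> of the form that the word stands for: even
  letters are coordinates of the points, odd letters a wedge of coordinate forms in the determinant
  convention of \<open>decomposable\<close>. A wrong number of vectors gives 0, so one family of
  functionals serves all exterior degrees.\<close>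

definition ev :: "'r::comm_ring_1 vec \<Rightarrow> 'r vec \<Rightarrow> 'r vec list \<Rightarrow> gen list \<Rightarrow> 'r" where
  "ev a b zs w = prod_list (map (\<lambda>x. coord x a b) (evens w)) *
     (if length zs = length (odds w)
      then det (mat (length zs) (length zs) (\<lambda>(i, j). (zs ! j) $ (odds w ! i))) else 0)"

abbreviation mult_vecs :: "'r::semiring_0 mat \<Rightarrow> 'r vec list \<Rightarrow> 'r vec list" where
  "mult_vecs A \<equiv> map (\<lambda>z. A *\<^sub>v z)"

definition remove_nth :: "nat \<Rightarrow> 'a list \<Rightarrow> 'a list" where
  "remove_nth s zs = take s zs @ drop (Suc s) zs"

lemma length_remove_nth [simp]: "s < length zs \<Longrightarrow> length (remove_nth s zs) = length zs - 1"
  by (simp add: remove_nth_def)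

lemma nth_remove_nth: "s < length zs \<Longrightarrow> j < length zs - 1 \<Longrightarrow>
   remove_nth s zs ! j = zs ! (if j < s then j else Suc j)"
  by (auto simp: remove_nth_def nth_append)

lemma map_remove_nth: "map f (remove_nth s zs) = remove_nth s (map f zs)"
  by (simp add: remove_nth_def take_map drop_map)

lemma ev_Nil [simp]: "ev a b zs [] = (if zs = [] then 1 else 0)"
  by (simp add: ev_def evens_def odds_def)

lemma ev_even: "snd x \<noteq> 2 \<Longrightarrow> ev a b zs (x # w) = coord x a b * ev a b zs w"
  by (simp add: ev_def evens_def odds_def mult.assoc)

text \<open>Laplace expansion along the first row, with rows labelled by arbitrary objects: by
  coordinate indices in \<open>ev_odd\<close>, by linear forms in
  \<open>exterior_surj\<close>.\<close>

lemma det_Cons: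
  fixes h :: "'b \<Rightarrow> 'c \<Rightarrow> 'r::comm_ring_1"
  assumes "length rs = p" "length zs = Suc p"
  shows "det (mat (Suc p) (Suc p) (\<lambda>(i, j). h ((r # rs) ! i) (zs ! j))) =
    (\<Sum>s<Suc p. (- 1) ^ s * h r (zs ! s) * det (mat p p (\<lambda>(i, j). h (rs ! i) (remove_nth s zs ! j))))"
proof -
  define A where "A = mat (Suc p) (Suc p) (\<lambda>(i, j). h ((r # rs) ! i) (zs ! j))"
  have del: "mat_delete A 0 s = mat p p (\<lambda>(i, j). h (rs ! i) (remove_nth s zs ! j))"
    if "s < Suc p" for s
    by (rule eq_matI) (use that assms in \<open>auto simp: mat_delete_def A_def nth_remove_nth\<close>)
  have "det A = (\<Sum>s<Suc p. A $$ (0, s) * cofactor A 0 s)"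
    by (rule laplace_expansion_row[of _ "Suc p"]) (auto simp: A_def)
  also have "\<dots> = (\<Sum>s<Suc p. (- 1) ^ s * h r (zs ! s) *
      det (mat p p (\<lambda>(i, j). h (rs ! i) (remove_nth s zs ! j))))"
  proof (rule sum.cong[OF refl])
    fix s assume "s \<in> {..<Suc p}"
    then have s: "s < Suc p" by simp
    have "A $$ (0, s) = h r (zs ! s)" using s by (simp add: A_def)
    then show "A $$ (0, s) * cofactor A 0 s = (- 1) ^ s * h r (zs ! s) *
        det (mat p p (\<lambda>(i, j). h (rs ! i) (remove_nth s zs ! j)))"
      unfolding cofactor_def del[OF s] by simp
  qed
  finally show ?thesis by (simp add: A_def)
qed

text \<open>Expansion along the row of x. Together with \<open>ev_even\<close> it makes
  \<open>ev\<close> a recursion on words, which replaces determinants in the later inductions on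
  words.\<close>

lemma ev_odd:
  assumes x: "snd x = 2"
  shows "ev a b zs (x # w) =
    (\<Sum>s<length zs. (- 1) ^ s * (zs ! s $ fst x) * ev a b (remove_nth s zs) w)"
proof (cases "length zs = Suc (length (odds w))")
  case True
  have "odds (x # w) = fst x # odds w" "evens (x # w) = evens w"
    using x by (simp_all add: odds_def evens_def)
  then show ?thesis
    using True det_Cons[OF refl True, of "\<lambda>r z. vec_index z r" "fst x"]
    by (simp add: ev_def sum_distrib_left mult_ac del: sum.lessThan_Suc)
next
  case False
  then have "ev a b zs (x # w) = 0" using x by (simp add: ev_def odds_def)
  moreover have "ev a b (remove_nth s zs) w = 0" if "s < length zs" for s
    using False that by (simp add: ev_def)
  ultimately show ?thesis by simp
qed

text \<open>Two odd letters exchange two rows of the determinant. In the other cases an even letter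
  merely contributes a scalar factor.\<close>

lemma ev_swap:
  "ev a b zs (x # y # w) = (if snd x = 2 \<and> snd y = 2 then - 1 else 1) * ev a b zs (y # x # w)"
proof (cases "snd x = 2 \<and> snd y = 2")
  case True
  define p where "p = length zs"
  show ?thesis
  proof (cases "length zs = Suc (Suc (length (odds w)))")
    case len: True
    let ?M = "\<lambda>w. mat p p (\<lambda>(i, j). (zs ! j) $ (odds w ! i))"
    have o: "odds (x # y # w) = fst x # fst y # odds w" "odds (y # x # w) = fst y # fst x # odds w"
      using True by (simp_all add: odds_def)
    have "?M (x # y # w) = swaprows 0 1 (?M (y # x # w))"
      by (rule eq_matI) (use len in \<open>auto simp: o p_def nth_Cons'\<close>)
    then have "det (?M (x # y # w)) = - det (?M (y # x # w))"
      using det_swaprows[of 0 p 1 "?M (y # x # w)"] len by (simp add: p_def)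
    then show ?thesis using True len by (simp add: ev_def evens_def p_def o)
  next
    case False
    then show ?thesis using True by (simp add: ev_def odds_def)
  qed
next
  case False
  then show ?thesis
    by (cases "snd x = 2"; cases "snd y = 2") (simp_all add: ev_even ev_odd sum_distrib_left mult_ac)
qed

text \<open>Induction over the common prefix; \<open>zs\<close> varies because an odd prefix letter
  consumes one of the vectors.\<close>

lemma supersym_ev: "supersym (ev a b zs)"
  unfolding supersym_def
proof (intro allI)
  fix p q :: "gen list" and x y :: gen
  show "ev a b zs (p @ x # y # q) =
      (if snd x = 2 \<and> snd y = 2 then - 1 else 1) * ev a b zs (p @ y # x # q)"
  proof (induction p arbitrary: zs)
    case Nil
    then show ?case using ev_swap[of a b zs x y q] by simp
  next
    case (Cons z p)
    show ?case
    proof (cases "snd z = 2")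
      case True
      then show ?thesis by (simp add: ev_odd Cons.IH sum_distrib_left mult_ac del: mult_minus1)
    next
      case False
      then show ?thesis by (simp add: ev_even Cons.IH mult_ac)
    qed
  qed
qed

section \<open>Derivations\<close>

lemma cdiff_C2 [simp]: "cdiff C2 c p = 0"
  by (simp add: sym_coalgebra2_def)

lemma cop_C2: "cop C2 c p q =
    (if (c, p, q) = (2, 0, 1) then 1 else if (c, p, q) = (2, 1, 0) then - 1 else 0)"
  by (simp add: sym_coalgebra2_def)

text \<open>The transpose of \<open>derivation_word\<close>: the derivation acts on functionals and
  the word is left alone, so products of letters never have to be normalized.\<close>

fun word_der ::
    "('k::field \<Rightarrow> 'r::comm_ring_1) \<Rightarrow> nat \<Rightarrow> (gen \<Rightarrow> 'k salg) \<Rightarrow> (gen list \<Rightarrow> 'r) \<Rightarrow> gen list \<Rightarrow> 'r" where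
  "word_der hm e \<delta> \<phi> [] = 0"
| "word_der hm e \<delta> \<phi> (x # w) = lin hm (\<lambda>u. \<phi> (u @ w)) (\<delta> x) +
     (- 1) ^ (e * gdeg (C2 :: 'k dg_coalgebra) x) * word_der hm e \<delta> (\<lambda>v. \<phi> (x # v)) w"

lemma word_der_fun_mult: "word_der hm e \<delta> (\<lambda>w. c * \<phi> w) w = c * word_der hm e \<delta> \<phi> w"
  by (induction w arbitrary: \<phi>) (simp_all add: lin_fun_mult distrib_left mult.left_commute)

lemma word_der_fun_sum:
  "word_der hm e \<delta> (\<lambda>w. \<Sum>i\<in>A. \<phi> i w) w = (\<Sum>i\<in>A. word_der hm e \<delta> (\<phi> i) w)"
  by (induction w arbitrary: \<phi>) (simp_all add: lin_fun_sum sum.distrib sum_distrib_left)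

text \<open>The transpose of a derivation of degree 0 that acts on the first index of generators by
  the matrix D. Degree 0 means that no sign occurs when a letter is passed.\<close>

fun mat_der ::
    "nat \<Rightarrow> (nat \<Rightarrow> nat \<Rightarrow> 'r::comm_ring_1) \<Rightarrow> (gen list \<Rightarrow> 'r) \<Rightarrow> gen list \<Rightarrow> 'r" where
  "mat_der n D \<phi> [] = 0"
| "mat_der n D \<phi> (x # w) = (\<Sum>j<n. D (fst x) j * \<phi> ((j, snd x) # w)) + mat_der n D (\<lambda>v. \<phi> (x # v)) w"

lemma mat_der_fun_add:
  "mat_der n D (\<lambda>w. \<phi> w + \<psi> w) w = mat_der n D \<phi> w + mat_der n D \<psi> w"
  by (induction w arbitrary: \<phi> \<psi>) (simp_all add: distrib_left sum.distrib)

lemma mat_der_fun_mult: "mat_der n D (\<lambda>w. c * \<phi> w) w = c * mat_der n D \<phi> w"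
  by (induction w arbitrary: \<phi>) (simp_all add: distrib_left sum_distrib_left mult.left_commute)

lemma mat_der_fun_sum:
  "mat_der n D (\<lambda>w. \<Sum>i\<in>A. \<phi> i w) w = (\<Sum>i\<in>A. mat_der n D (\<phi> i) w)"
  by (induction w arbitrary: \<phi>)
     (simp_all add: sum.distrib sum_distrib_left sum.swap[of _ A])

lemma mat_der_add:
  "mat_der n (\<lambda>i j. D i j + D' i j) \<phi> w = mat_der n D \<phi> w + mat_der n D' \<phi> w"
  by (induction w arbitrary: \<phi>) (simp_all add: distrib_right sum.distrib)

lemma mat_der_mult: "mat_der n (\<lambda>i j. c * D i j) \<phi> w = c * mat_der n D \<phi> w"
  by (induction w arbitrary: \<phi>) (simp_all add: distrib_left sum_distrib_left mult.assoc)

lemma mat_der_cong: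
  assumes "\<And>i j. i < n \<Longrightarrow> j < n \<Longrightarrow> D i j = D' i j" "fst ` set w \<subseteq> {..<n}"
  shows "mat_der n D \<phi> w = mat_der n D' \<phi> w"
  using assms(2) by (induction w arbitrary: \<phi>) (simp_all add: assms(1))

text \<open>In the composite, the terms that replace two different letters are symmetric in D and D'
  and cancel. Those that replace the same letter twice form the matrix commutator.\<close>

lemma mat_der_commutator:
  assumes "fst ` set w \<subseteq> {..<n}"
  shows "mat_der n D (mat_der n D' \<phi>) w - mat_der n D' (mat_der n D \<phi>) w =
     mat_der n (\<lambda>i j. (\<Sum>l<n. D i l * D' l j) - (\<Sum>l<n. D' i l * D l j)) \<phi> w"
proof (induction w arbitrary: \<phi>)
  case Nil
  then show ?case by simp
next
  case (Cons x w)
  have exp: "mat_der n D (mat_der n D' \<phi>) (x # w) =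
      (\<Sum>l<n. (\<Sum>j<n. D (fst x) j * D' j l) * \<phi> ((l, snd x) # w)) +
      (\<Sum>j<n. D (fst x) j * mat_der n D' (\<lambda>v. \<phi> ((j, snd x) # v)) w) +
      (\<Sum>j<n. D' (fst x) j * mat_der n D (\<lambda>v. \<phi> ((j, snd x) # v)) w) +
      mat_der n D (mat_der n D' (\<lambda>v. \<phi> (x # v))) w" for D D'
  proof -
    have "(\<Sum>j<n. D (fst x) j * (\<Sum>l<n. D' j l * \<phi> ((l, snd x) # w))) =
      (\<Sum>j<n. \<Sum>l<n. D (fst x) j * D' j l * \<phi> ((l, snd x) # w))"
      by (simp add: sum_distrib_left mult.assoc)
    also have "\<dots> = (\<Sum>l<n. (\<Sum>j<n. D (fst x) j * D' j l) * \<phi> ((l, snd x) # w))"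
      by (subst sum.swap) (simp add: sum_distrib_right)
    finally show ?thesis
      by (simp add: distrib_left sum.distrib mat_der_fun_add mat_der_fun_sum mat_der_fun_mult)
  qed
  show ?case
    unfolding exp[of D D'] exp[of D' D] using Cons.IH[of "\<lambda>v. \<phi> (x # v)"]
    by (simp add: left_diff_distrib sum_subtractf algebra_simps)
qed

text \<open>Replacing the first index of a letter keeps its parity, hence its swap signs. This
  allows \<open>lin_coad_action\<close> to be applied twice in a row.\<close>

lemma supersym_mat_der:
  assumes "supersym \<phi>"
  shows "supersym (mat_der n D \<phi>)"
  unfolding supersym_def
proof (intro allI)
  fix p q :: "gen list" and x y :: gen
  show "mat_der n D \<phi> (p @ x # y # q) =
      (if snd x = 2 \<and> snd y = 2 then - 1 else 1) * mat_der n D \<phi> (p @ y # x # q)"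
    using assms
  proof (induction p arbitrary: \<phi>)
    case Nil
    define \<sigma> :: 'a where "\<sigma> = (if snd x = 2 \<and> snd y = 2 then - 1 else 1)"
    have sw: "\<phi> (u # v # r) = \<sigma> * \<phi> (v # u # r)" if "snd u = snd x" "snd v = snd y" for u v r
      using supersymD[OF Nil, of "[]" u v r] that by (simp only: \<sigma>_def append_Nil)
    have s: "\<phi> ((j, snd x) # y # r) = \<sigma> * \<phi> (y # (j, snd x) # r)"
      "\<phi> (x # (j, snd y) # r) = \<sigma> * \<phi> ((j, snd y) # x # r)"
      "\<phi> (x # y # r) = \<sigma> * \<phi> (y # x # r)" for j r
      by (rule sw; simp)+
    show ?case
      unfolding \<sigma>_def[symmetric]
      by (simp add: s mat_der_fun_mult distrib_left sum_distrib_left mult.left_commute)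
  next
    case (Cons z p)
    have "\<phi> (u # p @ x # y # q) = (if snd x = 2 \<and> snd y = 2 then - 1 else 1) * \<phi> (u # p @ y # x # q)" for u
      using supersymD[OF Cons.prems, of "u # p" x y q] by (simp only: append_Cons)
    then show ?case
      using Cons.IH[OF supersym_Cons[OF Cons.prems, of z]]
      by (cases "snd x = 2 \<and> snd y = 2") (auto simp: sum_negf)
  qed
qed

context coeff_hom
begin

lemma lin_derivation_word:
  "supersym \<phi> \<Longrightarrow> lin hm \<phi> (derivation_word C2 e \<delta> w) = word_der hm e \<delta> \<phi> w"
proof (induction w arbitrary: \<phi>)
  case (Cons x w)
  show ?case
    using Cons.IH[OF supersym_Cons[OF Cons.prems, of x]]
    by (simp add: lin_add lin_scale lin_smul[OF Cons.prems] hom_neg_one_power)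
qed simp

lemma lin_derivation:
  "supersym \<phi> \<Longrightarrow> lin hm \<phi> (derivation C2 e \<delta> f) = lin hm (word_der hm e \<delta> \<phi>) f"
  by (simp add: derivation_def lin_sum lin_scale lin_derivation_word) (simp add: lin_def)

lemma lin_coad_action:
  assumes "supersym \<phi>"
  shows "lin hm \<phi> (coad_action C2 n br x f) =
    lin hm (mat_der n (\<lambda>i j. hm (- (br x (unit_vec n j) $ i))) \<phi>) f"
proof -
  have "word_der hm 0 (\<lambda>(i, c). \<Sum>j<n. scale (- (br x (unit_vec n j) $ i)) (gen_elem (j, c))) \<phi> w
     = mat_der n (\<lambda>i j. hm (- (br x (unit_vec n j) $ i))) \<phi> w" for w
    by (induction w arbitrary: \<phi>) (simp_all add: case_prod_beta lin_sum lin_scale)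
  then show ?thesis
    unfolding coad_action_def lin_derivation[OF assms] by (simp add: lin_def)
qed

lemma lin_gen_map_smul:
  assumes "supersym \<phi>"
  shows "lin hm \<phi> (smul C2 (gen_map A x) g) =
    (\<Sum>j<dim_col A. hm (A $$ (fst x, j)) * lin hm (\<lambda>v. \<phi> ((j, snd x) # v)) g)"
  unfolding lin_smul[OF assms] lin_gen_map by simp

text \<open>Induction on the word: an odd head gives a sum over the entries of its row of A and a
  sum over the vectors consumed. Exchanging the two sums assembles the coordinate of A applied to
  the vector.\<close>

lemma lin_ev_foldr_gen_map:
  assumes A: "A \<in> carrier_mat n m" and a: "a \<in> carrier_vec m" and b: "b \<in> carrier_vec m"
    and zs: "set zs \<subseteq> carrier_vec m" and w: "fst ` set w \<subseteq> {..<n}"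
  shows "lin hm (ev a b zs) (foldr (\<lambda>x g. smul C2 (gen_map A x) g) w (single [] 1)) =
    ev (map_mat hm A *\<^sub>v a) (map_mat hm A *\<^sub>v b) (mult_vecs (map_mat hm A) zs) w"
  using zs w
proof (induction w arbitrary: zs)
  case Nil
  then show ?case by simp
next
  case (Cons x w)
  let ?M = "\<lambda>z. map_mat hm A *\<^sub>v z"
  let ?g = "foldr (\<lambda>x g. smul C2 (gen_map A x) g) w (single [] 1)"
  have x: "fst x < n" using Cons.prems by auto
  have mv: "?M z $ fst x = (\<Sum>j<m. hm (A $$ (fst x, j)) * z $ j)" if "z \<in> carrier_vec m" for z
    using A x that by (simp add: scalar_prod_def lessThan_atLeast0)
  show ?case
  proof (cases "snd x = 2")
    case True
    have "lin hm (ev a b zs) (smul C2 (gen_map A x) ?g) =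
      (\<Sum>j<m. hm (A $$ (fst x, j)) * (\<Sum>s<length zs. (- 1) ^ s * (zs ! s $ j) * lin hm (ev a b (remove_nth s zs)) ?g))"
      using A True by (simp add: lin_gen_map_smul[OF supersym_ev] ev_odd lin_fun_sum lin_fun_mult)
    also have "\<dots> = (\<Sum>s<length zs. (- 1) ^ s * (?M (zs ! s) $ fst x) * lin hm (ev a b (remove_nth s zs)) ?g)"
      unfolding sum_distrib_left
    proof (subst sum.swap, rule sum.cong[OF refl])
      fix s assume "s \<in> {..<length zs}"
      then have z: "zs ! s \<in> carrier_vec m" using Cons.prems by (auto dest: nth_mem)
      show "(\<Sum>j<m. hm (A $$ (fst x, j)) * ((- 1) ^ s * (zs ! s $ j) * lin hm (ev a b (remove_nth s zs)) ?g)) =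
         (- 1) ^ s * (?M (zs ! s) $ fst x) * lin hm (ev a b (remove_nth s zs)) ?g"
        unfolding mv[OF z] by (simp add: sum_distrib_left sum_distrib_right mult_ac)
    qed
    also have "\<dots> = (\<Sum>s<length zs. (- 1) ^ s * (?M (zs ! s) $ fst x) *
        ev (?M a) (?M b) (map ?M (remove_nth s zs)) w)"
    proof (rule sum.cong[OF refl])
      fix s
      have "set (remove_nth s zs) \<subseteq> carrier_vec m"
        using Cons.prems(1) by (auto simp: remove_nth_def dest: in_set_takeD in_set_dropD)
      then show "(- 1) ^ s * (?M (zs ! s) $ fst x) * lin hm (ev a b (remove_nth s zs)) ?g =
        (- 1) ^ s * (?M (zs ! s) $ fst x) * ev (?M a) (?M b) (map ?M (remove_nth s zs)) w"
        using Cons.IH Cons.prems(2) by simp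
    qed
    finally show ?thesis using True by (simp add: ev_odd map_remove_nth)
  next
    case False
    have "coord x (?M a) (?M b) = (\<Sum>j<m. hm (A $$ (fst x, j)) * coord (j, snd x) a b)"
      by (simp add: coord_def mv[OF a] mv[OF b])
    moreover have "lin hm (ev a b zs) (smul C2 (gen_map A x) ?g) =
      (\<Sum>j<m. hm (A $$ (fst x, j)) * coord (j, snd x) a b * lin hm (ev a b zs) ?g)"
      using A False by (simp add: lin_gen_map_smul[OF supersym_ev] ev_even lin_fun_mult mult.assoc)
    ultimately show ?thesis
      using Cons.IH[OF Cons.prems(1)] Cons.prems(2) False by (simp add: ev_even sum_distrib_right)
  qed
qed

text \<open>\<open>sym_map\<close> is pullback of functions along A. With A = B this is restriction
  to the Cartan subalgebra, with a Weyl group matrix it is the action on functions there.\<close>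

lemma lin_ev_sym_map:
  assumes A: "A \<in> carrier_mat n m" and a: "a \<in> carrier_vec m" and b: "b \<in> carrier_vec m"
    and zs: "set zs \<subseteq> carrier_vec m" and f: "\<And>w. w \<in> keys f \<Longrightarrow> fst ` set w \<subseteq> {..<n}"
  shows "lin hm (ev a b zs) (sym_map C2 A f) =
    lin hm (ev (map_mat hm A *\<^sub>v a) (map_mat hm A *\<^sub>v b) (mult_vecs (map_mat hm A) zs)) f"
  by (simp add: sym_map_def lin_sum lin_scale lin_ev_foldr_gen_map[OF A a b zs f]) (simp add: lin_def)

text \<open>Only the terms x \<otimes> y and - y \<otimes> x of the coproduct contribute. The sign
  from \<open>cdeg\<close> and the leading minus of \<open>ce_gen_d2\<close> cancel; antisymmetry of
  the bracket and commutation of even letters make the two contributions equal, which absorbs the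
  factor 1/2.\<close>

lemma lin_ce_gen:
  fixes br :: "'k vec \<Rightarrow> 'k vec \<Rightarrow> 'k vec"
  assumes "supersym \<phi>" "i < n"
    and anti: "\<And>j l. j < n \<Longrightarrow> l < n \<Longrightarrow> br (unit_vec n l) (unit_vec n j) $ i = - (br (unit_vec n j) (unit_vec n l) $ i)"
  shows "lin hm \<phi> (ce_gen_d1 C2 (i, 2) + ce_gen_d2 C2 n br (i, 2)) =
     (\<Sum>j<n. \<Sum>l<n. hm (br (unit_vec n j) (unit_vec n l) $ i) * \<phi> [(j, 0), (l, 1)])"
proof -
  let ?c = "\<lambda>j l. br (unit_vec n j) (unit_vec n l) $ i"
  have sm: "lin hm \<phi> (smul C2 (gen_elem x) (gen_elem y)) = \<phi> [x, y]" for x y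
    by (simp add: lin_smul[OF assms(1)])
  have sw: "\<phi> [(j, 1), (l, 0)] = \<phi> [(l, 0), (j, 1)]" for j l
    using supersymD[OF assms(1), of "[]" "(j, 1)" "(l, 0)" "[]"] by simp
  have "lin hm \<phi> (ce_gen_d1 C2 (i, 2)) = 0"
    by (simp add: ce_gen_d1_def lin_uminus lin_diff lin_sum lin_scale sym_coalgebra2_def)
  moreover have "lin hm \<phi> (ce_gen_d2 C2 n br (i, 2)) =
     (\<Sum>j<n. \<Sum>l<n. hm (?c j l / 2) * \<phi> [(j, 0), (l, 1)]) - (\<Sum>j<n. \<Sum>l<n. hm (?c j l / 2) * \<phi> [(j, 1), (l, 0)])"
    by (simp add: ce_gen_d2_def lin_uminus lin_sum lin_scale sm)
       (simp add: sym_coalgebra2_def hom_uminus sum_negf)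
  moreover have "(\<Sum>j<n. \<Sum>l<n. hm (?c j l / 2) * \<phi> [(j, 1), (l, 0)]) =
     - (\<Sum>j<n. \<Sum>l<n. hm (?c j l / 2) * \<phi> [(j, 0), (l, 1)])"
  proof -
    have "hm (?c l j / 2) * \<phi> [(j, 0), (l, 1)] = - (hm (?c j l / 2) * \<phi> [(j, 0), (l, 1)])"
      if "j \<in> {..<n}" "l \<in> {..<n}" for j l
      using anti[of j l] that by (simp add: hom_uminus)
    then show ?thesis
      unfolding sw sum_negf[symmetric] by (subst sum.swap) (intro sum.cong refl)
  qed
  moreover have "hm (c / 2) + hm (c / 2) = hm c" for c
  proof -
    have "(2::'k) \<noteq> 0"
    proof
      assume "(2::'k) = 0"
      moreover have "hm (1 + 1) = 1 + 1" by (simp only: hom_add hom_one)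
      ultimately show False by simp
    qed
    then have "c / 2 + c / 2 = c" by (simp add: field_simps)
    then show ?thesis by (metis hom_add)
  qed
  ultimately show ?thesis
    by (simp add: lin_add flip: sum.distrib distrib_right)
qed

end

section \<open>Membership in the symmetric algebra\<close>

lemma cbasis_C2 [simp]: "cbasis C2 = {0, 1, 2}"
  by (simp add: sym_coalgebra2_def)

abbreviation letters :: "nat \<Rightarrow> gen set" where "letters n \<equiv> {..<n} \<times> {0, 1, 2}"

lemma sum_list_gdeg_C2: "sum_list (map (gdeg C2) w) = length (odds w)"
  by (induction w) (auto simp: odds_def)

definition mons :: "nat \<Rightarrow> gen list set" where
  "mons n = {w. set w \<subseteq> letters n \<and> sorted (map prod_encode w) \<and> (\<forall>x. snd x = 2 \<longrightarrow> count_list w x \<le> 1)}"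

lemma monomials_C2: "monomials C2 n = mons n"
  by (simp add: monomials_def mons_def)

lemma sym_alg_C2: "sym_alg C2 n p = {f. \<forall>w\<in>keys f. w \<in> mons n \<and> length (odds w) = p}"
  by (simp add: sym_alg_def sum_list_gdeg_C2 monomials_C2)

text \<open>All exterior degrees together: a domain on which evaluation is injective and which
  contains the results of the differential, the coadjoint action and substitutions.\<close>

definition salg :: "nat \<Rightarrow> 'k::field salg set" where
  "salg n = {f. keys f \<subseteq> mons n}"

lemma sym_alg_subset_salg: "sym_alg C2 n p \<subseteq> salg n"
  by (auto simp: sym_alg_C2 salg_def)

lemma letters_of_salg: "f \<in> salg n \<Longrightarrow> w \<in> keys f \<Longrightarrow> set w \<subseteq> letters n"
  by (auto simp: salg_def mons_def)

lemma fst_letters_of_salg: "f \<in> salg n \<Longrightarrow> w \<in> keys f \<Longrightarrow> fst ` set w \<subseteq> {..<n}"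
  using letters_of_salg by fastforce

lemma keys_sum: "w \<in> keys (\<Sum>i\<in>A. f i) \<Longrightarrow> \<exists>i\<in>A. w \<in> keys (f i)"
  by (induction A rule: infinite_finite_induct) (use Poly_Mapping.keys_add in fastforce)+

lemma keys_word_prod:
  assumes "w \<in> keys (word_prod C2 u)" "set u \<subseteq> letters n"
  shows "w \<in> mons n" "length (odds w) = length (odds u)"
proof -
  have nr: "\<not> (\<exists>x. snd x = 2 \<and> count_list u x > 1)" and w: "w = sort_key prod_encode u"
    using assms(1) by (auto simp: word_prod_C2 split: if_splits)
  have "count_list w x = count_list u x" for x
    unfolding w count_mset[symmetric] by simp
  then show "w \<in> mons n"
    using nr assms(2) by (auto simp: mons_def w not_less)
  show "length (odds w) = length (odds u)"
    unfolding odds_def w by (simp add: filter_sort)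
qed

lemma keys_smul:
  fixes f g :: "'k::field salg"
  assumes w: "w \<in> keys (smul C2 f g)"
    and fg: "\<And>u. u \<in> keys f \<Longrightarrow> set u \<subseteq> letters n" "\<And>v. v \<in> keys g \<Longrightarrow> set v \<subseteq> letters n"
  shows "\<exists>u\<in>keys f. \<exists>v\<in>keys g. w \<in> mons n \<and> length (odds w) = length (odds u) + length (odds v)"
proof -
  obtain u where u: "u \<in> keys f"
      "w \<in> keys (\<Sum>v\<in>keys g. scale (lookup f u * lookup g v) (word_prod C2 (u @ v)))"
    using keys_sum[OF w[unfolded smul_def]] by blast
  obtain v where v: "v \<in> keys g" "w \<in> keys (scale (lookup f u * lookup g v) (word_prod C2 (u @ v)))"
    using keys_sum[OF u(2)] by blast
  have "w \<in> keys (word_prod (C2 :: 'k dg_coalgebra) (u @ v))"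
    using v(2) keys_scale_subset by blast
  moreover have "set (u @ v) \<subseteq> letters n" using fg u(1) v(1) by simp
  ultimately show ?thesis
    using keys_word_prod[of w "u @ v" n] u(1) v(1) by (auto simp: odds_def)
qed

context
  fixes n :: nat
begin

lemma salg_0 [simp]: "0 \<in> salg n"
  by (simp add: salg_def)

lemma salg_add: "f \<in> salg n \<Longrightarrow> g \<in> salg n \<Longrightarrow> f + g \<in> salg n"
  unfolding salg_def using Poly_Mapping.keys_add[of f g] by auto

lemma salg_scale: "f \<in> salg n \<Longrightarrow> scale a f \<in> salg n"
  unfolding salg_def using keys_scale_subset[of a f] by auto

lemma salg_uminus: "f \<in> salg n \<Longrightarrow> - f \<in> salg n"
  by (auto simp: salg_def in_keys_iff)

lemma salg_diff: "f \<in> salg n \<Longrightarrow> g \<in> salg n \<Longrightarrow> f - g \<in> salg n"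
  using salg_add[of f "- g"] salg_uminus[of g] by simp

lemma salg_sum: "(\<And>i. i \<in> A \<Longrightarrow> f i \<in> salg n) \<Longrightarrow> (\<Sum>i\<in>A. f i) \<in> salg n"
  by (induction A rule: infinite_finite_induct) (simp_all add: salg_add)

lemma salg_smul:
  assumes "f \<in> salg n" "g \<in> salg n"
  shows "smul C2 f g \<in> salg n"
  unfolding salg_def using keys_smul[OF _ letters_of_salg[OF assms(1)] letters_of_salg[OF assms(2)]]
  by blast

lemma sym_alg_add: "f \<in> sym_alg C2 n p \<Longrightarrow> g \<in> sym_alg C2 n p \<Longrightarrow> f + g \<in> sym_alg C2 n p"
  unfolding sym_alg_C2 using Poly_Mapping.keys_add[of f g] by blast

lemma sym_alg_scale: "f \<in> sym_alg C2 n p \<Longrightarrow> scale a f \<in> sym_alg C2 n p"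
  unfolding sym_alg_C2 using keys_scale_subset[of a f] by blast

lemma sym_alg_0 [simp]: "0 \<in> sym_alg C2 n p"
  by (simp add: sym_alg_C2)

lemma sym_alg_sum: "(\<And>i. i \<in> A \<Longrightarrow> f i \<in> sym_alg C2 n p) \<Longrightarrow> (\<Sum>i\<in>A. f i) \<in> sym_alg C2 n p"
  by (induction A rule: infinite_finite_induct) (simp_all add: sym_alg_add)

lemma sym_alg_smul:
  assumes "f \<in> sym_alg C2 n p" "g \<in> sym_alg C2 n q"
  shows "smul C2 f g \<in> sym_alg C2 n (p + q)"
proof -
  have "f \<in> salg n" "g \<in> salg n" using assms sym_alg_subset_salg by blast+
  then show ?thesis
    using keys_smul[OF _ letters_of_salg[of f n] letters_of_salg[of g n]] assms
    unfolding sym_alg_C2 by fastforce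
qed

lemma sym_alg_const [simp]: "single [] c \<in> sym_alg C2 n 0"
  by (simp add: sym_alg_C2 mons_def odds_def)

lemma sym_alg_gen: "i < n \<Longrightarrow> c \<le> 2 \<Longrightarrow> gen_elem (i, c) \<in> sym_alg C2 n (if c = 2 then 1 else 0)"
  by (auto simp: sym_alg_C2 mons_def odds_def gen_elem_def)

lemma salg_gen: "i < n \<Longrightarrow> c \<le> 2 \<Longrightarrow> gen_elem (i, c) \<in> salg n"
  using sym_alg_gen sym_alg_subset_salg by blast

lemma salg_const [simp]: "single [] c \<in> salg n"
  using sym_alg_const sym_alg_subset_salg by blast

lemma mons_tl: "x # w \<in> mons n \<Longrightarrow> w \<in> mons n"
  by (auto simp: mons_def) (smt (verit) add_leD1)

lemma salg_derivation:
  assumes \<delta>: "\<And>x. x \<in> letters n \<Longrightarrow> \<delta> x \<in> salg n" and f: "f \<in> salg n"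
  shows "derivation C2 e \<delta> f \<in> salg n"
proof -
  have "derivation_word C2 e \<delta> w \<in> salg n" if "w \<in> mons n" for w
    using that
  proof (induction w)
    case (Cons x w)
    have w: "w \<in> mons n" by (rule mons_tl[OF Cons.prems])
    have x: "x \<in> letters n" using Cons.prems by (auto simp: mons_def)
    have "single w 1 \<in> salg n" using w by (simp add: salg_def)
    moreover have "gen_elem x \<in> salg n"
      using x salg_gen[of "fst x" "snd x"] by auto
    ultimately show ?case
      using Cons.IH[OF w] \<delta>[OF x] by (auto intro!: salg_add salg_smul salg_scale simp del: gdeg_C2)
  qed simp
  then show ?thesis
    unfolding derivation_def using f by (intro salg_sum salg_scale) (auto simp: salg_def[of n])
qed

lemma salg_coad_action: "f \<in> salg n \<Longrightarrow> coad_action C2 n br x f \<in> salg n"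
  unfolding coad_action_def
  by (rule salg_derivation) (auto intro!: salg_sum salg_scale salg_gen)

lemma salg_ce_diff: "f \<in> salg n \<Longrightarrow> ce_diff C2 n br f \<in> salg n"
  unfolding ce_diff_def
proof (rule salg_derivation)
  fix x assume "x \<in> letters n"
  then obtain i c where x: "x = (i, c)" "i < n" by auto
  have gen: "gen_elem (j, p) \<in> salg n" if "j \<in> {..<n}" "p \<in> cbasis C2" for j p
    using that by (intro salg_gen) auto
  have "ce_gen_d1 C2 x \<in> salg n"
    using x gen unfolding ce_gen_d1_def x(1) case_prod_conv by (intro salg_uminus salg_sum salg_scale) simp_all
  moreover have "ce_gen_d2 C2 n br x \<in> salg n"
    unfolding ce_gen_d2_def x(1) case_prod_conv
    by (intro salg_uminus salg_sum salg_scale salg_smul gen)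
  ultimately show "ce_gen_d1 C2 x + ce_gen_d2 C2 n br x \<in> salg n" by (rule salg_add)
qed

lemma salg_sym_map:
  assumes A: "A \<in> carrier_mat m n" and f: "f \<in> salg m"
  shows "sym_map C2 A f \<in> salg n"
proof -
  have "foldr (\<lambda>x g. smul C2 (gen_map A x) g) w (single [] 1) \<in> salg n" if "set w \<subseteq> letters m" for w
    using that
  proof (induction w)
    case (Cons x w)
    have "gen_map A x \<in> salg n"
      using Cons.prems A by (auto simp: gen_map_def intro!: salg_sum salg_scale salg_gen)
    then show ?case using Cons by (auto intro: salg_smul)
  qed simp
  then show ?thesis
    unfolding sym_map_def using letters_of_salg[OF f] by (auto intro!: salg_sum salg_scale)
qed

end

section \<open>The differential as a contraction\<close>

text \<open>Both sides are odd derivations that kill the even generators and send the odd generator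
  i to the i-th coordinate of c, the bracket of a and b: the left one by \<open>lin_ce_gen\<close>,
  the right one because contraction with c means inserting c in front. Induction on words makes this
  precise, with \<open>zs\<close> varying.\<close>

lemma (in coeff_hom) lin_ev_ce_diff:
  fixes br :: "'k vec \<Rightarrow> 'k vec \<Rightarrow> 'k vec" and a b c :: "'r vec"
  assumes anti: "\<And>i j l. i < n \<Longrightarrow> j < n \<Longrightarrow> l < n \<Longrightarrow>
      br (unit_vec n l) (unit_vec n j) $ i = - (br (unit_vec n j) (unit_vec n l) $ i)"
    and B: "\<And>i. i < n \<Longrightarrow> c $ i = (\<Sum>j<n. \<Sum>l<n. a $ j * b $ l * hm (br (unit_vec n j) (unit_vec n l) $ i))"
    and f: "f \<in> salg n"
  shows "lin hm (ev a b zs) (ce_diff C2 n br f) = lin hm (ev a b (c # zs)) f"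
proof -
  let ?\<delta> = "\<lambda>x. ce_gen_d1 C2 x + ce_gen_d2 C2 n br x"
  have even: "?\<delta> (i, e) = 0" if "e = 0 \<or> e = 1" for i e
    using that by (auto simp: ce_gen_d1_def ce_gen_d2_def cop_C2)
  have "word_der hm 1 ?\<delta> (ev a b zs) w = ev a b (c # zs) w" if "set w \<subseteq> letters n" for w
    using that
  proof (induction w arbitrary: zs)
    case Nil
    then show ?case by simp
  next
    case (Cons x w)
    obtain i e where x: "x = (i, e)" by (cases x)
    have ie: "i < n" "e = 0 \<or> e = 1 \<or> e = 2" using Cons.prems x by auto
    have IH: "word_der hm 1 ?\<delta> (ev a b zs) w = ev a b (c # zs) w" for zs
      using Cons.IH Cons.prems by simp
    show ?case
    proof (cases "e = 2")
      case True
      have gen2: "lin hm \<phi> (?\<delta> (i, 2)) =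
          (\<Sum>j<n. \<Sum>l<n. hm (br (unit_vec n j) (unit_vec n l) $ i) * \<phi> [(j, 0), (l, 1)])"
        if "supersym \<phi>" for \<phi>
        by (rule lin_ce_gen[OF that ie(1)]) (rule anti[OF ie(1)])
      have "lin hm (\<lambda>u. ev a b zs (u @ w)) (?\<delta> x) =
          (\<Sum>j<n. \<Sum>l<n. hm (br (unit_vec n j) (unit_vec n l) $ i) * (a $ j * b $ l * ev a b zs w))"
        unfolding x True
        by (subst gen2)
           (simp_all add: supersym_append[OF supersym_ev] ev_even coord_def mult.assoc)
      also have "\<dots> = c $ i * ev a b zs w"
        by (simp add: B[OF ie(1)] sum_distrib_left sum_distrib_right mult_ac)
      finally have 1: "lin hm (\<lambda>u. ev a b zs (u @ w)) (?\<delta> x) = c $ i * ev a b zs w" .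
      have "word_der hm 1 ?\<delta> (\<lambda>v. ev a b zs (x # v)) w =
         (\<Sum>s<length zs. (- 1) ^ s * (zs ! s $ i) * ev a b (c # remove_nth s zs) w)"
        using True x by (simp add: ev_odd word_der_fun_sum word_der_fun_mult IH[unfolded One_nat_def])
      \<comment> \<open>The summand s = 0 consumes c. In the others the index moves up by one, and
        the resulting sign is that of an odd derivation passing an odd letter.\<close>
      moreover have "ev a b (c # zs) (x # w) = c $ i * ev a b zs w -
         (\<Sum>s<length zs. (- 1) ^ s * (zs ! s $ i) * ev a b (c # remove_nth s zs) w)"
        using True x
        by (simp add: ev_odd sum.lessThan_Suc_shift remove_nth_def sum_negf del: sum.lessThan_Suc)
      ultimately show ?thesis using 1 True x by simp
    next
      case False
      then have e: "e = 0 \<or> e = 1" using ie by simp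
      show ?thesis
        using False x even[OF e, of i] by (simp add: ev_even word_der_fun_mult IH[unfolded One_nat_def])
    qed
  qed
  then show ?thesis
    unfolding ce_diff_def lin_derivation[OF supersym_ev]
    by (intro lin_cong) (use letters_of_salg[OF f] in auto)
qed

section \<open>Evaluation is injective\<close>

text \<open>Digits in base N: c occurs fewer than N times, so no carry happens, and the entries
  below c together contribute less than N ^ c.\<close>

lemma count_eq_digit:
  fixes xs :: "nat list"
  assumes len: "length xs < N"
  shows "count_list xs c = sum_list (map (\<lambda>x. N ^ x) xs) div N ^ c mod N"
proof -
  have N: "N > 0" using len by simp
  define lo where "lo = filter (\<lambda>x. x < c) xs"
  define hi where "hi = filter (\<lambda>x. x > c) xs"
  let ?S = "\<lambda>xs. sum_list (map (\<lambda>x. N ^ x) xs)"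
  have split: "?S xs = ?S lo + count_list xs c * N ^ c + ?S hi"
    unfolding lo_def hi_def by (induction xs) (auto simp: algebra_simps)
  have "N ^ Suc c dvd ?S hi"
    unfolding hi_def by (induction xs) (auto intro!: dvd_add le_imp_power_dvd simp del: power_Suc)
  then obtain H where H: "?S hi = N ^ Suc c * H" by blast
  have "N * ?S ys \<le> length ys * N ^ c" if "\<forall>x\<in>set ys. x < c" for ys
    using that
  proof (induction ys)
    case (Cons y ys)
    have "N * N ^ y \<le> N ^ c"
      using Cons.prems N power_increasing[of "Suc y" c N] by simp
    then show ?case using Cons by (simp add: distrib_left)
  qed simp
  then have "N * ?S lo \<le> length lo * N ^ c" by (simp add: lo_def)
  also have "\<dots> < N * N ^ c"
    using len N length_filter_le[of "\<lambda>x. x < c" xs] unfolding lo_def[symmetric] by simp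
  finally have lo: "?S lo < N ^ c" by simp
  have q: "count_list xs c < N"
    using count_le_length[of xs c] len by simp
  have "?S xs = ?S lo + N ^ c * (count_list xs c + N * H)"
    unfolding split H by (simp add: algebra_simps)
  then have "?S xs div N ^ c = count_list xs c + N * H"
    using lo N by simp
  then show ?thesis using q by simp
qed

lemma mset_eq_if_sum_powers_eq:
  fixes xs ys :: "nat list"
  assumes "length xs < N" "length ys < N"
    "sum_list (map (\<lambda>x. N ^ x) xs) = sum_list (map (\<lambda>x. N ^ x) ys)"
  shows "mset xs = mset ys"
  by (rule multiset_eqI) (simp add: count_mset count_eq_digit[OF assms(1)] count_eq_digit[OF assms(2)] assms(3))

lemma odds_sorted_distinct:
  assumes "w \<in> mons n"
  shows "sorted (map (\<lambda>i. prod_encode (i, 2)) (odds w))" "distinct (odds w)" "set (odds w) \<subseteq> {..<n}"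
proof -
  have eq: "map (\<lambda>i. prod_encode (i, 2)) (odds w) = map prod_encode (filter (\<lambda>x. snd x = 2) w)"
    unfolding odds_def by (auto simp: prod_eq_iff)
  show "sorted (map (\<lambda>i. prod_encode (i, 2)) (odds w))"
    unfolding eq using assms sorted_filter[of prod_encode w] by (auto simp: mons_def)
  have "count_list (odds w) i \<le> 1" for i
  proof -
    have "count_list (odds w) i = count_list w (i, 2)"
      unfolding odds_def by (induction w) (auto simp: prod_eq_iff)
    then show ?thesis using assms by (simp add: mons_def)
  qed
  then have "count (mset (odds w)) i \<le> 1" for i by (simp add: count_mset)
  then show "distinct (odds w)"
    by (metis distinct_count_atmost_1 le_antisym not_less_eq_eq One_nat_def not_in_iff count_mset
        count_list_0_iff le_0_eq Suc_leI le_SucE)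
  show "set (odds w) \<subseteq> {..<n}"
    using assms by (auto simp: mons_def odds_def)
qed

text \<open>A sorted word is determined by its multiset of letters, and this multiset splits into
  even and odd letters.\<close>

lemma mons_eqI:
  assumes "w \<in> mons n" "w' \<in> mons n" "mset (evens w) = mset (evens w')" "odds w = odds w'"
  shows "w = w'"
proof -
  have o: "filter (\<lambda>x. snd x = 2) v = map (\<lambda>i. (i, 2)) (odds v)" for v
    unfolding odds_def by (induction v) (auto simp: prod_eq_iff)
  have m: "mset v = mset (evens v) + mset (map (\<lambda>i. (i, 2)) (odds v))" for v
    unfolding o[symmetric] evens_def by (induction v) auto
  have "mset w = mset w'" using m[of w] m[of w'] assms by simp
  then have "mset (map prod_encode w) = mset (map prod_encode w')" by simp
  moreover have "sorted (map prod_encode w)" "sorted (map prod_encode w')"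
    using assms by (auto simp: mons_def)
  ultimately have "map prod_encode w = map prod_encode w'"
    by (metis properties_for_sort)
  then show ?thesis using inj_prod_encode[of UNIV] by (simp add: inj_map_eq_map)
qed

text \<open>Evaluation on the basis vectors named by w0 singles out one exterior monomial. For equal
  odd parts the matrix is the identity; for different ones of the same length the index sets differ,
  because sorted lists are determined by their sets, and an index outside gives a zero row.\<close>

lemma ev_unit_vecs:
  assumes w: "w \<in> mons n" and w0: "w0 \<in> mons n"
  shows "ev a b (map (unit_vec n) (odds w0)) w =
    (if odds w = odds w0 then prod_list (map (\<lambda>x. coord x a b) (evens w)) else (0::'r::comm_ring_1))"
proof (cases "length (odds w) = length (odds w0)")
  case True
  define p where "p = length (odds w)"
  let ?A = "mat p p (\<lambda>(i, j). (map (unit_vec n) (odds w0) ! j) $ (odds w ! i)) :: 'r mat"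
  note W = odds_sorted_distinct[OF w] and W0 = odds_sorted_distinct[OF w0]
  have A: "?A $$ (i, j) = (if odds w ! i = odds w0 ! j then 1 else 0)" if "i < p" "j < p" for i j
  proof -
    have "odds w ! i < n" "odds w0 ! j < n"
      using that True subsetD[OF W(3) nth_mem, of i] subsetD[OF W0(3) nth_mem, of j] by (auto simp: p_def)
    then show ?thesis using that True by (simp add: p_def)
  qed
  have det: "det ?A = (if odds w = odds w0 then 1 else 0)"
  proof (cases "odds w = odds w0")
    case same: True
    have "?A = 1\<^sub>m p"
    proof (rule eq_matI)
      fix i j assume "i < dim_row (1\<^sub>m p :: 'r mat)" "j < dim_col (1\<^sub>m p :: 'r mat)"
      then have ij: "i < p" "j < p" by simp_all
      then show "?A $$ (i, j) = 1\<^sub>m p $$ (i, j)"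
        unfolding A[OF ij] using same W(2) by (simp add: nth_eq_iff_index_eq p_def)
    qed simp_all
    then show ?thesis using same by simp
  next
    case False
    have "set (odds w) \<noteq> set (odds w0)"
    proof
      assume "set (odds w) = set (odds w0)"
      then have "map (\<lambda>i. prod_encode (i, 2)) (odds w) = map (\<lambda>i. prod_encode (i, 2)) (odds w0)"
        using W W0 by (intro sorted_distinct_set_unique) (auto simp: distinct_map inj_on_def)
      moreover have "inj (\<lambda>i. prod_encode (i, 2))" by (auto simp: inj_on_def)
      ultimately show False using False by (simp add: inj_map_eq_map)
    qed
    moreover have "card (set (odds w)) = card (set (odds w0))"
      using W(2) W0(2) True by (simp add: distinct_card)
    ultimately obtain r where "r \<in> set (odds w)" "r \<notin> set (odds w0)"
      by (metis List.finite_set card_subset_eq subsetI)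
    then obtain i where i: "i < p" "odds w ! i \<notin> set (odds w0)"
      by (metis in_set_conv_nth p_def)
    have z: "?A $$ (i, j) = 0" if "j < p" for j
      using A[OF i(1) that] i(2) that True by (auto simp: p_def)
    have "det ?A = (\<Sum>j<p. ?A $$ (i, j) * cofactor ?A i j)"
      by (rule laplace_expansion_row) (use i in auto)
    also have "\<dots> = 0" by (rule sum.neutral) (use z in simp)
    finally show ?thesis using False by simp
  qed
  show ?thesis
    using True det by (simp add: ev_def p_def)
next
  case False
  then have "odds w \<noteq> odds w0" by auto
  then show ?thesis using False by (simp add: ev_def)
qed

text \<open>Test points with natural number entries exist in every coefficient ring and are fixed by
  \<open>to_ac\<close>, so elements over k and over K can be compared at the same points.\<close>

definition nat_vec :: "nat \<Rightarrow> (nat \<Rightarrow> nat) \<Rightarrow> 'r::comm_ring_1 vec" where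
  "nat_vec n \<alpha> = vec n (\<lambda>i. of_nat (\<alpha> i))"

lemma nat_vec_carrier [simp]: "nat_vec n \<alpha> \<in> carrier_vec n"
  by (simp add: nat_vec_def)

text \<open>Kronecker substitution: substituting \<open>t ^ N ^ x\<close> for the variable numbered \<open>x\<close>, with \<open>N\<close> larger
  than all degrees, separates the monomials.\<close>

lemma (in coeff_hom) ev_inject:
  assumes f: "f \<in> salg n"
    and z: "\<And>\<alpha> \<beta> zs. set zs \<subseteq> unit_vec n ` {..<n} \<Longrightarrow> lin hm (ev (nat_vec n \<alpha>) (nat_vec n \<beta>) zs) f = 0"
  shows "f = 0"
proof (rule ccontr)
  assume "f \<noteq> 0"
  then obtain w0 where w0: "w0 \<in> keys f" by (metis poly_mapping_eqI in_keys_iff lookup_zero)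
  have mon: "w \<in> mons n" if "w \<in> keys f" for w using f that by (auto simp: salg_def)
  \<comment> \<open>Choosing \<open>zs\<close> as the basis vectors of \<open>odds w0\<close>
    reduces the problem to ordinary polynomials, indexed by the words with this odd part.\<close>
  define S where "S = {w \<in> keys f. odds w = odds w0}"
  have finS: "finite S" by (simp add: S_def)
  \<comment> \<open>Exceeds the length of every word, hence all digits of the exponent
    \<open>e w\<close>; distinct words of S then get distinct exponents.\<close>
  define N where "N = Suc (\<Sum>w\<in>keys f. length w)"
  have N: "length (evens w) < N" if "w \<in> keys f" for w
  proof -
    have "length w \<le> (\<Sum>w\<in>keys f. length w)" using that by (intro member_le_sum) auto
    then show ?thesis using length_filter_le[of _ w] unfolding N_def evens_def
      by (meson le_imp_less_Suc order_trans)
  qed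
  define e where "e w = sum_list (map (\<lambda>x. N ^ x) (map prod_encode (evens w)))" for w
  have inj: "inj_on e S"
  proof (rule inj_onI)
    fix w w' assume w: "w \<in> S" "w' \<in> S" "e w = e w'"
    then have "mset (map prod_encode (evens w)) = mset (map prod_encode (evens w'))"
      using N unfolding e_def S_def by (intro mset_eq_if_sum_powers_eq[of _ N]) auto
    then have "image_mset prod_encode (mset (evens w)) = image_mset prod_encode (mset (evens w'))" by simp
    then have "mset (evens w) = mset (evens w')"
      using multiset.inj_map[OF inj_prod_encode[of UNIV]] by (rule injD[rotated])
    then show "w = w'" using w mon by (intro mons_eqI[of _ n]) (auto simp: S_def)
  qed
  define P where "P = (\<Sum>w\<in>S. Polynomial.monom (hm (lookup f w)) (e w))"
  have root: "poly P (of_nat t) = 0" for t :: nat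
  proof -
    define \<alpha> where "\<alpha> i = t ^ N ^ prod_encode (i, 0)" for i
    define \<beta> where "\<beta> i = t ^ N ^ prod_encode (i, 1)" for i
    have pl: "prod_list (map (\<lambda>x. coord x (nat_vec n \<alpha>) (nat_vec n \<beta>)) (evens w)) = (of_nat t ^ e w :: 'r)"
      if "set w \<subseteq> letters n" for w
      using that
    proof (induction w)
      case (Cons x w)
      show ?case
      proof (cases "snd x = 2")
        case False
        then have "snd x = 0 \<or> snd x = 1" "fst x < n" using Cons.prems by auto
        then have "coord x (nat_vec n \<alpha>) (nat_vec n \<beta>) = (of_nat t ^ N ^ prod_encode x :: 'r)"
          by (cases x) (auto simp: coord_def nat_vec_def \<alpha>_def \<beta>_def)
        then show ?thesis using Cons False by (simp add: evens_def e_def power_add)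
      qed (use Cons in \<open>simp add: evens_def e_def\<close>)
    qed (simp add: evens_def e_def)
    have "0 = lin hm (ev (nat_vec n \<alpha>) (nat_vec n \<beta>) (map (unit_vec n) (odds w0))) f"
      by (rule z[symmetric]) (use odds_sorted_distinct(3)[OF mon[OF w0]] in auto)
    also have "\<dots> = (\<Sum>w\<in>keys f. if odds w = odds w0 then hm (lookup f w) * of_nat t ^ e w else 0)"
      unfolding lin_def
      by (rule sum.cong) (use mon mon[OF w0] pl in \<open>auto simp: ev_unit_vecs mons_def\<close>)
    also have "\<dots> = (\<Sum>w\<in>S. hm (lookup f w) * of_nat t ^ e w)"
      unfolding S_def by (rule sum.inter_filter[symmetric]) simp
    also have "\<dots> = poly P (of_nat t)"
      by (simp add: P_def poly_sum poly_monom)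
    finally show ?thesis by simp
  qed
  have "P = 0"
  proof (rule ccontr)
    assume "P \<noteq> 0"
    then have "finite {x. poly P x = 0}" by (rule poly_roots_finite)
    moreover have "range of_nat \<subseteq> {x. poly P x = 0}" using root by auto
    ultimately have "finite (range (of_nat :: nat \<Rightarrow> 'r))" by (rule rev_finite_subset)
    moreover have "inj (of_nat :: nat \<Rightarrow> 'r)" by (rule injI) simp
    ultimately show False using range_inj_infinite by blast
  qed
  moreover have "Polynomial.coeff P (e w0) = hm (lookup f w0)"
  proof -
    have "w0 \<in> S" using w0 by (simp add: S_def)
    have "Polynomial.coeff P (e w0) = (\<Sum>w\<in>S. if w = w0 then hm (lookup f w) else 0)"
      unfolding P_def Polynomial.coeff_sum
      by (rule sum.cong) (use inj \<open>w0 \<in> S\<close> in \<open>auto simp: inj_on_def\<close>)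
    then show ?thesis using finS \<open>w0 \<in> S\<close> by simp
  qed
  moreover have "hm (lookup f w0) \<noteq> 0"
  proof
    assume "hm (lookup f w0) = 0"
    then have "hm (lookup f w0 * inverse (lookup f w0)) = 0" by (simp add: hom_mult)
    then show False using w0 by (simp add: in_keys_iff)
  qed
  ultimately show False by simp
qed

section \<open>Forms as elements of the symmetric algebra\<close>

lemma coeff_hom_id: "coeff_hom (\<lambda>c::'k::field_char_0. c)"
  by unfold_locales simp_all

lemmas id_lin = coeff_hom.lin_0[OF coeff_hom_id] coeff_hom.lin_add[OF coeff_hom_id]
  coeff_hom.lin_scale[OF coeff_hom_id] coeff_hom.lin_diff[OF coeff_hom_id]
  coeff_hom.lin_sum[OF coeff_hom_id] coeff_hom.lin_single[OF coeff_hom_id]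
  coeff_hom.lin_gen_elem[OF coeff_hom_id]

definition pev :: "'k::field_char_0 vec \<Rightarrow> 'k vec \<Rightarrow> 'k vec list \<Rightarrow> 'k salg \<Rightarrow> 'k" where
  "pev a b zs f = lin (\<lambda>c. c) (ev a b zs) f"

lemma pev_0 [simp]: "pev a b zs 0 = 0"
  by (simp add: pev_def id_lin)

lemma pev_add: "pev a b zs (f + g) = pev a b zs f + pev a b zs g"
  by (simp add: pev_def id_lin)

lemma pev_diff: "pev a b zs (f - g) = pev a b zs f - pev a b zs g"
  by (simp add: pev_def id_lin)

lemma pev_smul_even:
  assumes "f \<in> sym_alg C2 m 0"
  shows "pev a b zs (smul C2 f g) = pev a b [] f * pev a b zs g"
proof -
  have *: "ev a b zs (u @ v) = ev a b [] u * ev a b zs v" if "odds u = []" for u v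
    using that by (simp add: ev_def odds_def evens_def)
  have "lin (\<lambda>c. c) (\<lambda>u. lin (\<lambda>c. c) (\<lambda>v. ev a b zs (u @ v)) g) f =
      lin (\<lambda>c. c) (\<lambda>u. pev a b zs g * ev a b [] u) f"
    by (rule lin_cong) (use assms in \<open>auto simp: sym_alg_C2 * lin_fun_mult pev_def mult.commute\<close>)
  then have "pev a b zs (smul C2 f g) = pev a b zs g * pev a b [] f"
    by (simp only: pev_def coeff_hom.lin_smul[OF coeff_hom_id supersym_ev] lin_fun_mult)
  then show ?thesis by (simp only: mult.commute)
qed

lemma pev_smul_odd:
  "pev a b zs (smul C2 (\<Sum>i<m. scale (c i) (gen_elem (i, 2))) f) =
     (\<Sum>s<length zs. (- 1) ^ s * (\<Sum>i<m. c i * (zs ! s $ i)) * pev a b (remove_nth s zs) f)"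
  unfolding pev_def
  by (simp add: coeff_hom.lin_smul[OF coeff_hom_id supersym_ev] id_lin ev_odd lin_fun_sum lin_fun_mult
      sum_distrib_left sum_distrib_right)
     (subst sum.swap, simp add: mult_ac)

text \<open>L supplies coordinates on V. The value 0 outside V agrees with the convention of
  \<open>decomposable\<close>, so equality of forms is equality of functions.\<close>

definition form_of :: "'k::field_char_0 vec set \<Rightarrow> 'k mat \<Rightarrow> 'k salg \<Rightarrow> 'k form" where
  "form_of V L f = (\<lambda>\<xi> \<eta> \<zeta>s. if \<xi> \<in> V \<and> \<eta> \<in> V \<and> set \<zeta>s \<subseteq> V
     then pev (L *\<^sub>v \<xi>) (L *\<^sub>v \<eta>) (mult_vecs L \<zeta>s) f else 0)"

lemma form_of_add: "form_of V L (f + g) = form_of V L f + form_of V L g"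
  by (auto simp: form_of_def fun_eq_iff pev_add)

lemma form_of_diff: "form_of V L (f - g) = form_of V L f - form_of V L g"
  by (auto simp: form_of_def fun_eq_iff pev_diff)

lemma form_of_0 [simp]: "form_of V L 0 = 0"
  by (auto simp: form_of_def fun_eq_iff)

text \<open>The columns of B are a basis of the subspace V, and L is a coordinate map on it,
  extended to the whole space. The choice B = L = 1 makes the same results available for the whole
  Lie algebra.\<close>

locale frame =
  fixes n m :: nat and B L :: "'k::field_char_0 mat"
  assumes B: "B \<in> carrier_mat n m" and L: "L \<in> carrier_mat m n" and LB: "L * B = 1\<^sub>m m"
begin

definition V :: "'k vec set" where "V = (\<lambda>v. B *\<^sub>v v) ` carrier_vec m"

lemma V_carrier: "V \<subseteq> carrier_vec n"
  using B by (auto simp: V_def)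

lemma LBv [simp]: "v \<in> carrier_vec m \<Longrightarrow> L *\<^sub>v (B *\<^sub>v v) = v"
  using B L LB by (metis assoc_mult_mat_vec one_mult_mat_vec)

lemma BLv: "\<xi> \<in> V \<Longrightarrow> B *\<^sub>v (L *\<^sub>v \<xi>) = \<xi>"
  by (auto simp: V_def)

lemma LV_carrier: "\<xi> \<in> V \<Longrightarrow> L *\<^sub>v \<xi> \<in> carrier_vec m"
  by (auto simp: V_def)

lemma BV: "v \<in> carrier_vec m \<Longrightarrow> B *\<^sub>v v \<in> V"
  by (auto simp: V_def)

lemma V_smult: "\<xi> \<in> V \<Longrightarrow> c \<cdot>\<^sub>v \<xi> \<in> V"
  using B by (auto simp: V_def mult_mat_vec[symmetric] intro!: imageI)

lemma coordinate_dual: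
  assumes "i < m"
  shows "(\<lambda>\<zeta>. (L *\<^sub>v \<zeta>) $ i) \<in> dual_space V"
proof -
  have "(L *\<^sub>v (u + v)) $ i = (L *\<^sub>v u) $ i + (L *\<^sub>v v) $ i" if "u \<in> V" "v \<in> V" for u v
    using that V_carrier L assms mult_add_distrib_mat_vec[OF L, of u v]
    by (metis carrier_matD(1) dim_mult_mat_vec index_add_vec(1) subsetD)
  moreover have "(L *\<^sub>v (a \<cdot>\<^sub>v u)) $ i = a * (L *\<^sub>v u) $ i" if "u \<in> V" for a u
    using that V_carrier L assms mult_mat_vec[OF L, of u a]
    by (metis carrier_matD(1) dim_mult_mat_vec index_smult_vec(1) subsetD)
  ultimately show ?thesis unfolding dual_space_def by blast
qed

text \<open>\<phi> is linear on V only and arbitrary elsewhere, so the coordinate vector is built up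
  one entry at a time, with every partial sum mapped into V by B.\<close>

lemma dual_expand:
  assumes \<phi>: "\<phi> \<in> dual_space V" and \<xi>: "\<xi> \<in> V"
  shows "\<phi> \<xi> = (\<Sum>i<m. \<phi> (B *\<^sub>v unit_vec m i) * (L *\<^sub>v \<xi>) $ i)"
proof -
  define v where "v = L *\<^sub>v \<xi>"
  have v: "v \<in> carrier_vec m" using LV_carrier \<xi> by (simp add: v_def)
  have add: "\<phi> (u + w) = \<phi> u + \<phi> w" if "u \<in> V" "w \<in> V" for u w
    using \<phi> that by (simp add: dual_space_def)
  have smult: "\<phi> (c \<cdot>\<^sub>v u) = c * \<phi> u" if "u \<in> V" for c u
    using \<phi> that by (simp add: dual_space_def)
  have "\<phi> (B *\<^sub>v vec m (\<lambda>i. if i < k then v $ i else 0)) = (\<Sum>i<k. \<phi> (B *\<^sub>v unit_vec m i) * v $ i)"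
    if "k \<le> m" for k
    using that
  proof (induction k)
    case 0
    have "vec m (\<lambda>i. 0) = (0::'k) \<cdot>\<^sub>v 0\<^sub>v m" by auto
    then have "\<phi> (B *\<^sub>v vec m (\<lambda>i. 0)) = \<phi> (0 \<cdot>\<^sub>v (B *\<^sub>v 0\<^sub>v m))"
      using B by (metis mult_mat_vec zero_carrier_vec)
    then show ?case by (simp add: smult BV)
  next
    case (Suc k)
    have "vec m (\<lambda>i. if i < Suc k then v $ i else 0) =
        vec m (\<lambda>i. if i < k then v $ i else 0) + v $ k \<cdot>\<^sub>v unit_vec m k"
      using Suc.prems by (auto simp: less_Suc_eq)
    then have "B *\<^sub>v vec m (\<lambda>i. if i < Suc k then v $ i else 0) =
        B *\<^sub>v vec m (\<lambda>i. if i < k then v $ i else 0) + v $ k \<cdot>\<^sub>v (B *\<^sub>v unit_vec m k)"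
      using B by (simp add: mult_add_distrib_mat_vec mult_mat_vec)
    then show ?case
      using Suc by (simp add: add smult BV V_smult mult.commute)
  qed
  note expand = this[of m]
  have "\<phi> (B *\<^sub>v v) = (\<Sum>i<m. \<phi> (B *\<^sub>v unit_vec m i) * v $ i)"
  proof -
    have "vec m (\<lambda>i. if i < m then v $ i else 0) = v"
      by (rule eq_vecI) (use v in auto)
    then show ?thesis using expand by simp
  qed
  then show ?thesis using BLv[OF \<xi>] by (simp add: v_def)
qed

text \<open>B carries the test points of \<open>ev_inject\<close> into V, and L carries them
  back.\<close>

lemma form_of_inject:
  assumes "f \<in> salg m" "g \<in> salg m" "form_of V L f = form_of V L g"
  shows "f = g"
proof -
  have "f - g = 0"
  proof (rule coeff_hom.ev_inject[OF coeff_hom_id])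
    show "f - g \<in> salg m" using assms by (intro salg_diff)
    fix \<alpha> \<beta> :: "nat \<Rightarrow> nat" and zs :: "'k vec list"
    assume zs: "set zs \<subseteq> unit_vec m ` {..<m}"
    then have c: "set zs \<subseteq> carrier_vec m" by auto
    then have m: "mult_vecs L (mult_vecs B zs) = zs"
      unfolding map_map by (intro map_idI) auto
    have V: "set (mult_vecs B zs) \<subseteq> V"
      using c BV by auto
    have "form_of V L (f - g) (B *\<^sub>v nat_vec m \<alpha>) (B *\<^sub>v nat_vec m \<beta>) (mult_vecs B zs) = 0"
      using assms(3) by (simp add: form_of_diff)
    then show "lin (\<lambda>c. c) (ev (nat_vec m \<alpha>) (nat_vec m \<beta>) zs) (f - g) = 0"
      using V BV unfolding form_of_def m pev_def by simp
  qed
  then show ?thesis by simp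
qed

lemma prod_coord_poly_fun:
  assumes "set w \<subseteq> {..<m} \<times> UNIV"
  shows "(\<lambda>\<xi> \<eta>. prod_list (map (\<lambda>x. coord x (L *\<^sub>v \<xi>) (L *\<^sub>v \<eta>)) w)) \<in> poly_funs V"
  using assms
proof (induction w)
  case Nil
  show ?case using poly_funs.const[of 1 V] by simp
next
  case (Cons x w)
  have "(\<lambda>\<xi> \<eta>. coord x (L *\<^sub>v \<xi>) (L *\<^sub>v \<eta>)) \<in> poly_funs V"
    using Cons.prems poly_funs.coord1[OF coordinate_dual] poly_funs.coord2[OF coordinate_dual]
    by (cases "snd x = 0") (auto simp: coord_def)
  then show ?case using Cons poly_funs.mult by fastforce
qed

text \<open>Each word gives one decomposable form: its even letters a polynomial coefficient, its
  odd letters the list of coordinate forms. The two determinants have the same entries.\<close>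

lemma form_of_in_forms:
  assumes f: "f \<in> sym_alg C2 m p"
  shows "form_of V L f \<in> forms V p"
proof -
  define D where "D w = decomposable V
      (\<lambda>\<xi> \<eta>. lookup f w * prod_list (map (\<lambda>x. coord x (L *\<^sub>v \<xi>) (L *\<^sub>v \<eta>)) (evens w)))
      (map (\<lambda>i \<zeta>. (L *\<^sub>v \<zeta>) $ i) (odds w))" for w
  have ev: "ev (L *\<^sub>v \<xi>) (L *\<^sub>v \<eta>) (mult_vecs L \<zeta>s) w * lookup f w = D w \<xi> \<eta> \<zeta>s"
    if "\<xi> \<in> V" "\<eta> \<in> V" "set \<zeta>s \<subseteq> V" for w \<xi> \<eta> \<zeta>s
  proof (cases "length \<zeta>s = length (odds w)")
    case True
    have "mat (length \<zeta>s) (length \<zeta>s) (\<lambda>(i, j). (mult_vecs L \<zeta>s ! j) $ (odds w ! i)) =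
      mat (length \<zeta>s) (length \<zeta>s) (\<lambda>(i, j). (map (\<lambda>i \<zeta>. (L *\<^sub>v \<zeta>) $ i) (odds w) ! i) (\<zeta>s ! j))"
      by (rule eq_matI) (simp_all add: True)
    then show ?thesis using that True by (simp add: ev_def D_def decomposable_def)
  qed (simp add: ev_def D_def decomposable_def)
  have "form_of V L f = (\<Sum>w\<in>keys f. D w)"
  proof (intro ext)
    fix \<xi> \<eta> \<zeta>s
    have s: "(\<Sum>w\<in>A. D w) \<xi> \<eta> \<zeta>s = (\<Sum>w\<in>A. D w \<xi> \<eta> \<zeta>s)" for A
      by (induction A rule: infinite_finite_induct) simp_all
    show "form_of V L f \<xi> \<eta> \<zeta>s = (\<Sum>w\<in>keys f. D w) \<xi> \<eta> \<zeta>s"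
    proof (cases "\<xi> \<in> V \<and> \<eta> \<in> V \<and> set \<zeta>s \<subseteq> V")
      case True
      then show ?thesis
        unfolding s by (simp add: form_of_def pev_def lin_def ev[symmetric] mult.commute)
    next
      case False
      then have "D w \<xi> \<eta> \<zeta>s = 0" for w unfolding D_def decomposable_def by auto
      then show ?thesis unfolding s using False by (auto simp: form_of_def)
    qed
  qed
  moreover have "(\<Sum>w\<in>A. D w) \<in> forms V p" if "finite A" "A \<subseteq> keys f" for A
    using that
  proof (induction A)
    case empty
    show ?case unfolding sum.empty by (rule forms.zero)
  next
    case (insert w A)
    have w: "set w \<subseteq> letters m" "length (odds w) = p"
      using f insert.prems by (auto simp: sym_alg_C2 mons_def)
    have "(\<Sum>w\<in>A. D w) + D w \<in> forms V p"
      unfolding D_def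
    proof (rule forms.add)
      show "(\<Sum>w\<in>A. decomposable V
          (\<lambda>\<xi> \<eta>. lookup f w * prod_list (map (\<lambda>x. coord x (L *\<^sub>v \<xi>) (L *\<^sub>v \<eta>)) (evens w)))
          (map (\<lambda>i \<zeta>. (L *\<^sub>v \<zeta>) $ i) (odds w))) \<in> forms V p"
        using insert unfolding D_def by simp
      show "(\<lambda>\<xi> \<eta>. lookup f w * prod_list (map (\<lambda>x. coord x (L *\<^sub>v \<xi>) (L *\<^sub>v \<eta>)) (evens w))) \<in> poly_funs V"
        by (rule poly_funs.mult[OF poly_funs.const prod_coord_poly_fun]) (use w in \<open>auto simp: evens_def\<close>)
      show "set (map (\<lambda>i \<zeta>. (L *\<^sub>v \<zeta>) $ i) (odds w)) \<subseteq> dual_space V"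
        using w by (auto simp: odds_def intro!: coordinate_dual)
    qed (use w in simp)
    then show ?case unfolding sum.insert[OF insert.hyps(1,2)] add.commute[of "D w"] .
  qed
  ultimately show ?thesis by simp
qed

lemma linear_elem:
  fixes \<phi> :: "'k vec \<Rightarrow> 'k"
  assumes "\<phi> \<in> dual_space V" "c = 0 \<or> c = 1" "\<xi> \<in> V" "\<eta> \<in> V"
  shows "pev (L *\<^sub>v \<xi>) (L *\<^sub>v \<eta>) [] (\<Sum>i<m. scale (\<phi> (B *\<^sub>v unit_vec m i)) (gen_elem (i, c))) =
    \<phi> (if c = 0 then \<xi> else \<eta>)"
  using assms(2) dual_expand[OF assms(1,3)] dual_expand[OF assms(1,4)]
  by (auto simp: pev_def id_lin ev_even coord_def)

lemma poly_funs_surj: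
  assumes "f \<in> poly_funs V"
  shows "\<exists>g\<in>sym_alg C2 m 0. \<forall>\<xi>\<in>V. \<forall>\<eta>\<in>V. pev (L *\<^sub>v \<xi>) (L *\<^sub>v \<eta>) [] g = f \<xi> \<eta>"
  using assms
proof induction
  case (const a)
  show ?case by (rule bexI[of _ "single [] a"]) (simp_all add: pev_def id_lin)
next
  case (coord1 \<phi>)
  show ?case
    using linear_elem[OF coord1, of 0]
    by (intro bexI[of _ "\<Sum>i<m. scale (\<phi> (B *\<^sub>v unit_vec m i)) (gen_elem (i, 0))"] sym_alg_sum sym_alg_scale)
       (use sym_alg_gen[of _ m 0] in simp_all)
next
  case (coord2 \<phi>)
  show ?case
    using linear_elem[OF coord2, of 1]
    by (intro bexI[of _ "\<Sum>i<m. scale (\<phi> (B *\<^sub>v unit_vec m i)) (gen_elem (i, 1))"] sym_alg_sum sym_alg_scale)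
       (use sym_alg_gen[of _ m 1] in simp_all)
next
  case (add f g)
  then obtain f' g' where "f' \<in> sym_alg C2 m 0" "g' \<in> sym_alg C2 m 0"
    "\<forall>\<xi>\<in>V. \<forall>\<eta>\<in>V. pev (L *\<^sub>v \<xi>) (L *\<^sub>v \<eta>) [] f' = f \<xi> \<eta>"
    "\<forall>\<xi>\<in>V. \<forall>\<eta>\<in>V. pev (L *\<^sub>v \<xi>) (L *\<^sub>v \<eta>) [] g' = g \<xi> \<eta>"
    by blast
  then show ?case by (intro bexI[of _ "f' + g'"]) (simp_all add: sym_alg_add pev_add)
next
  case (mult f g)
  then obtain f' g' where fg: "f' \<in> sym_alg C2 m 0" "g' \<in> sym_alg C2 m 0"
    "\<forall>\<xi>\<in>V. \<forall>\<eta>\<in>V. pev (L *\<^sub>v \<xi>) (L *\<^sub>v \<eta>) [] f' = f \<xi> \<eta>"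
    "\<forall>\<xi>\<in>V. \<forall>\<eta>\<in>V. pev (L *\<^sub>v \<xi>) (L *\<^sub>v \<eta>) [] g' = g \<xi> \<eta>"
    by blast
  then show ?case
    using sym_alg_smul[OF fg(1,2)]
    by (intro bexI[of _ "smul C2 f' g'"]) (simp_all add: pev_smul_even[OF fg(1)])
qed

text \<open>The preimage is the product of the odd linear elements of the listed forms; multiplying
  by one more is Laplace expansion along a new first row.\<close>

lemma exterior_surj:
  assumes "set \<phi>s \<subseteq> dual_space V"
  shows "\<exists>g\<in>sym_alg C2 m (length \<phi>s). \<forall>a b \<zeta>s. set \<zeta>s \<subseteq> V \<longrightarrow>
    pev a b (mult_vecs L \<zeta>s) g =
    (if length \<zeta>s = length \<phi>s
     then det (mat (length \<phi>s) (length \<phi>s) (\<lambda>(i, j). (\<phi>s ! i) (\<zeta>s ! j))) else 0)"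
  using assms
proof (induction \<phi>s)
  case Nil
  show ?case by (rule bexI[of _ "single [] 1"]) (simp_all add: pev_def id_lin)
next
  case (Cons \<phi> \<phi>s)
  then obtain g where g: "g \<in> sym_alg C2 m (length \<phi>s)"
    "\<And>a b \<zeta>s. set \<zeta>s \<subseteq> V \<Longrightarrow> pev a b (mult_vecs L \<zeta>s) g =
    (if length \<zeta>s = length \<phi>s
     then det (mat (length \<phi>s) (length \<phi>s) (\<lambda>(i, j). (\<phi>s ! i) (\<zeta>s ! j))) else 0)"
    by auto
  define e where "e = (\<Sum>i<m. scale (\<phi> (B *\<^sub>v unit_vec m i)) (gen_elem (i, 2)))"
  have e: "e \<in> sym_alg C2 m 1"
    unfolding e_def using sym_alg_gen[of _ m 2] by (intro sym_alg_sum sym_alg_scale) simp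
  have "pev a b (mult_vecs L \<zeta>s) (smul C2 e g) =
    (if length \<zeta>s = length (\<phi> # \<phi>s)
     then det (mat (length (\<phi> # \<phi>s)) (length (\<phi> # \<phi>s)) (\<lambda>(i, j). ((\<phi> # \<phi>s) ! i) (\<zeta>s ! j))) else 0)"
    if \<zeta>s: "set \<zeta>s \<subseteq> V" for a b \<zeta>s
  proof -
    have \<phi>: "(\<Sum>i<m. \<phi> (B *\<^sub>v unit_vec m i) * ((L *\<^sub>v (\<zeta>s ! s)) $ i)) = \<phi> (\<zeta>s ! s)" if "s < length \<zeta>s" for s
      using dual_expand[of \<phi> "\<zeta>s ! s"] Cons.prems \<zeta>s that nth_mem by fastforce
    have r: "set (remove_nth s \<zeta>s) \<subseteq> V" for s
      using \<zeta>s by (auto simp: remove_nth_def dest: in_set_takeD in_set_dropD)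
    have "pev a b (mult_vecs L \<zeta>s) (smul C2 e g) =
      (\<Sum>s<length \<zeta>s. (- 1) ^ s * \<phi> (\<zeta>s ! s) * pev a b (mult_vecs L (remove_nth s \<zeta>s)) g)"
      unfolding e_def pev_smul_odd by (simp add: \<phi> map_remove_nth)
    also have "\<dots> = (\<Sum>s<length \<zeta>s. (- 1) ^ s * \<phi> (\<zeta>s ! s) * (if length \<zeta>s = Suc (length \<phi>s)
     then det (mat (length \<phi>s) (length \<phi>s) (\<lambda>(i, j). (\<phi>s ! i) (remove_nth s \<zeta>s ! j))) else 0))"
      by (rule sum.cong) (auto simp: g(2)[OF r])
    also have "\<dots> = (if length \<zeta>s = Suc (length \<phi>s)
     then det (mat (Suc (length \<phi>s)) (Suc (length \<phi>s)) (\<lambda>(i, j). ((\<phi> # \<phi>s) ! i) (\<zeta>s ! j))) else 0)"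
      using det_Cons[of \<phi>s "length \<phi>s" \<zeta>s "\<lambda>\<phi> \<zeta>. \<phi> \<zeta>" \<phi>] by (simp del: sum.lessThan_Suc)
    finally show ?thesis by simp
  qed
  moreover have "smul C2 e g \<in> sym_alg C2 m (length (\<phi> # \<phi>s))"
    using sym_alg_smul[OF e g(1)] by simp
  ultimately show ?case by blast
qed

lemma form_of_surj:
  assumes "F \<in> forms V p"
  shows "\<exists>f\<in>sym_alg C2 m p. F = form_of V L f"
  using assms
proof induction
  case zero
  show ?case by (rule bexI[of _ 0]) simp_all
next
  case (add F f \<phi>s)
  then obtain g where g: "g \<in> sym_alg C2 m p" "F = form_of V L g" by blast
  obtain u where u: "u \<in> sym_alg C2 m 0"
    "\<And>\<xi> \<eta>. \<xi> \<in> V \<Longrightarrow> \<eta> \<in> V \<Longrightarrow> pev (L *\<^sub>v \<xi>) (L *\<^sub>v \<eta>) [] u = f \<xi> \<eta>"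
    using poly_funs_surj[OF add.hyps(2)] by blast
  obtain v where v: "v \<in> sym_alg C2 m (length \<phi>s)"
    "\<And>a b \<zeta>s. set \<zeta>s \<subseteq> V \<Longrightarrow> pev a b (mult_vecs L \<zeta>s) v =
    (if length \<zeta>s = length \<phi>s
     then det (mat (length \<phi>s) (length \<phi>s) (\<lambda>(i, j). (\<phi>s ! i) (\<zeta>s ! j))) else 0)"
    using exterior_surj[OF add.hyps(4)] by blast
  have "decomposable V f \<phi>s = form_of V L (smul C2 u v)"
    by (auto simp: fun_eq_iff decomposable_def form_of_def pev_smul_even[OF u(1)] u(2) v(2))
  moreover have "smul C2 u v \<in> sym_alg C2 m p"
    using sym_alg_smul[OF u(1) v(1)] add.hyps(3) by simp
  ultimately show ?case
    using g by (intro bexI[of _ "g + smul C2 u v"]) (simp_all add: form_of_add sym_alg_add)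
qed

end

section \<open>Nilpotent matrices and their exponentials\<close>

text \<open>The vectors are the columns of a matrix padded with zero rows to a square one; row n is
  zero, so the determinant vanishes and a kernel vector supplies the coefficients.\<close>

lemma exists_dependency:
  fixes f :: "nat \<Rightarrow> nat \<Rightarrow> 'a::field"
  assumes "n < r"
  shows "\<exists>c. (\<exists>i<r. c i \<noteq> 0) \<and> (\<forall>l<n. (\<Sum>i<r. c i * f i l) = 0)"
proof -
  define A where "A = mat r r (\<lambda>(l, i). if l < n then f i l else 0)"
  have A: "A \<in> carrier_mat r r" by (simp add: A_def)
  have "det A = (\<Sum>j<r. A $$ (n, j) * cofactor A n j)"
    by (rule laplace_expansion_row[OF A assms])
  also have "\<dots> = 0" by (rule sum.neutral) (use assms in \<open>simp add: A_def\<close>)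
  finally obtain v where v: "v \<in> carrier_vec r" "v \<noteq> 0\<^sub>v r" "A *\<^sub>v v = 0\<^sub>v r"
    using det_0_iff_vec_prod_zero[OF A] by blast
  have "\<exists>i<r. v $ i \<noteq> 0"
  proof (rule ccontr)
    assume "\<not> ?thesis"
    then have "v = 0\<^sub>v r" using v(1) by (intro eq_vecI) auto
    then show False using v(2) by simp
  qed
  moreover have "(\<Sum>i<r. v $ i * f i l) = 0" if "l < n" for l
  proof -
    have "(A *\<^sub>v v) $ l = (\<Sum>i<r. v $ i * f i l)"
      using that assms v(1)
      by (simp add: A_def scalar_prod_def lessThan_atLeast0 mult.commute)
    then show ?thesis using v(3) that assms by simp
  qed
  ultimately show ?thesis by blast
qed

section \<open>Nilpotent matrices and the order of nilpotency\<close>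

lemma pow_mat_mult_vec:
  assumes A: "A \<in> carrier_mat n n" and v: "v \<in> carrier_vec n"
  shows "(A ^\<^sub>m r) *\<^sub>v v = ((\<lambda>v. A *\<^sub>v v) ^^ r) v"
  using v
proof (induction r arbitrary: v)
  case (Suc r)
  have "(A ^\<^sub>m Suc r) *\<^sub>v v = (A ^\<^sub>m r) *\<^sub>v (A *\<^sub>v v)"
    using A Suc.prems by (simp add: assoc_mult_mat_vec[of _ n n _ n])
  also have "\<dots> = ((\<lambda>v. A *\<^sub>v v) ^^ r) (A *\<^sub>v v)"
    using A Suc by simp
  finally show ?case by (simp add: funpow_swap1)
qed (use A in simp)

lemma funpow_mult_mat_vec_carrier:
  assumes "A \<in> carrier_mat n n" "v \<in> carrier_vec n"
  shows "((\<lambda>v. A *\<^sub>v v) ^^ r) v \<in> carrier_vec n"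
  by (induction r) (use assms in auto)

lemma mat_eq_0_iff_mult_unit_vec:
  assumes A: "(A :: 'a::comm_ring_1 mat) \<in> carrier_mat n n"
  shows "A = 0\<^sub>m n n \<longleftrightarrow> (\<forall>j<n. A *\<^sub>v unit_vec n j = 0\<^sub>v n)"
proof
  assume *: "\<forall>j<n. A *\<^sub>v unit_vec n j = 0\<^sub>v n"
  show "A = 0\<^sub>m n n"
  proof (rule eq_matI)
    fix i j assume "i < dim_row (0\<^sub>m n n :: 'a mat)" "j < dim_col (0\<^sub>m n n :: 'a mat)"
    then have ij: "i < n" "j < n" by simp_all
    have "(A *\<^sub>v unit_vec n j) $ i = A $$ (i, j)" using A ij by simp
    then show "A $$ (i, j) = 0\<^sub>m n n $$ (i, j)" using * ij by simp
  qed (use A in auto)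
next
  assume "A = 0\<^sub>m n n"
  then show "\<forall>j<n. A *\<^sub>v unit_vec n j = 0\<^sub>v n"
    by (auto intro!: eq_vecI)
qed

lemma funpow_eq_0_mono:
  fixes f :: "'a::zero vec \<Rightarrow> 'a vec"
  assumes "(f ^^ r) v = 0\<^sub>v n" "f (0\<^sub>v n) = 0\<^sub>v n" "r \<le> s"
  shows "(f ^^ s) v = 0\<^sub>v n"
proof -
  have "(f ^^ s) v = (f ^^ (s - r)) ((f ^^ r) v)"
    using assms(3) by (metis add.commute comp_apply funpow_add le_add_diff_inverse)
  moreover have "(f ^^ k) (0\<^sub>v n) = 0\<^sub>v n" for k
    by (induction k) (use assms(2) in simp_all)
  ultimately show ?thesis using assms(1) by simp
qed

lemma mult_mat_zero_vec [simp]: "(A :: 'a::comm_ring_1 mat) \<in> carrier_mat n n \<Longrightarrow> A *\<^sub>v 0\<^sub>v n = 0\<^sub>v n"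
  by (rule eq_vecI) auto

lemma nilpotentI:
  fixes A :: "'a::comm_ring_1 mat"
  assumes A: "A \<in> carrier_mat n n" and "\<And>j. j < n \<Longrightarrow> \<exists>r. ((\<lambda>v. A *\<^sub>v v) ^^ r) (unit_vec n j) = 0\<^sub>v n"
  shows "\<exists>r. A ^\<^sub>m r = 0\<^sub>m n n"
proof -
  obtain r where r: "\<And>j. j < n \<Longrightarrow> ((\<lambda>v. A *\<^sub>v v) ^^ r j) (unit_vec n j) = 0\<^sub>v n"
    using assms(2) by metis
  define s where "s = (\<Sum>j<n. r j)"
  have "((\<lambda>v. A *\<^sub>v v) ^^ s) (unit_vec n j) = 0\<^sub>v n" if "j < n" for j
  proof (rule funpow_eq_0_mono[OF r[OF that]])
    show "r j \<le> s" unfolding s_def using that by (intro member_le_sum) auto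
  qed (use A in simp)
  then have "A ^\<^sub>m s = 0\<^sub>m n n"
    using A by (subst mat_eq_0_iff_mult_unit_vec) (simp_all add: pow_mat_mult_vec)
  then show ?thesis by blast
qed

text \<open>\<open>exp_nilpotent\<close> stops at the exponent n, so nilpotency must be visible
  there. If v survived up to a minimal exponent s > n, its s iterates before that would be
  dependent; a suitable power of A turns a dependency into the vanishing of the last one, against
  minimality.\<close>

lemma nilpotent_pow_dim:
  fixes A :: "'a::field mat"
  assumes A: "A \<in> carrier_mat n n" and nil: "A ^\<^sub>m r = 0\<^sub>m n n"
  shows "A ^\<^sub>m n = 0\<^sub>m n n"
proof -
  let ?f = "\<lambda>v. A *\<^sub>v v"
  have "(?f ^^ n) v = 0\<^sub>v n" if v: "v \<in> carrier_vec n" for v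
  proof -
    have c: "(?f ^^ k) v \<in> carrier_vec n" for k by (rule funpow_mult_mat_vec_carrier[OF A v])
    define s where "s = (LEAST s. (?f ^^ s) v = 0\<^sub>v n)"
    have "(?f ^^ r) v = 0\<^sub>v n"
    proof -
      have "(?f ^^ r) v = 0\<^sub>m n n *\<^sub>v v" using nil pow_mat_mult_vec[OF A v, of r] by simp
      also have "\<dots> = 0\<^sub>v n" by (rule eq_vecI) (use v in auto)
      finally show ?thesis .
    qed
    then have s: "(?f ^^ s) v = 0\<^sub>v n" unfolding s_def by (rule LeastI)
    have s': "(?f ^^ k) v \<noteq> 0\<^sub>v n" if "k < s" for k using that unfolding s_def by (rule not_less_Least)
    have above: "(?f ^^ k) v = 0\<^sub>v n" if "s \<le> k" for k
      by (rule funpow_eq_0_mono[OF s]) (use A that in simp_all)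
    show ?thesis
    proof (cases "s \<le> n")
      case True
      then show ?thesis by (rule above)
    next
      case False
      then have "n < s" by simp
      then obtain c where c0: "\<exists>i<s. c i \<noteq> 0" and dep: "\<And>l. l < n \<Longrightarrow> (\<Sum>i<s. c i * ((?f ^^ i) v $ l)) = 0"
        using exists_dependency[of n s "\<lambda>i l. (?f ^^ i) v $ l"] by blast
      have dep': "(\<Sum>i<s. c i * ((?f ^^ (m + i)) v $ l)) = 0" if "l < n" for m l
        using that
      proof (induction m arbitrary: l)
        case 0
        then show ?case using dep by simp
      next
        case (Suc m)
        have "(?f ^^ (Suc m + i)) v $ l = (\<Sum>q<n. A $$ (l, q) * ((?f ^^ (m + i)) v $ q))" for i
          using A Suc.prems c[of "m + i"] by (simp add: scalar_prod_def lessThan_atLeast0)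
        then have "(\<Sum>i<s. c i * ((?f ^^ (Suc m + i)) v $ l)) =
            (\<Sum>i<s. \<Sum>q<n. A $$ (l, q) * (c i * ((?f ^^ (m + i)) v $ q)))"
          by (simp add: sum_distrib_left mult_ac)
        also have "\<dots> = (\<Sum>q<n. A $$ (l, q) * (\<Sum>i<s. c i * ((?f ^^ (m + i)) v $ q)))"
          by (subst sum.swap) (simp add: sum_distrib_left)
        finally show ?case using Suc.IH by simp
      qed
      define i0 where "i0 = (LEAST i. i < s \<and> c i \<noteq> 0)"
      have i0: "i0 < s" "c i0 \<noteq> 0"
        using LeastI_ex[OF c0[unfolded Bex_def]] unfolding i0_def by blast+
      have below: "c i = 0" if "i < i0" for i
        using not_less_Least[of i "\<lambda>i. i < s \<and> c i \<noteq> 0"] that i0(1) unfolding i0_def[symmetric] by auto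
      \<comment> \<open>Applying the power s - 1 - i0 kills every term after the first nonzero
        coefficient i0 and leaves only the iterate s - 1.\<close>
      have "(?f ^^ (s - 1)) v = 0\<^sub>v n"
      proof (rule eq_vecI)
        fix l assume "l < dim_vec (0\<^sub>v n :: 'a vec)"
        then have l: "l < n" by simp
        have "c i * ((?f ^^ (s - 1 - i0 + i)) v $ l) = (if i = i0 then c i0 * ((?f ^^ (s - 1)) v $ l) else 0)"
          if "i < s" for i
        proof (cases i i0 rule: linorder_cases)
          case greater
          then have "(?f ^^ (s - 1 - i0 + i)) v = 0\<^sub>v n" by (intro above) linarith
          then show ?thesis using greater l by simp
        qed (use below i0 in auto)
        then have "(\<Sum>i<s. c i * ((?f ^^ (s - 1 - i0 + i)) v $ l)) =
           (\<Sum>i<s. if i = i0 then c i0 * ((?f ^^ (s - 1)) v $ l) else 0)"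
          by (intro sum.cong) auto
        then have "c i0 * ((?f ^^ (s - 1)) v $ l) = 0"
          using dep'[OF l, of "s - 1 - i0"] i0(1) by simp
        then show "(?f ^^ (s - 1)) v $ l = 0\<^sub>v n $ l" using i0(2) l by simp
      qed (use c[of "s - 1"] in simp)
      then show ?thesis using s'[of "s - 1"] i0(1) by simp
    qed
  qed
  then show ?thesis
    using A by (subst mat_eq_0_iff_mult_unit_vec) (simp_all add: pow_mat_mult_vec)
qed

lemma pow_mat_Suc_index:
  assumes A: "(A :: 'a::comm_ring_1 mat) \<in> carrier_mat n n" and ij: "i < n" "j < n"
  shows "(A ^\<^sub>m Suc r) $$ (i, j) = (\<Sum>l<n. A $$ (i, l) * (A ^\<^sub>m r) $$ (l, j))"
proof -
  have "A ^\<^sub>m r * A = A * A ^\<^sub>m r"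
  proof (induction r)
    case (Suc r)
    have p: "A ^\<^sub>m r \<in> carrier_mat n n" using A by simp
    have "A ^\<^sub>m Suc r * A = A * A ^\<^sub>m r * A" using Suc by simp
    also have "\<dots> = A * (A ^\<^sub>m r * A)" by (rule assoc_mult_mat[OF A p A])
    finally show ?case by simp
  qed (use A in simp)
  then have "A ^\<^sub>m Suc r = A * A ^\<^sub>m r" by simp
  then show ?thesis using A ij by (simp add: scalar_prod_def lessThan_atLeast0)
qed

text \<open>With \<open>exp (t A)\<close> as a matrix over \<open>k[t]\<close>, formal differentiation in \<open>t\<close> relates
  invariance under one-parameter groups to infinitesimal invariance.\<close>

definition exp_poly :: "nat \<Rightarrow> 'k::field_char_0 mat \<Rightarrow> 'k poly mat" where
  "exp_poly n A = mat n n (\<lambda>(i, j). \<Sum>r\<le>n. Polynomial.monom ((A ^\<^sub>m r) $$ (i, j) / fact r) r)"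

lemma exp_poly_carrier [simp]: "exp_poly n A \<in> carrier_mat n n"
  by (simp add: exp_poly_def)

lemma pderiv_sum: "pderiv (\<Sum>i\<in>A. f i) = (\<Sum>i\<in>A. pderiv (f i))"
  by (induction A rule: infinite_finite_induct) (simp_all add: pderiv_add)

text \<open>The differential equation of the exponential. Differentiation drops one term of the
  truncated sum; it can be put back because its coefficient A ^ (n + 1) is zero.\<close>

lemma pderiv_exp_poly:
  assumes A: "A \<in> carrier_mat n n" and nil: "A ^\<^sub>m n = 0\<^sub>m n n" and ij: "i < n" "j < n"
  shows "pderiv (exp_poly n A $$ (i, j)) = (\<Sum>l<n. [:A $$ (i, l):] * exp_poly n A $$ (l, j))"
proof -
  let ?h = "\<lambda>r. Polynomial.monom ((A ^\<^sub>m Suc r) $$ (i, j) / fact r) r"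
  have "pderiv (exp_poly n A $$ (i, j)) = (\<Sum>r\<le>n. Polynomial.monom (of_nat r * ((A ^\<^sub>m r) $$ (i, j) / fact r)) (r - 1))"
    using ij by (simp add: exp_poly_def pderiv_sum pderiv_monom)
  also have "\<dots> = (\<Sum>r<n. ?h r)"
    unfolding sum.atMost_shift
    by (simp add: field_simps del: pow_mat.simps of_nat_Suc)
  also have "\<dots> = (\<Sum>r\<le>n. ?h r)"
  proof -
    have "A ^\<^sub>m Suc n = 0\<^sub>m n n" using nil A by simp
    then show ?thesis using ij by (simp add: lessThan_Suc_atMost[symmetric] del: pow_mat.simps)
  qed
  also have "\<dots> = (\<Sum>r\<le>n. \<Sum>l<n. [:A $$ (i, l):] * Polynomial.monom ((A ^\<^sub>m r) $$ (l, j) / fact r) r)"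
  proof (rule sum.cong[OF refl])
    fix r
    have "?h r = Polynomial.monom (\<Sum>l<n. A $$ (i, l) * ((A ^\<^sub>m r) $$ (l, j) / fact r)) r"
      unfolding pow_mat_Suc_index[OF A ij] by (simp add: sum_divide_distrib)
    also have "\<dots> = (\<Sum>l<n. Polynomial.monom (A $$ (i, l) * ((A ^\<^sub>m r) $$ (l, j) / fact r)) r)"
      by (induction n) (simp_all add: add_monom[symmetric])
    finally show "?h r = (\<Sum>l<n. [:A $$ (i, l):] * Polynomial.monom ((A ^\<^sub>m r) $$ (l, j) / fact r) r)"
      by (simp add: smult_monom)
  qed
  also have "\<dots> = (\<Sum>l<n. [:A $$ (i, l):] * exp_poly n A $$ (l, j))"
  proof -
    have "exp_poly n A $$ (l, j) = (\<Sum>r\<le>n. Polynomial.monom ((A ^\<^sub>m r) $$ (l, j) / fact r) r)" if "l \<in> {..<n}" for l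
      using that ij by (simp add: exp_poly_def)
    then show ?thesis
      by (subst sum.swap) (intro sum.cong refl, simp only: sum_distrib_left)
  qed
  finally show ?thesis .
qed

lemma smult_pow_mat:
  assumes A: "(A :: 'a::comm_ring_1 mat) \<in> carrier_mat n n"
  shows "(t \<cdot>\<^sub>m A) ^\<^sub>m r = t ^ r \<cdot>\<^sub>m (A ^\<^sub>m r)"
proof (induction r)
  case 0
  show ?case using A by (auto intro!: eq_matI)
next
  case (Suc r)
  have p: "A ^\<^sub>m r \<in> carrier_mat n n" using A by simp
  have ss: "t ^ r \<cdot>\<^sub>m (t \<cdot>\<^sub>m M) = t ^ Suc r \<cdot>\<^sub>m M" for M :: "'a mat"
    by (rule eq_matI) (auto simp: mult_ac)
  have "(t \<cdot>\<^sub>m A) ^\<^sub>m Suc r = (t ^ r \<cdot>\<^sub>m A ^\<^sub>m r) * (t \<cdot>\<^sub>m A)" using Suc by simp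
  also have "\<dots> = t ^ r \<cdot>\<^sub>m (t \<cdot>\<^sub>m (A ^\<^sub>m r * A))"
    using mult_smult_assoc_mat[OF p, of "t \<cdot>\<^sub>m A" n "t ^ r"] mult_smult_distrib[OF p A, of t] A by simp
  finally show ?case by (simp only: ss pow_mat.simps)
qed

lemma eval_exp_poly:
  assumes A: "A \<in> carrier_mat n n"
  shows "map_mat (\<lambda>p. poly p t) (exp_poly n A) = exp_nilpotent n (t \<cdot>\<^sub>m A)"
  by (rule eq_matI)
     (use A in \<open>auto simp: exp_poly_def exp_nilpotent_def poly_sum poly_monom smult_pow_mat mult.commute\<close>)

lemma exp_nilpotent_0: "exp_nilpotent n (0 \<cdot>\<^sub>m A) = 1\<^sub>m n" if A: "A \<in> carrier_mat n n"
proof (rule eq_matI)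
  fix i j assume "i < dim_row (1\<^sub>m n :: 'a mat)" "j < dim_col (1\<^sub>m n :: 'a mat)"
  then have ij: "i < n" "j < n" by simp_all
  have "((0 \<cdot>\<^sub>m A) ^\<^sub>m r) $$ (i, j) / fact r = (if r = 0 then 1\<^sub>m n $$ (i, j) else 0)" for r
    unfolding smult_pow_mat[OF A] using A ij by (cases r) auto
  then show "exp_nilpotent n (0 \<cdot>\<^sub>m A) $$ (i, j) = 1\<^sub>m n $$ (i, j)"
    using ij by (simp add: exp_nilpotent_def)
qed (simp_all add: exp_nilpotent_def)

lemma exp_nilpotent_carrier [simp]: "exp_nilpotent n A \<in> carrier_mat n n"
  by (simp add: exp_nilpotent_def)

section \<open>Invariance under one-parameter groups\<close>

lemma coeff_hom_const: "coeff_hom (\<lambda>c::'k::field_char_0. [:c:])"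
  by unfold_locales (simp_all add: one_pCons)

lemma comm_ring_hom_poly: "comm_ring_hom (\<lambda>p. poly p (t::'k::field_char_0))"
  by unfold_locales simp_all

lemma semiring_hom_poly: "semiring_hom (\<lambda>p. poly p (t::'k::field_char_0))"
  by unfold_locales simp_all

text \<open>The product rule: both points and all vectors of \<open>zs\<close> move with velocity D,
  so each letter in turn is replaced by its image under D.\<close>

lemma pderiv_ev:
  fixes D :: "nat \<Rightarrow> nat \<Rightarrow> 'k::field_char_0" and a b :: "'k poly vec" and zs :: "'k poly vec list"
  assumes a: "\<And>i. i < n \<Longrightarrow> pderiv (a $ i) = (\<Sum>j<n. [:D i j:] * a $ j)"
    and b: "\<And>i. i < n \<Longrightarrow> pderiv (b $ i) = (\<Sum>j<n. [:D i j:] * b $ j)"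
    and zs: "\<And>z i. z \<in> set zs \<Longrightarrow> i < n \<Longrightarrow> pderiv (z $ i) = (\<Sum>j<n. [:D i j:] * z $ j)"
    and w: "fst ` set w \<subseteq> {..<n}"
  shows "pderiv (ev a b zs w) = mat_der n (\<lambda>i j. [:D i j:]) (ev a b zs) w"
  using zs w
proof (induction w arbitrary: zs)
  case Nil
  then show ?case by simp
next
  case (Cons x w)
  have x: "fst x < n" and w: "fst ` set w \<subseteq> {..<n}" using Cons.prems(2) by auto
  show ?case
  proof (cases "snd x = 2")
    case True
    have sg: "pderiv ((- 1) ^ s * p) = (- 1) ^ s * pderiv p" for s and p :: "'k poly"
      by (cases "even s") (simp_all add: pderiv_minus)
    have r: "pderiv (ev a b (remove_nth s zs) w) = mat_der n (\<lambda>i j. [:D i j:]) (ev a b (remove_nth s zs)) w" for s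
      by (rule Cons.IH[OF _ w])
         (use Cons.prems(1) in \<open>auto simp: remove_nth_def dest: in_set_takeD in_set_dropD\<close>)
    have z: "pderiv (zs ! s $ fst x) = (\<Sum>j<n. [:D (fst x) j:] * zs ! s $ j)" if "s < length zs" for s
      using Cons.prems(1)[OF nth_mem[OF that] x] .
    have "pderiv (ev a b zs (x # w)) =
      (\<Sum>s<length zs. (- 1) ^ s * pderiv (zs ! s $ fst x * ev a b (remove_nth s zs) w))"
      using True by (simp add: ev_odd pderiv_sum sg mult.assoc)
    also have "\<dots> = (\<Sum>s<length zs. (- 1) ^ s * ((\<Sum>j<n. [:D (fst x) j:] * zs ! s $ j) * ev a b (remove_nth s zs) w)) +
      (\<Sum>s<length zs. (- 1) ^ s * (zs ! s $ fst x * mat_der n (\<lambda>i j. [:D i j:]) (ev a b (remove_nth s zs)) w))"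
      unfolding sum.distrib[symmetric]
      by (rule sum.cong) (simp_all add: pderiv_mult r z distrib_left add.commute mult.commute)
    also have "(\<Sum>s<length zs. (- 1) ^ s * ((\<Sum>j<n. [:D (fst x) j:] * zs ! s $ j) * ev a b (remove_nth s zs) w)) =
       (\<Sum>j<n. [:D (fst x) j:] * ev a b zs ((j, snd x) # w))"
      using True
      by (simp only: ev_odd snd_conv fst_conv sum_distrib_left sum_distrib_right)
         (subst sum.swap, simp only: mult_ac)
    also have "(\<Sum>s<length zs. (- 1) ^ s * (zs ! s $ fst x * mat_der n (\<lambda>i j. [:D i j:]) (ev a b (remove_nth s zs)) w)) =
       mat_der n (\<lambda>i j. [:D i j:]) (\<lambda>v. ev a b zs (x # v)) w"
      using True by (simp only: ev_odd mat_der_fun_sum mat_der_fun_mult mult.assoc)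
    finally show ?thesis by (simp only: mat_der.simps)
  next
    case False
    have c: "pderiv (coord x a b) = (\<Sum>j<n. [:D (fst x) j:] * coord (j, snd x) a b)"
      using a[OF x] b[OF x] by (simp add: coord_def)
    have "pderiv (ev a b zs (x # w)) = (\<Sum>j<n. [:D (fst x) j:] * coord (j, snd x) a b) * ev a b zs w +
        coord x a b * mat_der n (\<lambda>i j. [:D i j:]) (ev a b zs) w"
      using False by (simp only: ev_even[OF False] pderiv_mult c Cons.IH[OF Cons.prems(1) w] add.commute mult.commute)
    then show ?thesis
      using False by (simp only: mat_der.simps ev_even snd_conv sum_distrib_right mult.assoc mat_der_fun_mult
          not_False_eq_True)
  qed
qed

lemma (in comm_ring_hom) ev_hom:
  assumes "a \<in> carrier_vec n" "b \<in> carrier_vec n" "set zs \<subseteq> carrier_vec n" "fst ` set w \<subseteq> {..<n}"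
  shows "hom (ev a b zs w) = ev (map_vec hom a) (map_vec hom b) (map (map_vec hom) zs) w"
  using assms
proof (induction w arbitrary: zs)
  case Nil
  then show ?case by simp
next
  case (Cons x w)
  have x: "fst x < n" and w: "fst ` set w \<subseteq> {..<n}" using Cons.prems by auto
  show ?case
  proof (cases "snd x = 2")
    case True
    have "hom (ev a b zs (x # w)) =
      (\<Sum>s<length zs. (- 1) ^ s * hom (zs ! s $ fst x) * hom (ev a b (remove_nth s zs) w))"
      using True by (simp add: ev_odd hom_sum hom_mult hom_power hom_uminus)
    also have "\<dots> = (\<Sum>s<length zs. (- 1) ^ s * (map (map_vec hom) zs ! s $ fst x) *
        ev (map_vec hom a) (map_vec hom b) (remove_nth s (map (map_vec hom) zs)) w)"
    proof (rule sum.cong[OF refl])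
      fix s assume "s \<in> {..<length zs}"
      then have "zs ! s \<in> carrier_vec n" using Cons.prems(3) by (auto dest: nth_mem)
      moreover have "set (remove_nth s zs) \<subseteq> carrier_vec n"
        using Cons.prems(3) by (auto simp: remove_nth_def dest: in_set_takeD in_set_dropD)
      ultimately show "(- 1) ^ s * hom (zs ! s $ fst x) * hom (ev a b (remove_nth s zs) w) =
        (- 1) ^ s * (map (map_vec hom) zs ! s $ fst x) *
        ev (map_vec hom a) (map_vec hom b) (remove_nth s (map (map_vec hom) zs)) w"
        using Cons.IH[OF Cons.prems(1,2) _ w] x \<open>s \<in> {..<length zs}\<close> by (simp add: map_remove_nth)
    qed
    finally show ?thesis using True by (simp add: ev_odd)
  next
    case False
    have "hom (coord x a b) = coord x (map_vec hom a) (map_vec hom b)"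
      using Cons.prems(1,2) x by (simp add: coord_def)
    then show ?thesis
      using False Cons.IH[OF Cons.prems(1-3) w] by (simp add: ev_even hom_mult)
  qed
qed

text \<open>The curve exp (tA) a with polynomial entries in t, so that derivatives in t are
  formal.\<close>

definition flow_point :: "nat \<Rightarrow> 'k::field_char_0 mat \<Rightarrow> 'k vec \<Rightarrow> 'k poly vec" where
  "flow_point n A a = exp_poly n A *\<^sub>v map_vec (\<lambda>c. [:c:]) a"

lemma flow_point_carrier [simp]: "flow_point n A a \<in> carrier_vec n"
  by (rule carrier_vecI) (simp add: flow_point_def exp_poly_def)

lemma pderiv_flow_point:
  assumes A: "A \<in> carrier_mat n n" and nil: "A ^\<^sub>m n = 0\<^sub>m n n" and a: "a \<in> carrier_vec n" and i: "i < n"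
  shows "pderiv (flow_point n A a $ i) = (\<Sum>j<n. [:A $$ (i, j):] * flow_point n A a $ j)"
proof -
  have fp: "flow_point n A a $ i = (\<Sum>l<n. exp_poly n A $$ (i, l) * [:a $ l:])" if "i < n" for i
    using a that exp_poly_carrier[of n A]
    by (simp add: flow_point_def scalar_prod_def lessThan_atLeast0 del: exp_poly_carrier)
  have "pderiv (flow_point n A a $ i) = (\<Sum>l<n. (\<Sum>j<n. [:A $$ (i, j):] * exp_poly n A $$ (j, l)) * [:a $ l:])"
    unfolding fp[OF i] pderiv_sum
    by (rule sum.cong) (use A nil i in \<open>simp_all add: pderiv_smult pderiv_exp_poly mult.commute\<close>)
  also have "\<dots> = (\<Sum>j<n. [:A $$ (i, j):] * (\<Sum>l<n. exp_poly n A $$ (j, l) * [:a $ l:]))"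
    unfolding sum_distrib_left sum_distrib_right by (subst sum.swap) (simp only: mult.assoc)
  finally show ?thesis by (simp add: fp)
qed

lemma eval_flow_point:
  assumes A: "A \<in> carrier_mat n n" and a: "a \<in> carrier_vec n"
  shows "map_vec (\<lambda>p. poly p t) (flow_point n A a) = exp_nilpotent n (t \<cdot>\<^sub>m A) *\<^sub>v a"
proof -
  have "map_vec (\<lambda>p. poly p t) (map_vec (\<lambda>c. [:c:]) a) = a" by (rule eq_vecI) auto
  then show ?thesis
    unfolding flow_point_def eval_exp_poly[OF A, symmetric]
    using semiring_hom.mult_mat_vec_hom[OF semiring_hom_poly exp_poly_carrier[of n A], of "map_vec (\<lambda>c. [:c:]) a"] a by simp
qed

lemma poly_lin: "poly (lin (\<lambda>c. [:c:]) \<phi> f) t = lin (\<lambda>c. c) (\<lambda>w. poly (\<phi> w) t) f"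
  by (simp add: lin_def poly_sum)

lemma pderiv_lin: "pderiv (lin (\<lambda>c. [:c:]) \<phi> f) = lin (\<lambda>c. [:c:]) (\<lambda>w. pderiv (\<phi> w)) f"
  by (simp add: lin_def pderiv_sum pderiv_smult)

lemma salg_eq_0I:
  fixes f :: "'k::field_char_0 salg"
  assumes "f \<in> salg n"
    and "\<And>a b zs. a \<in> carrier_vec n \<Longrightarrow> b \<in> carrier_vec n \<Longrightarrow> set zs \<subseteq> carrier_vec n \<Longrightarrow> pev a b zs f = 0"
  shows "f = 0"
proof (rule coeff_hom.ev_inject[OF coeff_hom_id assms(1)])
  fix \<alpha> \<beta> :: "nat \<Rightarrow> nat" and zs :: "'k vec list"
  assume "set zs \<subseteq> unit_vec n ` {..<n}"
  then have "set zs \<subseteq> carrier_vec n" by auto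
  then show "lin (\<lambda>c. c) (ev (nat_vec n \<alpha>) (nat_vec n \<beta>) zs) f = 0"
    using assms(2)[of "nat_vec n \<alpha>" "nat_vec n \<beta>" zs] by (simp add: pev_def)
qed

lemma ad_mat_carrier [simp]: "ad_mat n br x \<in> carrier_mat n n"
  by (simp add: ad_mat_def)

context
  fixes n :: nat and br :: "'k::field_char_0 vec \<Rightarrow> 'k vec \<Rightarrow> 'k vec" and x :: "'k vec" and f :: "'k salg"
  assumes f: "f \<in> salg n" and nil: "\<exists>r. ad_mat n br x ^\<^sub>m r = 0\<^sub>m n n"
begin

private abbreviation "A \<equiv> ad_mat n br x"
private abbreviation "E t \<equiv> exp_nilpotent n (t \<cdot>\<^sub>m A)"
private abbreviation "flow \<equiv> flow_point n A"

private lemma flow_value: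
  assumes "a \<in> carrier_vec n" "b \<in> carrier_vec n" "set zs \<subseteq> carrier_vec n" and g: "g \<in> salg n"
  shows "poly (lin (\<lambda>c. [:c:]) (ev (flow a) (flow b)
       (map (flow) zs)) g) t =
     pev (E t *\<^sub>v a) (E t *\<^sub>v b)
       (mult_vecs (E t) zs) g"
proof -
  have zs: "map (map_vec (\<lambda>p. poly p t) \<circ> flow) zs =
      mult_vecs (E t) zs"
  proof (rule map_cong[OF refl])
    fix z assume "z \<in> set zs"
    then have "z \<in> carrier_vec n" using assms(3) by blast
    then show "(map_vec (\<lambda>p. poly p t) \<circ> flow) z =
        E t *\<^sub>v z"
      by (simp only: comp_apply eval_flow_point[OF ad_mat_carrier])
  qed
  show ?thesis
    unfolding poly_lin pev_def
  proof (rule lin_cong)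
    fix w assume "w \<in> keys g"
    then have w: "fst ` set w \<subseteq> {..<n}" using fst_letters_of_salg[OF g] by blast
    have "set (map (flow) zs) \<subseteq> carrier_vec n" by auto
    from comm_ring_hom.ev_hom[OF comm_ring_hom_poly[of t] flow_point_carrier[of n "A" a] flow_point_carrier[of n "A" b] this w]
    show "poly (ev (flow a) (flow b)
         (map (flow) zs) w) t =
       ev (E t *\<^sub>v a) (E t *\<^sub>v b)
         (mult_vecs (E t) zs) w"
      unfolding map_map zs eval_flow_point[OF ad_mat_carrier assms(1)] eval_flow_point[OF ad_mat_carrier assms(2)] .
  qed
qed

text \<open>Differentiation along the flow of \<open>ad x\<close> is minus the coadjoint action, the
  minus sign being that of the contragredient action. The derivative is again evaluated along the
  flow, so this is an identity in t and not only a statement at t = 0.\<close>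

private lemma pderiv_flow:
  assumes "a \<in> carrier_vec n" "b \<in> carrier_vec n" "set zs \<subseteq> carrier_vec n"
  shows "pderiv (lin (\<lambda>c. [:c:]) (ev (flow a) (flow b)
       (map (flow) zs)) f) =
     - lin (\<lambda>c. [:c:]) (ev (flow a) (flow b)
       (map (flow) zs)) (coad_action C2 n br x f)"
proof -
  have nil': "A ^\<^sub>m n = 0\<^sub>m n n" using nil nilpotent_pow_dim[OF ad_mat_carrier] by blast
  define \<phi> where "\<phi> = ev (flow a) (flow b) (map (flow) zs)"
  have *: "mat_der n (\<lambda>i j. [:- (br x (unit_vec n j) $ i):]) \<phi> w = - pderiv (\<phi> w)" if "w \<in> keys f" for w
  proof -
    have w: "fst ` set w \<subseteq> {..<n}" using fst_letters_of_salg[OF f that] .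
    have "mat_der n (\<lambda>i j. [:- (br x (unit_vec n j) $ i):]) \<phi> w = mat_der n (\<lambda>i j. - 1 * [:A $$ (i, j):]) \<phi> w"
      by (rule mat_der_cong[OF _ w]) (simp add: ad_mat_def)
    also have "\<dots> = - mat_der n (\<lambda>i j. [:A $$ (i, j):]) \<phi> w" 
      by (subst mat_der_mult) simp
    also have "mat_der n (\<lambda>i j. [:A $$ (i, j):]) \<phi> w = pderiv (\<phi> w)"
      unfolding \<phi>_def
      by (rule pderiv_ev[symmetric])
         (use assms w pderiv_flow_point[OF ad_mat_carrier nil'] in auto)
    finally show ?thesis .
  qed
  have ss: "supersym \<phi>" unfolding \<phi>_def by (rule supersym_ev)
  have "lin (\<lambda>c. [:c:]) \<phi> (coad_action C2 n br x f) = lin (\<lambda>c. [:c:]) (\<lambda>w. - 1 * pderiv (\<phi> w)) f"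
    unfolding coeff_hom.lin_coad_action[OF coeff_hom_const ss]
    by (rule lin_cong) (simp add: *)
  then show ?thesis unfolding \<phi>_def[symmetric] pderiv_lin lin_fun_mult by simp
qed

text \<open>The value along the flow is a polynomial with derivative 0, hence constant in
  characteristic 0; its values at t = 1 and t = 0 are compared.\<close>

lemma exp_invariant_if_coad_0:
  assumes coad: "coad_action C2 n br x f = 0"
    and c: "a \<in> carrier_vec n" "b \<in> carrier_vec n" "set zs \<subseteq> carrier_vec n"
    shows "pev (exp_nilpotent n A *\<^sub>v a) (exp_nilpotent n A *\<^sub>v b) (mult_vecs (exp_nilpotent n A) zs) f = pev a b zs f"
proof -
  define G where "G = lin (\<lambda>c. [:c:]) (ev (flow a) (flow b) (map (flow) zs)) f"
  have "pderiv G = 0"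
    unfolding G_def pderiv_flow[OF c] coad coeff_hom.lin_0[OF coeff_hom_const] by simp
  then obtain k where k: "G = [:k:]" by (metis pderiv_eq_0_iff degree_0_id)
  have 1: "1 \<cdot>\<^sub>m A = A" by (rule eq_matI) auto
  have 0: "mult_vecs (1\<^sub>m n) zs = zs" using c(3) by (intro map_idI) auto
  have "poly G 1 = poly G 0" by (simp add: k)
  then show ?thesis
    using c unfolding G_def flow_value[OF c f] exp_nilpotent_0[OF ad_mat_carrier] 1 0 by simp
qed

text \<open>Equal values for all t in an infinite field make the value along the flow a constant
  polynomial; its derivative is read off at t = 0, where the flow is the identity.\<close>

lemma coad_0_if_exp_invariant:
  assumes inv: "\<And>t a b zs. a \<in> carrier_vec n \<Longrightarrow> b \<in> carrier_vec n \<Longrightarrow> set zs \<subseteq> carrier_vec n \<Longrightarrow>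
      pev (E t *\<^sub>v a) (E t *\<^sub>v b)
       (mult_vecs (E t) zs) f = pev a b zs f"
  shows "coad_action C2 n br x f = 0"
proof (rule salg_eq_0I[OF salg_coad_action[OF f]])
  fix a b :: "'k vec" and zs :: "'k vec list"
  assume c: "a \<in> carrier_vec n" "b \<in> carrier_vec n" "set zs \<subseteq> carrier_vec n"
  define \<phi> where "\<phi> = ev (flow a) (flow b) (map (flow) zs)"
  define G where "G = lin (\<lambda>c. [:c:]) \<phi> f"
  have "poly (G - [:pev a b zs f:]) t = 0" for t
    unfolding G_def \<phi>_def using flow_value[OF c f] inv[OF c] by simp
  then have "{t. poly (G - [:pev a b zs f:]) t = 0} = UNIV" by auto
  then have "G - [:pev a b zs f:] = 0"
    using poly_roots_finite[of "G - [:pev a b zs f:]"] infinite_UNIV_char_0[where 'a='k] by auto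
  then have "pderiv G = 0" by (simp add: pderiv_pCons)
  then have "lin (\<lambda>c. [:c:]) \<phi> (coad_action C2 n br x f) = 0"
    unfolding G_def \<phi>_def pderiv_flow[OF c] by simp
  then have "poly (lin (\<lambda>c. [:c:]) \<phi> (coad_action C2 n br x f)) 0 = 0" by simp
  moreover have "mult_vecs (1\<^sub>m n) zs = zs" using c(3) by (intro map_idI) auto
  ultimately show "pev a b zs (coad_action C2 n br x f) = 0"
    using c unfolding \<phi>_def flow_value[OF c salg_coad_action[OF f]] exp_nilpotent_0[OF ad_mat_carrier] by simp
qed

end

section \<open>Generalized eigenvectors\<close>

text \<open>Finite sums without coefficients. The sets S that occur are stable under scalars, so
  these are linear spans.\<close>

inductive_set vsum :: "nat \<Rightarrow> 'a::field vec set \<Rightarrow> 'a vec set" for n :: nat and S :: "'a vec set" where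
  zero: "0\<^sub>v n \<in> vsum n S"
| add: "u \<in> S \<Longrightarrow> v \<in> vsum n S \<Longrightarrow> u + v \<in> vsum n S"

lemma vsum_carrier:
  assumes "S \<subseteq> carrier_vec n"
  shows "v \<in> vsum n S \<Longrightarrow> v \<in> carrier_vec n"
  by (induction rule: vsum.induct) (use assms in auto)

lemma vsum_add:
  assumes S: "S \<subseteq> carrier_vec n" and "u \<in> vsum n S" and v: "v \<in> vsum n S"
  shows "u + v \<in> vsum n S"
  using assms(2)
proof induction
  case zero
  show ?case using v vsum_carrier[OF S v] by simp
next
  case (add w u)
  have "w + (u + v) \<in> vsum n S" by (rule vsum.add[OF add.hyps(1) add.IH])
  then show ?case
    using assoc_add_vec[OF subsetD[OF S add.hyps(1)] vsum_carrier[OF S add.hyps(2)] vsum_carrier[OF S v]]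
    by simp
qed

lemma vsum_base: "S \<subseteq> carrier_vec n \<Longrightarrow> u \<in> S \<Longrightarrow> u \<in> vsum n S"
  using vsum.add[OF _ vsum.zero, of u S n] by (metis right_zero_vec subsetD)

definition shift :: "'a::field mat \<Rightarrow> 'a \<Rightarrow> 'a vec \<Rightarrow> 'a vec" where
  "shift A l v = A *\<^sub>v v - l \<cdot>\<^sub>v v"

text \<open>Vectors killed by some power of A - l. As an inductive set it comes with induction on
  that power.\<close>

inductive_set geneig :: "nat \<Rightarrow> 'a::field mat \<Rightarrow> 'a \<Rightarrow> 'a vec set"
  for n :: nat and A :: "'a mat" and l :: 'a where
  zero: "0\<^sub>v n \<in> geneig n A l"
| step: "v \<in> carrier_vec n \<Longrightarrow> shift A l v \<in> geneig n A l \<Longrightarrow> v \<in> geneig n A l"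

lemma geneig_carrier: "v \<in> geneig n A l \<Longrightarrow> v \<in> carrier_vec n"
  by (induction rule: geneig.induct) auto

lemma geneig_Un_carrier: "(\<Union>l. geneig n A l) \<subseteq> carrier_vec n"
  using geneig_carrier by blast

text \<open>With a i as a coordinate of the i-th iterate of v, this says that (X - l) q evaluated at
  A and applied to v equals q evaluated at A and applied to (A - l) v.\<close>

lemma sum_coeff_mult_linear:
  fixes q :: "'a::field poly"
  assumes "q \<noteq> 0"
  shows "(\<Sum>i\<le>Polynomial.degree ([:- l, 1:] * q). Polynomial.coeff ([:- l, 1:] * q) i * a i) =
    (\<Sum>i\<le>Polynomial.degree q. Polynomial.coeff q i * (a (Suc i) - l * a i))"
proof -
  have deg: "Polynomial.degree ([:- l, 1:] * q) = Suc (Polynomial.degree q)"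
    using assms by (subst degree_mult_eq) auto
  have c0: "Polynomial.coeff ([:- l, 1:] * q) 0 = - l * Polynomial.coeff q 0" by simp
  have cS: "Polynomial.coeff ([:- l, 1:] * q) (Suc i) = Polynomial.coeff q i - l * Polynomial.coeff q (Suc i)" for i
    by simp
  have top: "Polynomial.coeff q (Suc (Polynomial.degree q)) = 0" by (simp add: coeff_eq_0)
  have "(\<Sum>i\<le>Polynomial.degree ([:- l, 1:] * q). Polynomial.coeff ([:- l, 1:] * q) i * a i) =
     (\<Sum>i\<le>Polynomial.degree q. Polynomial.coeff q i * a (Suc i)) -
     l * (Polynomial.coeff q 0 * a 0 + (\<Sum>i\<le>Polynomial.degree q. Polynomial.coeff q (Suc i) * a (Suc i)))"
    unfolding deg sum.atMost_Suc_shift c0 cS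
    by (simp add: algebra_simps sum_subtractf sum_distrib_left)
  also have "Polynomial.coeff q 0 * a 0 + (\<Sum>i\<le>Polynomial.degree q. Polynomial.coeff q (Suc i) * a (Suc i)) =
      (\<Sum>i\<le>Suc (Polynomial.degree q). Polynomial.coeff q i * a i)"
    by (simp only: sum.atMost_Suc_shift)
  also have "\<dots> = (\<Sum>i\<le>Polynomial.degree q. Polynomial.coeff q i * a i)"
    using top by simp
  finally show ?thesis by (simp add: algebra_simps sum_subtractf sum_distrib_left)
qed

context
  fixes n :: nat and A :: "'a::field mat"
  assumes A: "A \<in> carrier_mat n n"
begin

lemma shift_carrier [simp]: "v \<in> carrier_vec n \<Longrightarrow> shift A l v \<in> carrier_vec n"
  using A by (simp add: shift_def)

lemma shift_zero [simp]: "shift A l (0\<^sub>v n) = 0\<^sub>v n"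
  by (rule eq_vecI) (use A in \<open>auto simp: shift_def\<close>)

lemma shift_add:
  "u \<in> carrier_vec n \<Longrightarrow> v \<in> carrier_vec n \<Longrightarrow> shift A l (u + v) = shift A l u + shift A l v"
  unfolding shift_def using A
  by (subst mult_add_distrib_mat_vec[OF A]) (auto intro!: eq_vecI simp: algebra_simps)

lemma shift_smult: "v \<in> carrier_vec n \<Longrightarrow> shift A l (c \<cdot>\<^sub>v v) = c \<cdot>\<^sub>v shift A l v"
  unfolding shift_def using A
  by (subst mult_mat_vec[OF A]) (auto intro!: eq_vecI simp: algebra_simps)

lemma geneig_shift: "v \<in> geneig n A l \<Longrightarrow> shift A l v \<in> geneig n A l"
  by (cases rule: geneig.cases) (auto intro: geneig.zero)

lemma geneig_add: "u \<in> geneig n A l \<Longrightarrow> v \<in> geneig n A l \<Longrightarrow> u + v \<in> geneig n A l"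
proof (induction arbitrary: v rule: geneig.induct)
  case zero
  then show ?case using geneig_carrier by fastforce
next
  case (step u)
  have v: "v \<in> carrier_vec n" by (rule geneig_carrier[OF step.prems])
  have "shift A l (u + v) \<in> geneig n A l"
    unfolding shift_add[OF step.hyps(1) v] by (rule step.IH[OF geneig_shift[OF step.prems]])
  then show ?case using step.hyps(1) v by (intro geneig.step[of "u + v"]) auto
qed

lemma geneig_smult: "v \<in> geneig n A l \<Longrightarrow> c \<cdot>\<^sub>v v \<in> geneig n A l"
proof (induction rule: geneig.induct)
  case zero
  have "c \<cdot>\<^sub>v 0\<^sub>v n = 0\<^sub>v n" by auto
  then show ?case using geneig.zero by simp
next
  case (step v)
  then show ?case by (intro geneig.step[of "c \<cdot>\<^sub>v v"]) (auto simp: shift_smult)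
qed

lemma geneig_mult: "v \<in> geneig n A l \<Longrightarrow> A *\<^sub>v v \<in> geneig n A l"
proof -
  assume v: "v \<in> geneig n A l"
  have "A *\<^sub>v v = shift A l v + l \<cdot>\<^sub>v v"
    using A geneig_carrier[OF v] by (intro eq_vecI) (auto simp: shift_def)
  then show ?thesis using geneig_add[OF geneig_shift[OF v] geneig_smult[OF v, of l]] by simp
qed

lemma geneig_funpow: "v \<in> geneig n A l \<Longrightarrow> ((\<lambda>v. A *\<^sub>v v) ^^ r) v \<in> geneig n A l"
  by (induction r) (auto intro: geneig_mult)

lemma geneig_0_nilpotent: "v \<in> geneig n A 0 \<Longrightarrow> \<exists>r. ((\<lambda>v. A *\<^sub>v v) ^^ r) v = 0\<^sub>v n"
proof (induction rule: geneig.induct)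
  case zero
  show ?case by (rule exI[of _ 0]) simp
next
  case (step v)
  have "shift A 0 v = A *\<^sub>v v" using A step.hyps(1) by (intro eq_vecI) (auto simp: shift_def)
  then obtain r where "((\<lambda>v. A *\<^sub>v v) ^^ r) (A *\<^sub>v v) = 0\<^sub>v n" using step.IH by auto
  then show ?case by (intro exI[of _ "Suc r"]) (simp add: funpow_swap1)
qed

text \<open>Since (A - l) - (A - m) is the nonzero scalar m - l, a solution v for the right-hand
  side (A - m) w yields the solution (w - v) / (m - l) for w.\<close>

lemma geneig_solve:
  assumes "l \<noteq> m"
  shows "w \<in> geneig n A m \<Longrightarrow> \<exists>v\<in>geneig n A m. shift A l v = w"
proof (induction rule: geneig.induct)
  case zero
  show ?case by (rule bexI[of _ "0\<^sub>v n"]) (auto intro: geneig.zero)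
next
  case (step w)
  then obtain v where v: "v \<in> geneig n A m" "shift A l v = shift A m w" by blast
  have w: "w \<in> geneig n A m" using step.hyps by (rule geneig.step)
  let ?u = "(1 / (m - l)) \<cdot>\<^sub>v (w + (- 1) \<cdot>\<^sub>v v)"
  have c: "v \<in> carrier_vec n" "w \<in> carrier_vec n" by (rule geneig_carrier[OF v(1)], rule step.hyps(1))
  have "shift A l ?u = (1 / (m - l)) \<cdot>\<^sub>v (shift A l w + (- 1) \<cdot>\<^sub>v shift A m w)"
    using c by (simp add: shift_smult shift_add v(2))
  also have "\<dots> = w"
    by (rule eq_vecI) (use c A assms in \<open>auto simp: shift_def field_simps\<close>)
  finally show ?case using geneig_smult[OF geneig_add[OF w geneig_smult[OF v(1)]]] by blast
qed

abbreviation eigsum :: "'a vec set" where "eigsum \<equiv> vsum n (\<Union>l. geneig n A l)"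

text \<open>On the sum of the generalized eigenspaces, A - l is onto up to the eigenspace of l:
  every element is w0 + (A - l) u with w0 in that eigenspace. If this element is (A - l) v, then v -
  u is a generalized eigenvector for l.\<close>

lemma eigsum_if_shift:
  assumes v: "v \<in> carrier_vec n" and "shift A l v \<in> eigsum"
  shows "v \<in> eigsum"
proof -
  have dec: "\<exists>w0\<in>geneig n A l. \<exists>u\<in>eigsum. w = w0 + shift A l u" if "w \<in> eigsum" for w
    using that
  proof induction
    case zero
    show ?case using geneig.zero vsum.zero by (auto intro!: bexI[of _ "0\<^sub>v n"])
  next
    case (add w w')
    then obtain w0 u where *: "w0 \<in> geneig n A l" "u \<in> eigsum" "w' = w0 + shift A l u" by blast
    obtain m where m: "w \<in> geneig n A m" using add.hyps(1) by blast
    have c: "w0 \<in> carrier_vec n" "u \<in> carrier_vec n" "w \<in> carrier_vec n"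
      using * m geneig_carrier vsum_carrier[OF geneig_Un_carrier] by auto
    show ?case
    proof (cases "m = l")
      case True
      have "w + w' = (w + w0) + shift A l u"
        using c by (simp add: *(3) assoc_add_vec[of _ n])
      then show ?thesis using True m * geneig_add by blast
    next
      case False
      then obtain y where y: "y \<in> geneig n A m" "shift A l y = w" using geneig_solve[of l m w] m by auto
      have yc: "y \<in> carrier_vec n" using geneig_carrier[OF y(1)] .
      have "w + w' = w0 + shift A l (y + u)"
        using c yc A unfolding shift_add[OF yc c(2)] y(2) *(3) by (intro eq_vecI) auto
      moreover have "y + u \<in> eigsum" using y(1) *(2) by (intro vsum.add) auto
      ultimately show ?thesis using *(1) by blast
    qed
  qed
  then obtain w0 u where *: "w0 \<in> geneig n A l" "u \<in> eigsum" "shift A l v = w0 + shift A l u"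
    using assms(2) by blast
  have c: "w0 \<in> carrier_vec n" "u \<in> carrier_vec n"
    using * geneig_carrier vsum_carrier[OF geneig_Un_carrier] by auto
  have "shift A l (v + (- 1) \<cdot>\<^sub>v u) = w0 + shift A l u + (- 1) \<cdot>\<^sub>v shift A l u"
    using c v by (simp add: shift_add shift_smult *(3))
  also have "\<dots> = w0"
    by (rule eq_vecI) (use c A in \<open>auto simp: shift_def\<close>)
  finally have "shift A l (v + (- 1) \<cdot>\<^sub>v u) \<in> geneig n A l" using *(1) by simp
  then have "v + (- 1) \<cdot>\<^sub>v u \<in> geneig n A l"
    using c v by (intro geneig.step[of "v + (- 1) \<cdot>\<^sub>v u"]) auto
  then have "(v + (- 1) \<cdot>\<^sub>v u) + u \<in> eigsum" using *(2) by (intro vsum.add) auto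
  moreover have "(v + (- 1) \<cdot>\<^sub>v u) + u = v" using c v by (intro eq_vecI) auto
  ultimately show ?thesis by simp
qed

end

text \<open>Some nonzero polynomial p in A kills v. Over an algebraically closed field a root l of p
  splits off, the quotient kills (A - l) v, and induction on the degree together with
  \<open>eigsum_if_shift\<close> gives v.\<close>

lemma eigsum_eq_carrier:
  fixes A :: "'a::alg_closed_field mat"
  assumes A: "A \<in> carrier_mat n n" and v: "v \<in> carrier_vec n"
  shows "v \<in> vsum n (\<Union>l. geneig n A l)"
proof -
  let ?f = "\<lambda>v. A *\<^sub>v v"
  have *: "v \<in> vsum n (\<Union>l. geneig n A l)"
    if "p \<noteq> 0" "v \<in> carrier_vec n"
      "\<And>l. l < n \<Longrightarrow> (\<Sum>i\<le>Polynomial.degree p. Polynomial.coeff p i * ((?f ^^ i) v $ l)) = 0" for p v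
    using that
  proof (induction "Polynomial.degree p" arbitrary: p v)
    case 0
    then obtain c where c: "p = [:c:]" "c \<noteq> 0" by (metis degree_0_id pCons_eq_0_iff)
    have "v = 0\<^sub>v n"
      by (rule eq_vecI) (use 0 c in auto)
    then show ?case by (simp add: vsum.zero)
  next
    case (Suc d)
    obtain l where "poly p l = 0"
      using alg_closed_imp_poly_has_root[of p] Suc.hyps(2) by auto
    then obtain q where q: "p = [:- l, 1:] * q" by (metis poly_eq_0_iff_dvd dvdE)
    have q0: "q \<noteq> 0" using Suc.prems(1) q by auto
    have "Polynomial.degree p = Suc (Polynomial.degree q)" unfolding q using q0 by (subst degree_mult_eq) auto
    then have d: "d = Polynomial.degree q" using Suc.hyps(2) by simp
    have v': "v \<in> carrier_vec n" by fact
    have sh: "(?f ^^ i) (shift A l v) = (?f ^^ Suc i) v - l \<cdot>\<^sub>v (?f ^^ i) v" for i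
    proof (induction i)
      case 0
      show ?case by (simp add: shift_def)
    next
      case (Suc i)
      have c: "(?f ^^ j) v \<in> carrier_vec n" for j by (rule funpow_mult_mat_vec_carrier[OF A v'])
      have "(?f ^^ Suc i) (shift A l v) = A *\<^sub>v ((?f ^^ Suc i) v - l \<cdot>\<^sub>v (?f ^^ i) v)"
        using Suc.IH by simp
      also have "\<dots> = A *\<^sub>v (?f ^^ Suc i) v - A *\<^sub>v (l \<cdot>\<^sub>v (?f ^^ i) v)"
        by (rule mult_minus_distrib_mat_vec[OF A]) (use c[of i] c[of "Suc i"] in auto)
      also have "A *\<^sub>v (l \<cdot>\<^sub>v (?f ^^ i) v) = l \<cdot>\<^sub>v (A *\<^sub>v (?f ^^ i) v)"
        by (rule mult_mat_vec[OF A c])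
      finally show ?case by simp
    qed
    have "shift A l v \<in> vsum n (\<Union>l. geneig n A l)"
    proof (rule Suc.hyps(1)[OF d q0])
      show "shift A l v \<in> carrier_vec n" using A Suc.prems(2) by simp
      fix j assume j: "j < n"
      have "(\<Sum>i\<le>Polynomial.degree q. Polynomial.coeff q i * ((?f ^^ i) (shift A l v) $ j)) =
          (\<Sum>i\<le>Polynomial.degree q. Polynomial.coeff q i * ((?f ^^ Suc i) v $ j - l * ((?f ^^ i) v $ j)))"
        using j carrier_vecD[OF funpow_mult_mat_vec_carrier[OF A v']] unfolding sh
        by (intro sum.cong refl) (simp del: funpow.simps)
      also have "\<dots> = 0"
        using sum_coeff_mult_linear[OF q0, of l "\<lambda>i. (?f ^^ i) v $ j"] Suc.prems(3)[OF j] unfolding q by simp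
      finally show "(\<Sum>i\<le>Polynomial.degree q. Polynomial.coeff q i * ((?f ^^ i) (shift A l v) $ j)) = 0" .
    qed
    then show ?case using eigsum_if_shift[OF A Suc.prems(2)] by blast
  qed
  \<comment> \<open>The n + 1 iterates of v in dimension n are dependent; the coefficients of the
    dependency are those of p.\<close>
  obtain c where c: "\<exists>i<Suc n. c i \<noteq> 0" "\<And>l. l < n \<Longrightarrow> (\<Sum>i<Suc n. c i * ((?f ^^ i) v $ l)) = 0"
    using exists_dependency[of n "Suc n" "\<lambda>i l. (?f ^^ i) v $ l"] by blast
  define p where "p = (\<Sum>i<Suc n. Polynomial.monom (c i) i)"
  have coeff: "Polynomial.coeff p i = (if i < Suc n then c i else 0)" for i
    by (simp add: p_def Polynomial.coeff_sum del: sum.lessThan_Suc)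
  have "p \<noteq> 0" using c(1) coeff by (metis coeff_0)
  moreover have "(\<Sum>i\<le>Polynomial.degree p. Polynomial.coeff p i * a i) = (\<Sum>i<Suc n. c i * a i)" for a
  proof -
    have "Polynomial.degree p \<le> n" by (rule degree_le) (simp add: coeff)
    then have "(\<Sum>i\<le>Polynomial.degree p. Polynomial.coeff p i * a i) = (\<Sum>i\<le>n. Polynomial.coeff p i * a i)"
      by (intro sum.mono_neutral_left) (auto simp: coeff_eq_0)
    also have "\<dots> = (\<Sum>i<Suc n. c i * a i)"
      unfolding lessThan_Suc_atMost by (rule sum.cong) (auto simp: coeff)
    finally show ?thesis .
  qed
  ultimately show ?thesis using *[of p v] v c(2) by presburger
qed

text \<open>The last nonzero iterate of a nonzero generalized eigenvector under A - l is an
  eigenvector, so l is a root of the characteristic polynomial.\<close>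

lemma finite_geneig:
  fixes A :: "'a::field mat"
  assumes A: "A \<in> carrier_mat n n"
  shows "finite {l. \<exists>v\<in>geneig n A l. v \<noteq> 0\<^sub>v n}"
proof (rule finite_subset)
  have ex: "\<exists>u\<in>carrier_vec n. u \<noteq> 0\<^sub>v n \<and> shift A l u = 0\<^sub>v n" if "v \<in> geneig n A l" "v \<noteq> 0\<^sub>v n" for v l
    using that by (induction rule: geneig.induct) auto
  have "eigenvalue A l" if v: "v \<in> geneig n A l" "v \<noteq> 0\<^sub>v n" for v l
  proof -
    obtain u where u: "u \<in> carrier_vec n" "u \<noteq> 0\<^sub>v n" "shift A l u = 0\<^sub>v n"
      using ex[OF v] by blast
    have "A *\<^sub>v u = l \<cdot>\<^sub>v u"
    proof (rule eq_vecI)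
      fix i assume i: "i < dim_vec (l \<cdot>\<^sub>v u)"
      have "shift A l u $ i = 0" using u i by simp
      then show "(A *\<^sub>v u) $ i = (l \<cdot>\<^sub>v u) $ i" using A u(1) i by (simp add: shift_def)
    qed (use A u in simp)
    then show ?thesis using A u unfolding eigenvalue_def eigenvector_def by auto
  qed
  then show "{l. \<exists>v\<in>geneig n A l. v \<noteq> 0\<^sub>v n} \<subseteq> {l. poly (char_poly A) l = 0}"
    using eigenvalue_root_char_poly[OF A] by blast
  have "char_poly A \<noteq> 0" using degree_monic_char_poly[OF A] by auto
  then show "finite {l. poly (char_poly A) l = 0}" by (rule poly_roots_finite)
qed

section \<open>Ad-nilpotent elements of Lie algebras\<close>

lemma linear_expand:
  fixes \<phi> :: "'k::field_char_0 vec \<Rightarrow> 'k"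
  assumes "\<phi> \<in> dual_space (carrier_vec n)" "v \<in> carrier_vec n"
  shows "\<phi> v = (\<Sum>i<n. \<phi> (unit_vec n i) * v $ i)"
proof -
  interpret frame n n "1\<^sub>m n" "1\<^sub>m n :: 'k mat" by unfold_locales auto
  have V: "V = carrier_vec n" unfolding V_def by (auto simp: image_iff)
  show ?thesis using dual_expand[unfolded V, OF assms] assms(2) by simp
qed

locale lie =
  fixes n :: nat and br :: "'k::field_char_0 vec \<Rightarrow> 'k vec \<Rightarrow> 'k vec"
  assumes lie: "lie_algebra n br"
begin

lemma br_closed [simp]: "x \<in> carrier_vec n \<Longrightarrow> y \<in> carrier_vec n \<Longrightarrow> br x y \<in> carrier_vec n"
  using lie unfolding lie_algebra_def by blast

lemma dim_br [simp]: "x \<in> carrier_vec n \<Longrightarrow> y \<in> carrier_vec n \<Longrightarrow> dim_vec (br x y) = n"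
  by (rule carrier_vecD) simp

lemma br_add_left: "x \<in> carrier_vec n \<Longrightarrow> y \<in> carrier_vec n \<Longrightarrow> z \<in> carrier_vec n \<Longrightarrow> br (x + y) z = br x z + br y z"
  and br_add_right: "x \<in> carrier_vec n \<Longrightarrow> y \<in> carrier_vec n \<Longrightarrow> z \<in> carrier_vec n \<Longrightarrow> br x (y + z) = br x y + br x z"
  using lie unfolding lie_algebra_def by blast+

lemma br_smult_left: "x \<in> carrier_vec n \<Longrightarrow> y \<in> carrier_vec n \<Longrightarrow> br (a \<cdot>\<^sub>v x) y = a \<cdot>\<^sub>v br x y"
  and br_smult_right: "x \<in> carrier_vec n \<Longrightarrow> y \<in> carrier_vec n \<Longrightarrow> br x (a \<cdot>\<^sub>v y) = a \<cdot>\<^sub>v br x y"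
  using lie unfolding lie_algebra_def by blast+

lemma br_self: "x \<in> carrier_vec n \<Longrightarrow> br x x = 0\<^sub>v n"
  using lie unfolding lie_algebra_def by blast

lemma jacobi: "x \<in> carrier_vec n \<Longrightarrow> y \<in> carrier_vec n \<Longrightarrow> z \<in> carrier_vec n \<Longrightarrow>
    br x (br y z) + br y (br z x) + br z (br x y) = 0\<^sub>v n"
  using lie unfolding lie_algebra_def by blast

lemma smult_0_vec: "v \<in> carrier_vec n \<Longrightarrow> (0::'k) \<cdot>\<^sub>v v = 0\<^sub>v n"
  by (rule eq_vecI) auto

lemma br_zero_right [simp]: "x \<in> carrier_vec n \<Longrightarrow> br x (0\<^sub>v n) = 0\<^sub>v n"
  using br_smult_right[of x "0\<^sub>v n" 0] by (simp add: smult_0_vec)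

lemma br_zero_left [simp]: "x \<in> carrier_vec n \<Longrightarrow> br (0\<^sub>v n) x = 0\<^sub>v n"
  using br_smult_left[of "0\<^sub>v n" x 0] by (simp add: smult_0_vec)

lemma br_anti:
  assumes "x \<in> carrier_vec n" "y \<in> carrier_vec n"
  shows "br x y = (- 1) \<cdot>\<^sub>v br y x"
proof (rule eq_vecI)
  have "br (x + y) (x + y) = (br x x + br y x) + (br x y + br y y)"
    using assms by (simp add: br_add_left br_add_right)
  then have e: "(br x x + br y x) + (br x y + br y y) = 0\<^sub>v n"
    using assms br_self[of "x + y"] by simp
  fix i assume "i < dim_vec ((- 1) \<cdot>\<^sub>v br y x)"
  then have i: "i < n" using assms br_closed[of y x] by (simp add: carrier_vecD)
  have c: "br x y \<in> carrier_vec n" "br y x \<in> carrier_vec n" using assms by auto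
  have "((br x x + br y x) + (br x y + br y y)) $ i = 0" using e i by simp
  then show "br x y $ i = ((- 1) \<cdot>\<^sub>v br y x) $ i"
    using assms c i by (simp add: br_self carrier_vecD eq_neg_iff_add_eq_0 add.commute)
qed (use assms br_closed in \<open>auto simp: carrier_vecD\<close>)

lemma br_anti_index:
  "x \<in> carrier_vec n \<Longrightarrow> y \<in> carrier_vec n \<Longrightarrow> i < n \<Longrightarrow> br x y $ i = - (br y x $ i)"
  using br_anti[of x y] carrier_vecD[OF br_closed[of y x]] by simp

lemma leibniz:
  assumes c: "x \<in> carrier_vec n" "y \<in> carrier_vec n" "z \<in> carrier_vec n"
  shows "br x (br y z) = br (br x y) z + br y (br x z)"
proof (rule eq_vecI)
  have cc: "br x (br y z) \<in> carrier_vec n" "br y (br x z) \<in> carrier_vec n" "br (br x y) z \<in> carrier_vec n"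
    "br y (br z x) \<in> carrier_vec n" "br z (br x y) \<in> carrier_vec n"
    using c by simp_all
  fix i assume "i < dim_vec (br (br x y) z + br y (br x z))"
  then have i: "i < n" using cc by (simp add: carrier_vecD)
  have "(br x (br y z) + br y (br z x) + br z (br x y)) $ i = 0"
    using jacobi[OF c] i by simp
  then have "br x (br y z) $ i + br y (br z x) $ i + br z (br x y) $ i = 0"
    using i cc by (simp add: carrier_vecD add.assoc)
  moreover have "br y (br z x) $ i = - (br y (br x z) $ i)"
    using br_anti[of z x] c i cc by (simp add: br_smult_right carrier_vecD)
  moreover have "br z (br x y) $ i = - (br (br x y) z $ i)"
    using c i by (intro br_anti_index) auto
  ultimately show "br x (br y z) $ i = (br (br x y) z + br y (br x z)) $ i"
    using i cc by (simp add: carrier_vecD algebra_simps)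
qed (use c in \<open>simp add: carrier_vecD[OF br_closed]\<close>)

lemma br_dual_right: "x \<in> carrier_vec n \<Longrightarrow> i < n \<Longrightarrow> (\<lambda>v. br x v $ i) \<in> dual_space (carrier_vec n)"
  unfolding dual_space_def
  by (auto simp: br_add_right br_smult_right carrier_vecD[OF br_closed])

lemma br_dual_left: "x \<in> carrier_vec n \<Longrightarrow> i < n \<Longrightarrow> (\<lambda>v. br v x $ i) \<in> dual_space (carrier_vec n)"
  unfolding dual_space_def
  by (auto simp: br_add_left br_smult_left carrier_vecD[OF br_closed])

lemma br_expand_right:
  "x \<in> carrier_vec n \<Longrightarrow> v \<in> carrier_vec n \<Longrightarrow> i < n \<Longrightarrow> br x v $ i = (\<Sum>l<n. br x (unit_vec n l) $ i * v $ l)"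
  by (rule linear_expand[OF br_dual_right])

lemma br_expand:
  assumes "x \<in> carrier_vec n" "y \<in> carrier_vec n" "i < n"
  shows "br x y $ i = (\<Sum>j<n. \<Sum>l<n. x $ j * y $ l * br (unit_vec n j) (unit_vec n l) $ i)"
proof -
  have "br x y $ i = (\<Sum>j<n. br (unit_vec n j) y $ i * x $ j)"
    by (rule linear_expand[OF br_dual_left]) (use assms in auto)
  also have "\<dots> = (\<Sum>j<n. (\<Sum>l<n. br (unit_vec n j) (unit_vec n l) $ i * y $ l) * x $ j)"
    using assms by (intro sum.cong) (simp_all add: br_expand_right)
  finally show ?thesis by (simp add: sum_distrib_left sum_distrib_right mult_ac)
qed

abbreviation ad :: "'k vec \<Rightarrow> 'k mat" where "ad \<equiv> ad_mat n br"
abbreviation coad :: "'k vec \<Rightarrow> 'k salg \<Rightarrow> 'k salg" where "coad \<equiv> coad_action C2 n br"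

lemma ad_mat_mult_vec:
  assumes "x \<in> carrier_vec n" "v \<in> carrier_vec n"
  shows "ad x *\<^sub>v v = br x v"
proof (rule eq_vecI)
  have d: "dim_vec (br x v) = n" using assms by (simp add: carrier_vecD[OF br_closed])
  fix i assume "i < dim_vec (br x v)"
  then have i: "i < n" using d by simp
  then show "(ad x *\<^sub>v v) $ i = br x v $ i"
    using br_expand_right[OF assms i] assms
    by (simp add: ad_mat_def scalar_prod_def lessThan_atLeast0)
qed (use assms in \<open>simp add: carrier_vecD[OF br_closed] ad_mat_def\<close>)

lemma ad_funpow:
  assumes "x \<in> carrier_vec n" "v \<in> carrier_vec n"
  shows "((\<lambda>v. ad x *\<^sub>v v) ^^ r) v = (br x ^^ r) v \<and> (br x ^^ r) v \<in> carrier_vec n"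
  by (induction r) (use assms in \<open>simp_all add: ad_mat_mult_vec\<close>)

text \<open>By \<open>leibniz\<close>, (ad x - l - m) [u, v] = [(ad x - l) u, v] +
  [u, (ad x - m) v]. Nested induction on the two orders of nilpotency covers both summands.\<close>

lemma geneig_br:
  assumes x: "x \<in> carrier_vec n"
  shows "u \<in> geneig n (ad x) l \<Longrightarrow> v \<in> geneig n (ad x) m \<Longrightarrow>
     br u v \<in> geneig n (ad x) (l + m)"
proof (induction arbitrary: v rule: geneig.induct)
  case zero
  then show ?case using geneig_carrier[OF zero] geneig.zero by simp
next
  case (step u)
  have "v \<in> geneig n (ad x) m" by fact
  then show ?case
  proof (induction rule: geneig.induct)
    case zero
    then show ?case using step.hyps(1) geneig.zero by simp
  next
    case v: (step v)
    have c: "u \<in> carrier_vec n" "v \<in> carrier_vec n" using step.hyps(1) v.hyps(1) by auto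
    have sh: "shift (ad x) k w = br x w + (- k) \<cdot>\<^sub>v w" if "w \<in> carrier_vec n" for k w
      using that x by (intro eq_vecI) (auto simp: shift_def ad_mat_mult_vec carrier_vecD[OF br_closed])
    have "shift (ad x) (l + m) (br u v) =
        br (shift (ad x) l u) v + br u (shift (ad x) m v)"
      using c x unfolding sh[OF c(1)] sh[OF c(2)] sh[OF br_closed[OF c]] leibniz[OF x c]
      by (intro eq_vecI)
         (auto simp: br_add_left br_add_right br_smult_left br_smult_right carrier_vecD[OF br_closed] algebra_simps)
    also have "\<dots> \<in> geneig n (ad x) (l + m)"
      using step.IH[OF geneig.step[OF v.hyps]] v.IH by (intro geneig_add[OF ad_mat_carrier])
    finally show ?case using c by (intro geneig.step[of "br u v"]) auto
  qed
qed

end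

locale lie_ac = lie n br for n :: nat and br :: "'k::{alg_closed_field, field_char_0} vec \<Rightarrow> 'k vec \<Rightarrow> 'k vec"
begin

text \<open>Each application of \<open>ad u\<close> adds l to the generalized eigenvalue of
  \<open>ad x\<close>. In characteristic 0 the values m + r l are all distinct, and only finitely
  many have nonzero generalized eigenvectors.\<close>

lemma ad_nilpotent_if_geneig:
  assumes x: "x \<in> carrier_vec n" and u: "u \<in> geneig n (ad x) l" and l: "l \<noteq> 0"
  shows "\<exists>r. ad u ^\<^sub>m r = 0\<^sub>m n n"
proof (rule nilpotentI[OF ad_mat_carrier])
  let ?A = "ad x"
  have uc: "u \<in> carrier_vec n" by (rule geneig_carrier[OF u])
  have pow: "(br u ^^ r) v \<in> geneig n ?A (m + of_nat r * l)" if "v \<in> geneig n ?A m" for v m r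
  proof (induction r)
    case (Suc r)
    have "br u ((br u ^^ r) v) \<in> geneig n ?A (l + (m + of_nat r * l))" by (rule geneig_br[OF x u Suc])
    then show ?case by (simp add: algebra_simps)
  qed (use that in simp)
  have nil: "\<exists>r. (br u ^^ r) v = 0\<^sub>v n" if v: "v \<in> geneig n ?A m" for v m
  proof -
    have "inj (\<lambda>r. m + of_nat r * l)" using l by (auto simp: inj_on_def)
    then have "infinite (range (\<lambda>r::nat. m + of_nat r * l))" by (rule range_inj_infinite)
    then have "\<not> range (\<lambda>r::nat. m + of_nat r * l) \<subseteq> {l. \<exists>v\<in>geneig n ?A l. v \<noteq> 0\<^sub>v n}"
      using finite_subset[OF _ finite_geneig[OF ad_mat_carrier]] by blast
    then obtain r :: nat where "m + of_nat r * l \<notin> {l. \<exists>v\<in>geneig n ?A l. v \<noteq> 0\<^sub>v n}" by blast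
    then show ?thesis using pow[OF v, of r] by blast
  qed
  have nil_sum: "\<exists>r. (br u ^^ r) v = 0\<^sub>v n" if "v \<in> vsum n (\<Union>m. geneig n ?A m)" for v
    using that
  proof induction
    case zero
    show ?case by (rule exI[of _ 0]) simp
  next
    case (add w v)
    then obtain r s where rs: "(br u ^^ r) w = 0\<^sub>v n" "(br u ^^ s) v = 0\<^sub>v n" using nil by blast
    have c: "w \<in> carrier_vec n" "v \<in> carrier_vec n"
      using add.hyps geneig_carrier vsum_carrier[OF geneig_Un_carrier] by blast+
    have b0: "br u (0\<^sub>v n) = 0\<^sub>v n" using uc by simp
    have "(br u ^^ k) (w + v) = (br u ^^ k) w + (br u ^^ k) v" for k
      by (induction k) (use c uc ad_funpow[OF uc] in \<open>simp_all add: br_add_right\<close>)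
    then have "(br u ^^ (r + s)) (w + v) = 0\<^sub>v n"
      using funpow_eq_0_mono[OF rs(1) b0, of "r + s"] funpow_eq_0_mono[OF rs(2) b0, of "r + s"] by simp
    then show ?case by blast
  qed
  fix j assume "j < n"
  then show "\<exists>r. ((\<lambda>v. ad u *\<^sub>v v) ^^ r) (unit_vec n j) = 0\<^sub>v n"
    using nil_sum[OF eigsum_eq_carrier[OF ad_mat_carrier, of "unit_vec n j" n]] ad_funpow[OF uc, of "unit_vec n j"]
    by simp
qed

text \<open>The span of these elements is the ideal generated by the generalized eigenspaces of \<open>ad x\<close> for
  nonzero eigenvalues. All elements of these eigenspaces are ad-nilpotent.\<close>

definition nonzero_gens :: "'k vec \<Rightarrow> 'k vec set" where
  "nonzero_gens x = {u. \<exists>l. l \<noteq> 0 \<and> u \<in> geneig n (ad x) l} \<union>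
     {br u v | u v l. l \<noteq> 0 \<and> u \<in> geneig n (ad x) l \<and> v \<in> geneig n (ad x) (- l)}"

lemma nonzero_gens_carrier: "nonzero_gens x \<subseteq> carrier_vec n"
  unfolding nonzero_gens_def using geneig_carrier by (fastforce intro!: br_closed)

text \<open>If l + m = 0, then both eigenvalues are nonzero and the bracket is a generator of the
  second kind; otherwise it is one of the first kind.\<close>

lemma br_geneig_nonzero_gens:
  assumes x: "x \<in> carrier_vec n" and uv: "u \<in> geneig n (ad x) l" "v \<in> geneig n (ad x) m"
    and nz: "l \<noteq> 0 \<or> m \<noteq> 0"
  shows "br u v \<in> nonzero_gens x"
proof (cases "l + m = 0")
  case True
  then have "m = - l" "l \<noteq> 0" using nz by (auto simp: add_eq_0_iff)
  then show ?thesis using uv unfolding nonzero_gens_def by blast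
next
  case False
  then show ?thesis using geneig_br[OF x uv] unfolding nonzero_gens_def by blast
qed

text \<open>The acting element is split into generalized eigenvectors. A bracket [u, v] of opposite
  nonzero eigenvalues is treated by \<open>leibniz\<close>, where each summand still has a factor
  from a nonzero eigenvalue.\<close>

lemma nonzero_gens_ideal:
  assumes x: "x \<in> carrier_vec n" and z: "z \<in> carrier_vec n" and v: "v \<in> vsum n (nonzero_gens x)"
  shows "br z v \<in> vsum n (nonzero_gens x)"
proof -
  note I_add = vsum_add[OF nonzero_gens_carrier] and I_base = vsum_base[OF nonzero_gens_carrier]
  have 1: "br w g \<in> vsum n (nonzero_gens x)" if w: "w \<in> geneig n (ad x) m" and "g \<in> nonzero_gens x" for w m g
  proof -
    have wc: "w \<in> carrier_vec n" by (rule geneig_carrier[OF w])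
    consider l where "l \<noteq> 0" "g \<in> geneig n (ad x) l"
      | u v l where "g = br u v" "l \<noteq> 0" "u \<in> geneig n (ad x) l" "v \<in> geneig n (ad x) (- l)"
      using \<open>g \<in> nonzero_gens x\<close> unfolding nonzero_gens_def by blast
    then show ?thesis
    proof cases
      case 1
      then show ?thesis using I_base br_geneig_nonzero_gens[OF x w] by blast
    next
      case 2
      have c: "u \<in> carrier_vec n" "v \<in> carrier_vec n" using 2 geneig_carrier by blast+
      have "br (br w u) v \<in> nonzero_gens x"
        by (rule br_geneig_nonzero_gens[OF x geneig_br[OF x w 2(3)] 2(4)]) (use 2 in simp)
      moreover have "br u (br w v) \<in> nonzero_gens x"
        by (rule br_geneig_nonzero_gens[OF x 2(3) geneig_br[OF x w 2(4)]]) (use 2 in simp)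
      ultimately show ?thesis
        unfolding 2(1) leibniz[OF wc c] using I_base by (intro I_add) auto
    qed
  qed
  have 2: "br z g \<in> vsum n (nonzero_gens x)" if g: "g \<in> nonzero_gens x" for g
  proof -
    have gc: "g \<in> carrier_vec n" using g nonzero_gens_carrier by blast
    have "br z g \<in> vsum n (nonzero_gens x)" if "z \<in> vsum n (\<Union>m. geneig n (ad x) m)" for z
      using that
    proof induction
      case zero
      show ?case using gc vsum.zero by simp
    next
      case (add w z)
      then obtain m where w: "w \<in> geneig n (ad x) m" by blast
      have "w \<in> carrier_vec n" "z \<in> carrier_vec n"
        using geneig_carrier[OF w] vsum_carrier[OF geneig_Un_carrier add.hyps(2)] by auto
      then show ?case using I_add[OF 1[OF w g] add.IH] gc by (simp add: br_add_left)
    qed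
    then show ?thesis using eigsum_eq_carrier[OF ad_mat_carrier z] by blast
  qed
  show ?thesis
    using v
  proof induction
    case zero
    show ?case using z vsum.zero by simp
  next
    case (add g v)
    have "g \<in> carrier_vec n" "v \<in> carrier_vec n"
      using add.hyps nonzero_gens_carrier vsum_carrier[OF nonzero_gens_carrier] by blast+
    then show ?case using I_add[OF 2[OF add.hyps(1)] add.IH] z by (simp add: br_add_right)
  qed
qed

text \<open>At most the component of z for eigenvalue 0 lies outside the ideal, and a power of
  \<open>ad x\<close> kills it; the other components stay in their eigenspaces.\<close>

lemma ad_pow_in_nonzero_gens:
  assumes x: "x \<in> carrier_vec n" and z: "z \<in> carrier_vec n"
  shows "\<exists>r. \<forall>s\<ge>r. (br x ^^ s) z \<in> vsum n (nonzero_gens x)"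
proof -
  let ?A = "ad x"
  note I_add = vsum_add[OF nonzero_gens_carrier] and I_base = vsum_base[OF nonzero_gens_carrier]
  have "\<exists>r. \<forall>s\<ge>r. (br x ^^ s) z \<in> vsum n (nonzero_gens x)" if "z \<in> vsum n (\<Union>m. geneig n ?A m)" for z
    using that
  proof induction
    case zero
    have "(br x ^^ s) (0\<^sub>v n) = 0\<^sub>v n" for s by (induction s) (use x in simp_all)
    then show ?case by (intro exI[of _ 0]) (simp add: vsum.zero)
  next
    case (add w z)
    then obtain m r where m: "w \<in> geneig n ?A m" and r: "\<forall>s\<ge>r. (br x ^^ s) z \<in> vsum n (nonzero_gens x)" by blast
    have c: "w \<in> carrier_vec n" "z \<in> carrier_vec n"
      using add.hyps geneig_carrier vsum_carrier[OF geneig_Un_carrier] by blast+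
    have "\<exists>r. \<forall>s\<ge>r. (br x ^^ s) w \<in> vsum n (nonzero_gens x)"
    proof (cases "m = 0")
      case True
      then obtain r where "((\<lambda>v. ?A *\<^sub>v v) ^^ r) w = 0\<^sub>v n"
        using geneig_0_nilpotent[OF ad_mat_carrier] m by blast
      then have "(br x ^^ r) w = 0\<^sub>v n" using ad_funpow[OF x c(1)] by simp
      then have "(br x ^^ s) w = 0\<^sub>v n" if "s \<ge> r" for s
        by (rule funpow_eq_0_mono) (use x that in auto)
      then show ?thesis using vsum.zero by metis
    next
      case False
      have "(br x ^^ s) w \<in> nonzero_gens x" for s
        using geneig_funpow[OF ad_mat_carrier m] ad_funpow[OF x c(1)] False unfolding nonzero_gens_def by auto
      then show ?thesis using I_base by blast
    qed
    then obtain r' where r': "\<forall>s\<ge>r'. (br x ^^ s) w \<in> vsum n (nonzero_gens x)" by blast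
    have sp: "(br x ^^ s) (w + z) = (br x ^^ s) w + (br x ^^ s) z" for s
      by (induction s) (use c x ad_funpow[OF x] in \<open>simp_all add: br_add_right\<close>)
    show ?case
      by (rule exI[of _ "r + r'"]) (use r r' in \<open>auto simp: sp intro!: I_add\<close>)
  qed
  then show ?thesis using eigsum_eq_carrier[OF ad_mat_carrier z] by blast
qed

text \<open>S stands for an annihilator. The generators of the first kind are ad-nilpotent, those of
  the second kind are brackets of two such elements.\<close>

lemma nonzero_gens_subset:
  assumes x: "x \<in> carrier_vec n"
    and zero: "0\<^sub>v n \<in> S" and add: "\<And>u v. u \<in> S \<Longrightarrow> v \<in> S \<Longrightarrow> u + v \<in> S"
    and br: "\<And>u v. u \<in> S \<Longrightarrow> v \<in> S \<Longrightarrow> br u v \<in> S"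
    and nil: "\<And>u r. u \<in> carrier_vec n \<Longrightarrow> ad u ^\<^sub>m r = 0\<^sub>m n n \<Longrightarrow> u \<in> S"
  shows "vsum n (nonzero_gens x) \<subseteq> S"
proof -
  have g: "u \<in> S" if "u \<in> geneig n (ad x) l" "l \<noteq> 0" for u l
    using ad_nilpotent_if_geneig[OF x that] nil[OF geneig_carrier[OF that(1)]] by blast
  have "nonzero_gens x \<subseteq> S"
    unfolding nonzero_gens_def using g br by (auto simp: neg_eq_iff_add_eq_0)
  note sub = this
  have "v \<in> S" if "v \<in> vsum n (nonzero_gens x)" for v
    using that by induction (use zero add sub in auto)
  then show ?thesis by blast
qed

end

section \<open>Infinitesimal and group invariants\<close>

context lie
begin

text \<open>Linearity in x, stated as membership in \<open>dual_space\<close> so that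
  \<open>linear_expand\<close> and closure under sums and scalars apply.\<close>

lemma coad_dual:
  fixes f :: "'k salg"
  assumes f: "f \<in> salg n"
  shows "(\<lambda>x. pev a b zs (coad x f)) \<in> dual_space (carrier_vec n)"
proof -
  define D where "D x i j = - (br x (unit_vec n j) $ i)" for x and i j :: nat
  have eq: "pev a b zs (coad x f) = lin (\<lambda>c. c) (mat_der n (D x) (ev a b zs)) f" for x
    unfolding pev_def coeff_hom.lin_coad_action[OF coeff_hom_id supersym_ev] by (simp add: D_def[abs_def])
  have add: "mat_der n (D (x + y)) (ev a b zs) w =
      mat_der n (D x) (ev a b zs) w + mat_der n (D y) (ev a b zs) w"
    if "x \<in> carrier_vec n" "y \<in> carrier_vec n" "w \<in> keys f" for x y w
    unfolding mat_der_add[symmetric]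
    by (rule mat_der_cong[OF _ fst_letters_of_salg[OF f that(3)]])
       (use that in \<open>simp add: D_def br_add_left\<close>)
  have smult: "mat_der n (D (c \<cdot>\<^sub>v x)) (ev a b zs) w = c * mat_der n (D x) (ev a b zs) w"
    if "x \<in> carrier_vec n" "w \<in> keys f" for x c w
    unfolding mat_der_mult[symmetric]
    by (rule mat_der_cong[OF _ fst_letters_of_salg[OF f that(2)]])
       (use that in \<open>simp add: D_def br_smult_left\<close>)
  show ?thesis
    unfolding dual_space_def eq
    by (auto simp: add smult simp flip: lin_fun_add lin_fun_mult intro!: lin_cong)
qed

lemma coad_eq_0_iff:
  assumes f: "f \<in> salg n"
  shows "coad x f = 0 \<longleftrightarrow> (\<forall>a b zs. pev a b zs (coad x f) = 0)"
  using salg_eq_0I[OF salg_coad_action[OF f]] by auto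

text \<open>The commutator of the two matrix derivations is, up to sign, the derivation of the
  bracket, and either order of composition applies one of the two actions to f directly, where it
  vanishes.\<close>

lemma coad_br:
  assumes f: "f \<in> salg n" and x: "x \<in> carrier_vec n" "coad x f = 0"
    and y: "y \<in> carrier_vec n" "coad y f = 0"
  shows "coad (br x y) f = 0"
  unfolding coad_eq_0_iff[OF f, of "br x y"]
proof (intro allI)
  fix a b :: "'k vec" and zs :: "'k vec list"
  define D where "D x i j = - (br x (unit_vec n j) $ i)" for x and i j :: nat
  define \<phi> where "\<phi> = ev a b zs"
  have ss: "supersym \<phi>" unfolding \<phi>_def by (rule supersym_ev)
  have lin: "lin (\<lambda>c. c) \<psi> (coad x f) = lin (\<lambda>c. c) (mat_der n (D x) \<psi>) f"
    if "supersym \<psi>" for \<psi> x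
    unfolding coeff_hom.lin_coad_action[OF coeff_hom_id that] by (simp add: D_def[abs_def])
  \<comment> \<open>\<open>D x\<close> is minus the matrix of \<open>ad x\<close>: the two signs in
    each product cancel, and the one on the left-hand side remains.\<close>
  have comm: "D (br x y) i j = - 1 * ((\<Sum>l<n. D x i l * D y l j) - (\<Sum>l<n. D y i l * D x l j))"
    if ij: "i < n" "j < n" for i j
  proof -
    have "(\<Sum>l<n. br u (unit_vec n l) $ i * br v (unit_vec n j) $ l) = br u (br v (unit_vec n j)) $ i"
      if "u \<in> carrier_vec n" "v \<in> carrier_vec n" for u v
      using br_expand_right[of u "br v (unit_vec n j)" i] that ij by simp
    moreover have "br x (br y (unit_vec n j)) $ i = br (br x y) (unit_vec n j) $ i + br y (br x (unit_vec n j)) $ i"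
      using leibniz[OF x(1) y(1), of "unit_vec n j"] x(1) y(1) ij by simp
    ultimately show ?thesis using x(1) y(1) by (simp add: D_def)
  qed
  have "mat_der n (D (br x y)) \<phi> w =
      - 1 * (mat_der n (D x) (mat_der n (D y) \<phi>) w + - 1 * mat_der n (D y) (mat_der n (D x) \<phi>) w)"
    if "w \<in> keys f" for w
  proof -
    have w: "fst ` set w \<subseteq> {..<n}" by (rule fst_letters_of_salg[OF f that])
    have "mat_der n (D (br x y)) \<phi> w = mat_der n (\<lambda>i j. - 1 * ((\<Sum>l<n. D x i l * D y l j) - (\<Sum>l<n. D y i l * D x l j))) \<phi> w"
      by (rule mat_der_cong[OF comm w])
    also have "\<dots> = - 1 * (mat_der n (D x) (mat_der n (D y) \<phi>) w - mat_der n (D y) (mat_der n (D x) \<phi>) w)"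
      unfolding mat_der_mult mat_der_commutator[OF w] ..
    finally show ?thesis by simp
  qed
  then have "pev a b zs (coad (br x y) f) = lin (\<lambda>c. c) (\<lambda>w. - 1 *
      (mat_der n (D x) (mat_der n (D y) \<phi>) w + - 1 * mat_der n (D y) (mat_der n (D x) \<phi>) w)) f"
    unfolding pev_def lin[OF ss, unfolded \<phi>_def, folded \<phi>_def] \<phi>_def[symmetric] lin[OF ss] by (intro lin_cong)
  also have "\<dots> = 0"
    unfolding lin_fun_mult lin_fun_add lin[OF supersym_mat_der[OF ss], symmetric] x(2) y(2)
    by (simp add: id_lin)
  finally show "pev a b zs (coad (br x y) f) = 0" .
qed

lemma coad_eq_0_if_units:
  assumes f: "f \<in> salg n" and "\<And>i. i < n \<Longrightarrow> coad (unit_vec n i) f = 0"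
    and x: "x \<in> carrier_vec n"
  shows "coad x f = 0"
  unfolding coad_eq_0_iff[OF f]
  using linear_expand[OF coad_dual[OF f] x] assms(2) by simp

lemma coad_0: "f \<in> salg n \<Longrightarrow> coad (0\<^sub>v n) f = 0"
  and coad_add: "f \<in> salg n \<Longrightarrow> x \<in> carrier_vec n \<Longrightarrow> y \<in> carrier_vec n \<Longrightarrow>
    coad x f = 0 \<Longrightarrow> coad y f = 0 \<Longrightarrow> coad (x + y) f = 0"
  and coad_smult: "f \<in> salg n \<Longrightarrow> x \<in> carrier_vec n \<Longrightarrow>
    coad x f = 0 \<Longrightarrow> coad (c \<cdot>\<^sub>v x) f = 0"
proof -
  show add: "coad (x + y) f = 0" if "f \<in> salg n" "x \<in> carrier_vec n" "y \<in> carrier_vec n"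
    "coad x f = 0" "coad y f = 0"
    unfolding coad_eq_0_iff[OF that(1)] using coad_dual[OF that(1)] that by (simp add: dual_space_def)
  show smult: "coad (c \<cdot>\<^sub>v x) f = 0"
    if "f \<in> salg n" "x \<in> carrier_vec n" "coad x f = 0" for c x
    unfolding coad_eq_0_iff[OF that(1)] using coad_dual[OF that(1)] that by (simp add: dual_space_def)
  show "coad (0\<^sub>v n) f = 0" if "f \<in> salg n"
    unfolding coad_eq_0_iff[OF that]
  proof (intro allI)
    fix a b :: "'k vec" and zs :: "'k vec list"
    have "\<forall>c. \<forall>u\<in>carrier_vec n. pev a b zs (coad (c \<cdot>\<^sub>v u) f) = c * pev a b zs (coad u f)"
      using coad_dual[OF that, of a b zs] unfolding dual_space_def by simp
    then have "pev a b zs (coad (0 \<cdot>\<^sub>v 0\<^sub>v n) f) = 0 * pev a b zs (coad (0\<^sub>v n) f)"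
      by (metis zero_carrier_vec)
    then show "pev a b zs (coad (0\<^sub>v n) f) = 0" by (simp add: smult_0_vec)
  qed
qed

section \<open>Inner automorphisms as products of exponentials\<close>

lemma ad_mat_smult: "x \<in> carrier_vec n \<Longrightarrow> ad (t \<cdot>\<^sub>v x) = t \<cdot>\<^sub>m ad x"
  by (rule eq_matI) (auto simp: ad_mat_def br_smult_left)

lemma inner_auts_carrier: "\<gamma> \<in> inner_auts n br \<Longrightarrow> \<gamma> \<in> carrier_mat n n"
  by (induction rule: inner_auts.induct) (auto intro: mult_carrier_mat[OF exp_nilpotent_carrier])

text \<open>If x is ad-nilpotent, so is t x, hence the whole one-parameter group lies in
  \<open>inner_auts\<close> and can be differentiated. Conversely, invariance passes through
  products of exponentials by induction.\<close>

lemma inner_auts_invariant_iff: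
  assumes f: "f \<in> salg n"
  shows "(\<forall>\<gamma>\<in>inner_auts n br. \<forall>a\<in>carrier_vec n. \<forall>b\<in>carrier_vec n. \<forall>zs. set zs \<subseteq> carrier_vec n \<longrightarrow>
      pev (\<gamma> *\<^sub>v a) (\<gamma> *\<^sub>v b) (mult_vecs \<gamma> zs) f = pev a b zs f) \<longleftrightarrow>
    (\<forall>x\<in>carrier_vec n. (\<exists>r. ad x ^\<^sub>m r = 0\<^sub>m n n) \<longrightarrow> coad x f = 0)"
  (is "?L \<longleftrightarrow> ?R")
proof
  assume L: ?L
  show ?R
  proof (intro ballI impI)
    fix x assume x: "x \<in> carrier_vec n" and nil: "\<exists>r. ad x ^\<^sub>m r = 0\<^sub>m n n"
    show "coad x f = 0"
    proof (rule coad_0_if_exp_invariant[OF f nil])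
      fix t :: 'k and a b :: "'k vec" and zs :: "'k vec list"
      assume c: "a \<in> carrier_vec n" "b \<in> carrier_vec n" "set zs \<subseteq> carrier_vec n"
      obtain r where "ad x ^\<^sub>m r = 0\<^sub>m n n" using nil by blast
      then have "ad (t \<cdot>\<^sub>v x) ^\<^sub>m r = 0\<^sub>m n n"
        unfolding ad_mat_smult[OF x] smult_pow_mat[OF ad_mat_carrier] by (auto intro!: eq_matI)
      then have "exp_nilpotent n (ad (t \<cdot>\<^sub>v x)) * 1\<^sub>m n \<in> inner_auts n br"
        using x by (intro inner_auts.exp inner_auts.one) auto
      then have "exp_nilpotent n (t \<cdot>\<^sub>m ad x) \<in> inner_auts n br"
        unfolding ad_mat_smult[OF x] right_mult_one_mat[OF exp_nilpotent_carrier] .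
      then show "pev (exp_nilpotent n (t \<cdot>\<^sub>m ad x) *\<^sub>v a) (exp_nilpotent n (t \<cdot>\<^sub>m ad x) *\<^sub>v b)
         (mult_vecs (exp_nilpotent n (t \<cdot>\<^sub>m ad x)) zs) f = pev a b zs f"
        using L c by blast
    qed
  qed
next
  assume R: ?R
  show ?L
  proof
    fix \<gamma> assume "\<gamma> \<in> inner_auts n br"
    then show "\<forall>a\<in>carrier_vec n. \<forall>b\<in>carrier_vec n. \<forall>zs. set zs \<subseteq> carrier_vec n \<longrightarrow>
      pev (\<gamma> *\<^sub>v a) (\<gamma> *\<^sub>v b) (mult_vecs \<gamma> zs) f = pev a b zs f"
    proof induction
      case one
      have "mult_vecs (1\<^sub>m n) zs = zs" if "set zs \<subseteq> carrier_vec n" for zs :: "'k vec list"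
        using that by (intro map_idI) auto
      then show ?case by simp
    next
      case (exp \<gamma> x)
      let ?E = "exp_nilpotent n (ad x)"
      have \<gamma>: "\<gamma> \<in> carrier_mat n n" by (rule inner_auts_carrier[OF exp.hyps(1)])
      have coad: "coad x f = 0" using R exp.hyps by blast
      show ?case
      proof (intro ballI allI impI)
        fix a b :: "'k vec" and zs :: "'k vec list"
        assume c: "a \<in> carrier_vec n" "b \<in> carrier_vec n" "set zs \<subseteq> carrier_vec n"
        have m: "(?E * \<gamma>) *\<^sub>v v = ?E *\<^sub>v (\<gamma> *\<^sub>v v)" if "v \<in> carrier_vec n" for v
          using \<gamma> that by (intro assoc_mult_mat_vec[of _ n n _ n]) auto
        have mz: "mult_vecs (?E * \<gamma>) zs = mult_vecs ?E (mult_vecs \<gamma> zs)"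
          using c(3) m by auto
        have "pev (?E *\<^sub>v (\<gamma> *\<^sub>v a)) (?E *\<^sub>v (\<gamma> *\<^sub>v b)) (mult_vecs ?E (mult_vecs \<gamma> zs)) f =
            pev (\<gamma> *\<^sub>v a) (\<gamma> *\<^sub>v b) (mult_vecs \<gamma> zs) f"
          by (rule exp_invariant_if_coad_0[OF f exp.hyps(3) coad]) (use c \<gamma> in auto)
        then show "pev (?E * \<gamma> *\<^sub>v a) (?E * \<gamma> *\<^sub>v b) (mult_vecs (?E * \<gamma>) zs) f = pev a b zs f"
          unfolding mz m[OF c(1)] m[OF c(2)] using exp.IH c by simp
      qed
    qed
  qed
qed

end

section \<open>Base change to the algebraic closure\<close>

abbreviation vec_ac :: "'k::field vec \<Rightarrow> 'k alg_closure vec" where "vec_ac \<equiv> map_vec to_ac"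
abbreviation salg_ac :: "'k::field salg \<Rightarrow> 'k alg_closure salg" where "salg_ac \<equiv> Poly_Mapping.map to_ac"

lemma coeff_hom_to_ac: "coeff_hom (to_ac :: 'k::field_char_0 \<Rightarrow> _)"
  by unfold_locales simp_all

lemma lookup_salg_ac [simp]: "lookup (salg_ac f) w = to_ac (lookup f w)"
  by (simp add: Poly_Mapping.map.rep_eq when_def)

lemma keys_salg_ac [simp]: "keys (salg_ac f) = keys f"
  by (auto simp: in_keys_iff)

lemma salg_ac_in_salg: "f \<in> salg n \<Longrightarrow> salg_ac f \<in> salg n"
  by (simp add: salg_def)

lemma salg_ac_in_sym_alg: "f \<in> sym_alg C2 n p \<Longrightarrow> salg_ac f \<in> sym_alg C2 n p"
  by (simp add: sym_alg_C2)

lemma vec_ac_unit [simp]: "vec_ac (unit_vec n i) = unit_vec n i"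
  by (rule eq_vecI) (auto simp: unit_vec_def)

lemma vec_ac_zero [simp]: "vec_ac (0\<^sub>v n) = 0\<^sub>v n"
  by (rule eq_vecI) auto

context lie
begin

section \<open>Scalar extension of the Lie algebra\<close>

abbreviation "brK \<equiv> bracket_ac n br"

lemma brK_vec_ac:
  assumes "x \<in> carrier_vec n" "y \<in> carrier_vec n"
  shows "brK (vec_ac x) (vec_ac y) = vec_ac (br x y)"
  by (rule eq_vecI) (use assms in \<open>auto simp: bracket_ac_def br_expand to_ac_sum\<close>)

lemma brK_add_left: "x \<in> carrier_vec n \<Longrightarrow> y \<in> carrier_vec n \<Longrightarrow> brK (x + y) z = brK x z + brK y z"
  by (rule eq_vecI) (auto simp: bracket_ac_def algebra_simps sum.distrib)

lemma brK_add_right: "y \<in> carrier_vec n \<Longrightarrow> z \<in> carrier_vec n \<Longrightarrow> brK x (y + z) = brK x y + brK x z"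
  by (rule eq_vecI) (auto simp: bracket_ac_def algebra_simps sum.distrib)

lemma brK_smult_left: "x \<in> carrier_vec n \<Longrightarrow> brK (a \<cdot>\<^sub>v x) z = a \<cdot>\<^sub>v brK x z"
  by (rule eq_vecI) (auto simp: bracket_ac_def sum_distrib_left mult_ac)

lemma brK_smult_right: "z \<in> carrier_vec n \<Longrightarrow> brK x (a \<cdot>\<^sub>v z) = a \<cdot>\<^sub>v brK x z"
  by (rule eq_vecI) (auto simp: bracket_ac_def sum_distrib_left mult_ac)

lemma brK_carrier [simp]: "brK x y \<in> carrier_vec n"
  by (simp add: bracket_ac_def)

lemma brK_dim [simp]: "dim_vec (brK x y) = n"
  by (simp add: bracket_ac_def)

text \<open>The device for lifting multilinear identities: on unit vectors the extended bracket is
  the image of the original one, and the arguments are then freed one at a time.\<close>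

lemma linear_zero:
  fixes T :: "'k alg_closure vec \<Rightarrow> 'k alg_closure vec"
  assumes add: "\<And>u v. u \<in> carrier_vec n \<Longrightarrow> v \<in> carrier_vec n \<Longrightarrow> T (u + v) = T u + T v"
    and smult: "\<And>c u. u \<in> carrier_vec n \<Longrightarrow> T (c \<cdot>\<^sub>v u) = c \<cdot>\<^sub>v T u"
    and car: "\<And>u. u \<in> carrier_vec n \<Longrightarrow> T u \<in> carrier_vec n"
    and z: "\<And>i. i < n \<Longrightarrow> T (unit_vec n i) = 0\<^sub>v n" and v: "v \<in> carrier_vec n"
  shows "T v = 0\<^sub>v n"
proof (rule eq_vecI)
  fix l assume "l < dim_vec (0\<^sub>v n :: 'k alg_closure vec)"
  then have l: "l < n" by simp
  have "(\<lambda>v. T v $ l) \<in> dual_space (carrier_vec n)"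
    unfolding dual_space_def using l carrier_vecD[OF car] by (auto simp: add smult)
  from linear_expand[OF this v] show "T v $ l = 0\<^sub>v n $ l" using z l by simp
qed (use car[OF v] in auto)

lemma lie_brK: "lie_algebra n brK"
proof -
  have anti: "brK x y + brK y x = 0\<^sub>v n" if x: "x \<in> carrier_vec n" and y: "y \<in> carrier_vec n" for x y
  proof -
    have u: "brK (unit_vec n i) (unit_vec n j) + brK (unit_vec n j) (unit_vec n i) = 0\<^sub>v n" if "i < n" "j < n" for i j
    proof -
      have "br (unit_vec n i) (unit_vec n j) = (- 1) \<cdot>\<^sub>v br (unit_vec n j) (unit_vec n i)"
        by (rule br_anti) auto
      then show ?thesis
        using brK_vec_ac[of "unit_vec n i" "unit_vec n j"] brK_vec_ac[of "unit_vec n j" "unit_vec n i"]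
        by (intro eq_vecI) auto
    qed
    have 1: "brK x (unit_vec n j) + brK (unit_vec n j) x = 0\<^sub>v n" if "x \<in> carrier_vec n" "j < n" for x j
      by (rule linear_zero[OF _ _ _ _ that(1)])
         (use u that in \<open>auto simp: brK_add_left brK_add_right brK_smult_left brK_smult_right algebra_simps intro!: eq_vecI\<close>)
    show ?thesis
      by (rule linear_zero[OF _ _ _ _ y])
         (use 1 x in \<open>auto simp: brK_add_left brK_add_right brK_smult_left brK_smult_right algebra_simps intro!: eq_vecI\<close>)
  qed
  \<comment> \<open>The bracket of x with itself is quadratic in x, so it cannot be checked on unit
    vectors alone; it is obtained from antisymmetry by dividing by 2.\<close>
  have self: "brK x x = 0\<^sub>v n" if "x \<in> carrier_vec n" for x
  proof (rule eq_vecI)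
    fix i assume "i < dim_vec (0\<^sub>v n :: 'k alg_closure vec)"
    then have i: "i < n" by simp
    have "(brK x x + brK x x) $ i = 0" using anti[OF that that] i by simp
    then have "2 * (brK x x $ i) = 0" using i by simp
    then show "brK x x $ i = 0\<^sub>v n $ i" using i by simp
  qed simp
  let ?J = "\<lambda>x y z. brK x (brK y z) + brK y (brK z x) + brK z (brK x y)"
  have lin: "?J (u + v) y z = ?J u y z + ?J v y z" "?J x (u + v) z = ?J x u z + ?J x v z" "?J x y (u + v) = ?J x y u + ?J x y v"
    "?J (c \<cdot>\<^sub>v u) y z = c \<cdot>\<^sub>v ?J u y z" "?J x (c \<cdot>\<^sub>v u) z = c \<cdot>\<^sub>v ?J x u z" "?J x y (c \<cdot>\<^sub>v u) = c \<cdot>\<^sub>v ?J x y u"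
    if "u \<in> carrier_vec n" "v \<in> carrier_vec n" for c u v x y z
    using that
    by (auto simp: brK_add_left brK_add_right brK_smult_left brK_smult_right algebra_simps intro!: eq_vecI)
  have u: "?J (unit_vec n i) (unit_vec n j) (unit_vec n l) = 0\<^sub>v n" for i j l
  proof -
    have e: "brK (unit_vec n i) (brK (unit_vec n j) (unit_vec n l)) = vec_ac (br (unit_vec n i) (br (unit_vec n j) (unit_vec n l)))" for i j l
      using brK_vec_ac[of "unit_vec n j" "unit_vec n l"] brK_vec_ac[of "unit_vec n i" "br (unit_vec n j) (unit_vec n l)"]
      by simp
    have "?J (unit_vec n i) (unit_vec n j) (unit_vec n l) = vec_ac (br (unit_vec n i) (br (unit_vec n j) (unit_vec n l)) +
        br (unit_vec n j) (br (unit_vec n l) (unit_vec n i)) + br (unit_vec n l) (br (unit_vec n i) (unit_vec n j)))"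
      unfolding e by (rule eq_vecI) auto
    also have "\<dots> = 0\<^sub>v n" by (subst jacobi) auto
    finally show ?thesis .
  qed
  have 1: "?J x (unit_vec n j) (unit_vec n l) = 0\<^sub>v n" if "x \<in> carrier_vec n" for x j l
    by (rule linear_zero[OF lin(1) lin(4) _ u that]) auto
  have 2: "?J x y (unit_vec n l) = 0\<^sub>v n" if "x \<in> carrier_vec n" "y \<in> carrier_vec n" for x y l
    by (rule linear_zero[OF lin(2) lin(5) _ 1[OF that(1)] that(2)]) auto
  have jac: "?J x y z = 0\<^sub>v n" if "x \<in> carrier_vec n" "y \<in> carrier_vec n" "z \<in> carrier_vec n" for x y z
    by (rule linear_zero[OF lin(3) lin(6) _ 2[OF that(1,2)] that(3)]) auto
  show ?thesis
    unfolding lie_algebra_def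
    using self jac brK_add_left brK_add_right brK_smult_left brK_smult_right by auto
qed

text \<open>Both actions have the same values at all points over K. Vanishing descends to k because
  \<open>ev_inject\<close> with \<open>to_ac\<close> allows an element over k to be tested with
  values in K.\<close>

lemma coad_ac_iff:
  fixes f :: "'k salg"
  assumes f: "f \<in> salg n" and x: "x \<in> carrier_vec n"
  shows "coad_action C2 n brK (vec_ac x) (salg_ac f) = 0 \<longleftrightarrow> coad x f = 0"
proof -
  have eq: "pev a b zs (coad_action C2 n brK (vec_ac x) (salg_ac f)) = lin to_ac (ev a b zs) (coad x f)"
    for a b zs
  proof -
    have "mat_der n (\<lambda>i j. - (brK (vec_ac x) (unit_vec n j) $ i)) (ev a b zs) w =
        mat_der n (\<lambda>i j. to_ac (- (br x (unit_vec n j) $ i))) (ev a b zs) w" if "w \<in> keys f" for w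
      by (rule mat_der_cong[OF _ fst_letters_of_salg[OF f that]])
         (use brK_vec_ac[OF x, of "unit_vec n j" for j] x in simp)
    then show ?thesis
      unfolding pev_def coeff_hom.lin_coad_action[OF coeff_hom_id supersym_ev]
        coeff_hom.lin_coad_action[OF coeff_hom_to_ac supersym_ev]
      by (simp add: lin_def)
  qed
  show ?thesis
  proof
    assume "coad_action C2 n brK (vec_ac x) (salg_ac f) = 0"
    then show "coad x f = 0"
      using eq by (intro coeff_hom.ev_inject[OF coeff_hom_to_ac salg_coad_action[OF f]]) simp
  next
    assume "coad x f = 0"
    then show "coad_action C2 n brK (vec_ac x) (salg_ac f) = 0"
      using eq coeff_hom.lin_0[OF coeff_hom_to_ac]
      by (intro salg_eq_0I[OF salg_coad_action[OF salg_ac_in_salg[OF f]]]) simp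
  qed
qed

text \<open>The hypothesis on nilpotent elements lives over K and the conclusion over k. Reductivity
  is applied over k, so the ideal I and its complement J are formed there; iterating
  \<open>ad x\<close> for x in J passes through the ideal over K and comes back to I and J.\<close>

lemma coad_eq_0_if_ad_nilpotent:
  assumes red: "reductive n br" and f: "f \<in> salg n"
    and nil: "\<And>x. x \<in> carrier_vec n \<Longrightarrow> \<exists>r. ad_mat n brK x ^\<^sub>m r = 0\<^sub>m n n \<Longrightarrow>
      coad_action C2 n brK x (salg_ac f) = 0"
    and x: "x \<in> carrier_vec n"
  shows "coad x f = 0"
proof -
  interpret K: lie_ac n brK by unfold_locales (rule lie_brK)
  note fK = salg_ac_in_salg[OF f]
  define SK where "SK = {x \<in> carrier_vec n. coad_action C2 n brK x (salg_ac f) = 0}"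
  define S where "S = {x \<in> carrier_vec n. coad x f = 0}"
  have S_iff: "vec_ac x \<in> SK \<longleftrightarrow> x \<in> S" if "x \<in> carrier_vec n" for x
    using coad_ac_iff[OF f that] that by (simp add: S_def SK_def)
  have SK: "vsum n (K.nonzero_gens x) \<subseteq> SK" if "x \<in> carrier_vec n" for x
    by (rule K.nonzero_gens_subset[OF that])
       (use nil K.coad_0[OF fK] K.coad_add[OF fK] K.coad_br[OF fK] in \<open>auto simp: SK_def\<close>)
  have fc: "foldr br zs v \<in> carrier_vec n" if "v \<in> carrier_vec n" "set zs \<subseteq> carrier_vec n" for zs v
    using that by (induction zs) auto
  \<comment> \<open>The largest ideal inside S, described by iterated brackets; the empty list puts
    I inside S.\<close>
  define I where "I = {y \<in> carrier_vec n. \<forall>zs. set zs \<subseteq> carrier_vec n \<longrightarrow> foldr br zs y \<in> S}"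
  have "lie_ideal n br I"
    unfolding lie_ideal_def linear_subspace_def
  proof (intro conjI ballI allI)
    show "I \<subseteq> carrier_vec n" by (auto simp: I_def)
    have "foldr br zs (0\<^sub>v n) = 0\<^sub>v n" if "set zs \<subseteq> carrier_vec n" for zs
      using that by (induction zs) auto
    then show "0\<^sub>v n \<in> I" using coad_0[OF f] by (auto simp: I_def S_def)
  next
    fix u v assume uv: "u \<in> I" "v \<in> I"
    have "foldr br zs (u + v) = foldr br zs u + foldr br zs v" if "set zs \<subseteq> carrier_vec n" for zs
      using that by (induction zs) (use uv fc in \<open>auto simp: I_def br_add_right\<close>)
    then show "u + v \<in> I" using uv coad_add[OF f] by (auto simp: I_def S_def)
  next
    fix c u assume u: "u \<in> I"
    have "foldr br zs (c \<cdot>\<^sub>v u) = c \<cdot>\<^sub>v foldr br zs u" if "set zs \<subseteq> carrier_vec n" for zs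
      using that by (induction zs) (use u fc in \<open>auto simp: I_def br_smult_right\<close>)
    then show "c \<cdot>\<^sub>v u \<in> I" using u coad_smult[OF f] by (auto simp: I_def S_def)
  next
    fix z u :: "'k vec" assume zu: "z \<in> carrier_vec n" "u \<in> I"
    have "foldr br zs (br z u) \<in> S" if "set zs \<subseteq> carrier_vec n" for zs
      using zu that unfolding I_def by (auto dest!: spec[of _ "zs @ [z]"])
    then show "br z u \<in> I" using zu by (auto simp: I_def)
  qed
  then obtain J where J: "lie_ideal n br J" "I \<inter> J = {0\<^sub>v n}"
      "\<And>x. x \<in> carrier_vec n \<Longrightarrow> \<exists>u\<in>I. \<exists>v\<in>J. x = u + v"
    using red unfolding reductive_def by blast
  have Jc: "J \<subseteq> carrier_vec n" and Jbr: "\<And>z u. z \<in> carrier_vec n \<Longrightarrow> u \<in> J \<Longrightarrow> br z u \<in> J"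
    and Jsm: "\<And>c u. u \<in> J \<Longrightarrow> c \<cdot>\<^sub>v u \<in> J"
    using J(1) unfolding lie_ideal_def linear_subspace_def by blast+
  have JS: "x \<in> S" if xJ: "x \<in> J" for x
  proof -
    have x: "x \<in> carrier_vec n" using xJ Jc by blast
    have powc: "(br x ^^ s) z \<in> carrier_vec n" if "z \<in> carrier_vec n" for s and z :: "'k vec"
      by (induction s) (use x that in auto)
    have powK: "(brK (vec_ac x) ^^ s) (vec_ac z) = vec_ac ((br x ^^ s) z)" if "z \<in> carrier_vec n" for s z
      by (induction s) (use brK_vec_ac[OF x powc[OF that]] in auto)
    have pow0: "\<exists>r. (br x ^^ r) z = 0\<^sub>v n" if z: "z \<in> carrier_vec n" for z
    proof -
      obtain r where r: "\<And>s. s \<ge> r \<Longrightarrow> (brK (vec_ac x) ^^ s) (vec_ac z) \<in> vsum n (K.nonzero_gens (vec_ac x))"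
        using K.ad_pow_in_nonzero_gens[of "vec_ac x" "vec_ac z"] x z by auto
      \<comment> \<open>The exponent is a successor so that y is a bracket with x and lies in J;
        being at least r, it also puts y into the ideal over K.\<close>
      define y where "y = (br x ^^ Suc r) z"
      have y: "y \<in> carrier_vec n" unfolding y_def by (rule powc[OF z])
      have yK: "vec_ac y \<in> vsum n (K.nonzero_gens (vec_ac x))"
        using r[of "Suc r"] powK[OF z, of "Suc r"] unfolding y_def by simp
      \<comment> \<open>All iterated brackets of y stay in the ideal over K, which lies in
        \<open>SK\<close>; descending to k, they lie in S, so y is in I.\<close>
      have "vec_ac (foldr br zs y) \<in> vsum n (K.nonzero_gens (vec_ac x))" if "set zs \<subseteq> carrier_vec n" for zs
        using that
      proof (induction zs)
        case (Cons u zs)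
        then have c: "u \<in> carrier_vec n" "foldr br zs y \<in> carrier_vec n" using fc y by auto
        then show ?case
          using K.nonzero_gens_ideal[of "vec_ac x" "vec_ac u", OF _ _ Cons.IH] Cons.prems x
          by (simp add: brK_vec_ac)
      qed (use yK in simp)
      then have "foldr br zs y \<in> S" if "set zs \<subseteq> carrier_vec n" for zs
        using that SK[of "vec_ac x"] S_iff fc[OF y that] x by auto
      then have "y \<in> I" using y by (simp add: I_def)
      moreover have "y \<in> J"
      proof -
        have "y = (- 1) \<cdot>\<^sub>v br ((br x ^^ r) z) x"
          unfolding y_def using br_anti[OF x powc[OF z]] by simp
        then show ?thesis using Jsm[OF Jbr[OF powc[OF z] xJ]] by simp
      qed
      ultimately have "y = 0\<^sub>v n" using J(2) by blast
      then show ?thesis unfolding y_def by blast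
    qed
    have "\<exists>r. ad_mat n brK (vec_ac x) ^\<^sub>m r = 0\<^sub>m n n"
    proof (rule nilpotentI[OF ad_mat_carrier])
      fix j assume "j < n"
      obtain r where r: "(br x ^^ r) (unit_vec n j) = 0\<^sub>v n" using pow0[of "unit_vec n j"] by auto
      have "(brK (vec_ac x) ^^ r) (unit_vec n j) = 0\<^sub>v n"
        using powK[of "unit_vec n j" r] r by simp
      then show "\<exists>r. ((\<lambda>v. ad_mat n brK (vec_ac x) *\<^sub>v v) ^^ r) (unit_vec n j) = 0\<^sub>v n"
        using K.ad_funpow[of "vec_ac x" "unit_vec n j" r] x by auto
    qed
    then have "vec_ac x \<in> SK" using nil[of "vec_ac x"] x by (simp add: SK_def)
    then show ?thesis using S_iff x by simp
  qed
  have "J \<subseteq> I"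
  proof
    fix y assume y: "y \<in> J"
    have "foldr br zs y \<in> J" if "set zs \<subseteq> carrier_vec n" for zs
      using that by (induction zs) (use y Jbr in auto)
    then show "y \<in> I" using JS y Jc by (auto simp: I_def)
  qed
  obtain u v where uv: "u \<in> I" "v \<in> J" "x = u + v" using J(3)[OF x] by blast
  then have "foldr br [] u \<in> S" "foldr br [] v \<in> S" using \<open>J \<subseteq> I\<close> unfolding I_def by (auto simp del: foldr.simps)
  then show ?thesis using uv coad_add[OF f] by (simp add: S_def)
qed

text \<open>Group invariance gives vanishing for ad-nilpotent elements over K, which is enough by
  the preceding lemma. The converse passes from k to K through unit vectors, which are defined over
  k and span over K.\<close>

lemma Ad_group_invariant_iff:
  assumes red: "reductive n br" and f: "f \<in> salg n"
  shows "(\<forall>\<gamma>\<in>Ad_group n br. \<forall>a\<in>carrier_vec n. \<forall>b\<in>carrier_vec n. \<forall>zs. set zs \<subseteq> carrier_vec n \<longrightarrow>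
      pev (\<gamma> *\<^sub>v a) (\<gamma> *\<^sub>v b) (mult_vecs \<gamma> zs) (salg_ac f) = pev a b zs (salg_ac f)) \<longleftrightarrow>
    (\<forall>x\<in>carrier_vec n. coad x f = 0)"
proof -
  interpret K: lie_ac n brK by unfold_locales (rule lie_brK)
  note fK = salg_ac_in_salg[OF f]
  show ?thesis
    unfolding Ad_group_def K.inner_auts_invariant_iff[OF fK]
  proof
    assume "\<forall>x\<in>carrier_vec n. (\<exists>r. ad_mat n brK x ^\<^sub>m r = 0\<^sub>m n n) \<longrightarrow> coad_action C2 n brK x (salg_ac f) = 0"
    then show "\<forall>x\<in>carrier_vec n. coad x f = 0"
      using coad_eq_0_if_ad_nilpotent[OF red f] by blast
  next
    assume *: "\<forall>x\<in>carrier_vec n. coad x f = 0"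
    have "coad_action C2 n brK (unit_vec n i) (salg_ac f) = 0" for i
      using coad_ac_iff[OF f, of "unit_vec n i"] * by simp
    then show "\<forall>x\<in>carrier_vec n. (\<exists>r. ad_mat n brK x ^\<^sub>m r = 0\<^sub>m n n) \<longrightarrow> coad_action C2 n brK x (salg_ac f) = 0"
      using K.coad_eq_0_if_units[OF fK] by blast
  qed
qed

end

section \<open>Bases of subspaces\<close>

text \<open>A basis is an injective matrix with image inside U and the largest possible number of
  columns, bounded by n. A vector of U outside the image could be appended as a further
  column.\<close>

lemma is_basis_exists:
  assumes U: "linear_subspace n (U :: 'k::field vec set)"
  shows "\<exists>m B. is_basis n U m B"
proof -
  define P where "P m \<longleftrightarrow> (\<exists>B\<in>carrier_mat n m. (\<lambda>v. B *\<^sub>v v) ` carrier_vec m \<subseteq> U \<and>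
      (\<forall>v\<in>carrier_vec m. B *\<^sub>v v = 0\<^sub>v n \<longrightarrow> v = 0\<^sub>v m))" for m
  have U0: "0\<^sub>v n \<in> U" and Uadd: "\<And>x y. x \<in> U \<Longrightarrow> y \<in> U \<Longrightarrow> x + y \<in> U"
    and Usm: "\<And>a x. x \<in> U \<Longrightarrow> a \<cdot>\<^sub>v x \<in> U" and Uc: "U \<subseteq> carrier_vec n"
    using U unfolding linear_subspace_def by auto
  have "P 0"
    unfolding P_def
  proof (rule bexI[of _ "mat n 0 (\<lambda>_. 0)"])
    have "mat n 0 (\<lambda>_. 0) *\<^sub>v v = (0\<^sub>v n :: 'k vec)" if "v \<in> carrier_vec 0" for v
      using that by (intro eq_vecI) (auto simp: scalar_prod_def)
    then show "(\<lambda>v. mat n 0 (\<lambda>_. 0) *\<^sub>v v) ` carrier_vec 0 \<subseteq> U \<and>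
      (\<forall>v\<in>carrier_vec 0. mat n 0 (\<lambda>_. 0) *\<^sub>v v = 0\<^sub>v n \<longrightarrow> v = 0\<^sub>v 0)"
      using U0 by auto
  qed simp
  have bound: "m \<le> n" if Pm: "P m" for m
  proof (rule ccontr)
    assume "\<not> m \<le> n"
    obtain B where B: "B \<in> carrier_mat n m" and "(\<lambda>v. B *\<^sub>v v) ` carrier_vec m \<subseteq> U"
        and Binj: "\<forall>v\<in>carrier_vec m. B *\<^sub>v v = 0\<^sub>v n \<longrightarrow> v = 0\<^sub>v m"
      using Pm unfolding P_def by (elim bexE conjE)
    obtain c where c: "\<exists>i<m. c i \<noteq> 0" "\<And>l. l < n \<Longrightarrow> (\<Sum>i<m. c i * B $$ (l, i)) = 0"
      using exists_dependency[of n m "\<lambda>i l. B $$ (l, i)"] \<open>\<not> m \<le> n\<close> by auto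
    have "B *\<^sub>v vec m c = 0\<^sub>v n"
      by (rule eq_vecI) (use B c(2) in \<open>auto simp: scalar_prod_def lessThan_atLeast0 mult.commute\<close>)
    then have "vec m c = 0\<^sub>v m" using Binj by simp
    then show False using c(1) by (metis index_vec index_zero_vec(1))
  qed
  obtain m where m: "P m" "\<And>m'. P m' \<Longrightarrow> m' \<le> m"
    using \<open>P 0\<close> bound by (metis GreatestI_nat Greatest_le_nat)
  obtain B where B: "B \<in> carrier_mat n m" "(\<lambda>v. B *\<^sub>v v) ` carrier_vec m \<subseteq> U"
      "\<forall>v\<in>carrier_vec m. B *\<^sub>v v = 0\<^sub>v n \<longrightarrow> v = 0\<^sub>v m"
    using m(1) unfolding P_def by (elim bexE conjE)
  have "u \<in> (\<lambda>v. B *\<^sub>v v) ` carrier_vec m" if u: "u \<in> U" for u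
  proof (rule ccontr)
    assume notin: "u \<notin> (\<lambda>v. B *\<^sub>v v) ` carrier_vec m"
    have uc: "u \<in> carrier_vec n" using u Uc by blast
    define B' where "B' = mat n (Suc m) (\<lambda>(i, j). if j < m then B $$ (i, j) else u $ i)"
    have B'v: "B' *\<^sub>v v = B *\<^sub>v vec m (\<lambda>i. v $ i) + (v $ m) \<cdot>\<^sub>v u" if "v \<in> carrier_vec (Suc m)" for v
      by (rule eq_vecI)
         (use that B(1) uc in \<open>auto simp: B'_def scalar_prod_def sum.atLeast0_lessThan_Suc mult.commute\<close>)
    have "P (Suc m)"
      unfolding P_def
    proof (intro bexI[of _ B'] conjI ballI impI)
      show "(\<lambda>v. B' *\<^sub>v v) ` carrier_vec (Suc m) \<subseteq> U"
        using B(2) u by (auto simp: B'v intro!: Uadd Usm)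
      fix v assume v: "v \<in> carrier_vec (Suc m)" "B' *\<^sub>v v = 0\<^sub>v n"
      let ?w = "vec m (\<lambda>i. v $ i)"
      have e: "(B *\<^sub>v ?w) $ i + v $ m * u $ i = 0" if "i < n" for i
      proof -
        have "(B *\<^sub>v ?w + (v $ m) \<cdot>\<^sub>v u) $ i = 0"
          unfolding B'v[OF v(1), symmetric] v(2) using that by simp
        then show ?thesis using that B(1) uc by simp
      qed
      have vm: "v $ m = 0"
      proof (rule ccontr)
        assume nz: "v $ m \<noteq> 0"
        have "u = (- 1 / v $ m) \<cdot>\<^sub>v (B *\<^sub>v ?w)"
        proof (rule eq_vecI)
          fix i assume "i < dim_vec ((- 1 / v $ m) \<cdot>\<^sub>v (B *\<^sub>v ?w))"
          then have i: "i < n" using B(1) by simp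
          have "(B *\<^sub>v ?w) $ i = - (v $ m * u $ i)" using e[OF i] by (simp add: eq_neg_iff_add_eq_0)
          then show "u $ i = ((- 1 / v $ m) \<cdot>\<^sub>v (B *\<^sub>v ?w)) $ i"
            using i B(1) nz by simp
        qed (use uc B(1) in simp)
        also have "\<dots> = B *\<^sub>v ((- 1 / v $ m) \<cdot>\<^sub>v ?w)" by (rule mult_mat_vec[symmetric, OF B(1)]) simp
        finally show False using notin by auto
      qed
      have "B *\<^sub>v ?w = 0\<^sub>v n" by (rule eq_vecI) (use e vm B(1) in auto)
      then have w: "?w = 0\<^sub>v m" using B(3) by simp
      show "v = 0\<^sub>v (Suc m)"
      proof (rule eq_vecI)
        fix i assume i: "i < dim_vec (0\<^sub>v (Suc m) :: 'k vec)"
        show "v $ i = 0\<^sub>v (Suc m) $ i"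
        proof (cases "i = m")
          case False
          then have "?w $ i = 0" using w i by simp
          then show ?thesis using i False by simp
        qed (use vm in simp)
      qed (use v in simp)
    qed (simp add: B'_def)
    then show False using m(2) by fastforce
  qed
  then have "is_basis n U m B" using B unfolding is_basis_def by blast
  then show ?thesis by blast
qed

text \<open>The left inverse comes from the abstract theory of vector spaces, applied to functions
  on the natural numbers: B becomes a linear map F, injective on the sequences \<open>X0\<close>
  supported below m, and the matrix L records a left inverse of F on the unit sequences.\<close>

lemma is_basis_frame:
  assumes "is_basis n U m (B :: 'k::field_char_0 mat)"
  shows "\<exists>L. frame n m B L \<and> frame.V m B = U"
proof -
  have B: "B \<in> carrier_mat n m" and U: "U = (\<lambda>v. B *\<^sub>v v) ` carrier_vec m"
    and inj: "\<And>v. v \<in> carrier_vec m \<Longrightarrow> B *\<^sub>v v = 0\<^sub>v n \<Longrightarrow> v = 0\<^sub>v m"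
    using assms unfolding is_basis_def by auto
  interpret vs: vector_space "\<lambda>(c::'k) (f::nat \<Rightarrow> 'k) i. c * f i"
    by unfold_locales (auto simp: algebra_simps fun_eq_iff)
  interpret vs2: vector_space_pair "\<lambda>(c::'k) (f::nat \<Rightarrow> 'k) i. c * f i" "\<lambda>(c::'k) (f::nat \<Rightarrow> 'k) i. c * f i" ..
  define F where "F x l = (if l < n then \<Sum>j<m. B $$ (l, j) * x j else 0)" for x :: "nat \<Rightarrow> 'k" and l
  define X0 where "X0 = {x :: nat \<Rightarrow> 'k. \<forall>j\<ge>m. x j = 0}"
  have linF: "Vector_Spaces.linear (\<lambda>(c::'k) (f::nat \<Rightarrow> 'k) i. c * f i) (\<lambda>(c::'k) (f::nat \<Rightarrow> 'k) i. c * f i) F"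
    by unfold_locales (auto simp: F_def fun_eq_iff algebra_simps sum.distrib sum_distrib_left)
  have sub: "vs.subspace X0"
    unfolding vs.subspace_def X0_def by auto
  have injF: "inj_on F X0"
  proof (rule inj_onI)
    fix x y assume xy: "x \<in> X0" "y \<in> X0" "F x = F y"
    have "B *\<^sub>v vec m (\<lambda>j. x j - y j) = 0\<^sub>v n"
    proof (rule eq_vecI)
      fix l assume "l < dim_vec (0\<^sub>v n :: 'k vec)"
      then have l: "l < n" by simp
      have "F x l = F y l" using xy by simp
      then have "(\<Sum>j<m. B $$ (l, j) * (x j - y j)) = 0"
        using l by (simp add: F_def right_diff_distrib sum_subtractf)
      then show "(B *\<^sub>v vec m (\<lambda>j. x j - y j)) $ l = 0\<^sub>v n $ l"
        using B l by (simp add: scalar_prod_def lessThan_atLeast0)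
    qed (use B in simp)
    then have z: "vec m (\<lambda>j. x j - y j) = 0\<^sub>v m" by (intro inj) auto
    have "x j = y j" for j
    proof (cases "j < m")
      case True
      then have "vec m (\<lambda>j. x j - y j) $ j = 0" using z by simp
      then show ?thesis using True by simp
    qed (use xy in \<open>simp add: X0_def\<close>)
    then show "x = y" by blast
  qed
  obtain g where g: "Vector_Spaces.linear (\<lambda>(c::'k) (f::nat \<Rightarrow> 'k) i. c * f i) (\<lambda>(c::'k) (f::nat \<Rightarrow> 'k) i. c * f i) g"
      "\<And>x. x \<in> X0 \<Longrightarrow> g (F x) = x"
    using vs2.linear_exists_left_inverse_on[OF linF sub injF] by blast
  define e where "e l = (\<lambda>i. if i = l then 1 else 0 :: 'k)" for l :: nat
  define L where "L = mat m n (\<lambda>(j, l). g (e l) j)"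
  have "L * B = 1\<^sub>m m"
  proof (rule eq_matI)
    fix i j assume "i < dim_row (1\<^sub>m m :: 'k mat)" "j < dim_col (1\<^sub>m m :: 'k mat)"
    then have ij: "i < m" "j < m" by simp_all
    have "F (e j) = (\<Sum>l<n. (\<lambda>i. B $$ (l, j) * e l i))"
    proof
      fix i
      have s: "(\<Sum>l\<in>A. (\<lambda>i. B $$ (l, j) * e l i)) i = (\<Sum>l\<in>A. B $$ (l, j) * e l i)" for A
        by (induction A rule: infinite_finite_induct) auto
      show "F (e j) i = (\<Sum>l<n. (\<lambda>i. B $$ (l, j) * e l i)) i"
        unfolding s using ij by (simp add: F_def e_def if_distrib cong: if_cong)
    qed
    then have "g (F (e j)) = (\<Sum>l<n. (\<lambda>i. B $$ (l, j) * g (e l) i))"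
      by (simp only: vs2.linear_sum[OF g(1)] vs2.linear_scale[OF g(1)])
    moreover have "g (F (e j)) = e j" by (rule g(2)) (use ij in \<open>auto simp: X0_def e_def\<close>)
    ultimately have ge: "(\<Sum>l<n. (\<lambda>i. B $$ (l, j) * g (e l) i)) = e j" by simp
    have "(\<Sum>l\<in>A. (\<lambda>i. B $$ (l, j) * g (e l) i)) i = (\<Sum>l\<in>A. B $$ (l, j) * g (e l) i)" for A
      by (induction A rule: infinite_finite_induct) auto
    from this[of "{..<n}"] have "(\<Sum>l<n. B $$ (l, j) * g (e l) i) = e j i" unfolding ge by (rule sym)
    then show "(L * B) $$ (i, j) = 1\<^sub>m m $$ (i, j)"
      using ij B by (simp add: L_def scalar_prod_def lessThan_atLeast0 mult.commute e_def)
  qed (use B in \<open>simp_all add: L_def\<close>)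
  then have fr: "frame n m B L" using B by unfold_locales (simp_all add: L_def)
  then show ?thesis using frame.V_def[OF fr] U by blast
qed

section \<open>Base change of subspaces and forms\<close>

context frame
begin

abbreviation "BK \<equiv> map_mat to_ac B"
abbreviation "LK \<equiv> map_mat to_ac L"

lemma frame_ac: "frame n m BK LK"
proof -
  interpret h: comm_ring_hom "to_ac :: 'k \<Rightarrow> _" by unfold_locales simp_all
  show ?thesis
    using B L h.mat_hom_mult[OF L B] LB by unfold_locales (auto simp: h.mat_hom_one)
qed

end

text \<open>A separate locale, because iterating the base change inside \<open>frame\<close> would never terminate: the
  closure of a closure is a new type.\<close>

locale frame_ext = frame n m B L for n m :: nat and B L :: "'k::field_char_0 mat"
begin

sublocale K: frame n m BK LK by (rule frame_ac)

lemma BK_vec_ac: "v \<in> carrier_vec m \<Longrightarrow> BK *\<^sub>v vec_ac v = vec_ac (B *\<^sub>v v)"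
proof -
  interpret h: comm_ring_hom "to_ac :: 'k \<Rightarrow> _" by unfold_locales simp_all
  show "v \<in> carrier_vec m \<Longrightarrow> BK *\<^sub>v vec_ac v = vec_ac (B *\<^sub>v v)"
    using h.mult_mat_vec_hom[OF B] by simp
qed

lemma LK_vec_ac: "v \<in> carrier_vec n \<Longrightarrow> LK *\<^sub>v vec_ac v = vec_ac (L *\<^sub>v v)"
proof -
  interpret h: comm_ring_hom "to_ac :: 'k \<Rightarrow> _" by unfold_locales simp_all
  show "v \<in> carrier_vec n \<Longrightarrow> LK *\<^sub>v vec_ac v = vec_ac (L *\<^sub>v v)"
    using h.mult_mat_vec_hom[OF L] by simp
qed

lemma vec_ac_V: "\<xi> \<in> V \<Longrightarrow> vec_ac \<xi> \<in> K.V"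
  unfolding V_def K.V_def using BK_vec_ac by (auto simp: image_iff) (metis map_carrier_vec)

text \<open>Coordinates extend K-linearly through L in one direction. In the other, the columns of B
  serve as the finite set; \<open>span_ac\<close> indexes coefficients by vectors, so the columns
  must be distinct.\<close>

lemma span_ac_V: "span_ac n V = K.V"
proof (intro equalityI subsetI)
  fix x assume "x \<in> span_ac n V"
  then obtain S :: "'k vec set" and a where S: "x = vec n (\<lambda>i. \<Sum>u\<in>S. a u * to_ac (u $ i))" "finite S" "S \<subseteq> V"
    unfolding span_ac_def by blast
  define w where "w = vec m (\<lambda>j. \<Sum>u\<in>S. a u * to_ac ((L *\<^sub>v u) $ j))"
  have "BK *\<^sub>v w = x"
  proof (rule eq_vecI)
    fix i assume "i < dim_vec x"
    then have i: "i < n" by (simp add: S(1))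
    have "(BK *\<^sub>v w) $ i = (\<Sum>j<m. to_ac (B $$ (i, j)) * (\<Sum>u\<in>S. a u * to_ac ((L *\<^sub>v u) $ j)))"
      using i B by (simp add: w_def scalar_prod_def lessThan_atLeast0)
    also have "\<dots> = (\<Sum>u\<in>S. a u * to_ac (\<Sum>j<m. B $$ (i, j) * (L *\<^sub>v u) $ j))"
      by (simp add: sum_distrib_left to_ac_sum mult_ac) (subst sum.swap, simp)
    also have "\<dots> = (\<Sum>u\<in>S. a u * to_ac (u $ i))"
    proof (rule sum.cong[OF refl])
      fix u assume "u \<in> S"
      then have u: "u \<in> V" using S by blast
      have "(B *\<^sub>v (L *\<^sub>v u)) $ i = (\<Sum>j<m. B $$ (i, j) * (L *\<^sub>v u) $ j)"
        using i B carrier_vecD[OF LV_carrier[OF u]] by (simp add: scalar_prod_def lessThan_atLeast0)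
      then show "a u * to_ac (\<Sum>j<m. B $$ (i, j) * (L *\<^sub>v u) $ j) = a u * to_ac (u $ i)"
        using BLv[OF u] by simp
    qed
    finally show "(BK *\<^sub>v w) $ i = x $ i" using i by (simp add: S(1))
  qed (use B in \<open>simp add: S(1)\<close>)
  moreover have "w \<in> carrier_vec m" by (simp add: w_def)
  ultimately show "x \<in> K.V" unfolding K.V_def by blast
next
  fix x assume "x \<in> K.V"
  then obtain w where w: "w \<in> carrier_vec m" "x = BK *\<^sub>v w" unfolding K.V_def by blast
  define c where "c j = B *\<^sub>v unit_vec m j" for j
  have inj: "inj_on c {..<m}"
  proof (rule inj_onI)
    fix i j assume ij: "i \<in> {..<m}" "j \<in> {..<m}" "c i = c j"
    have "unit_vec m i = (unit_vec m j :: 'k vec)"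
      using arg_cong[OF ij(3), of "\<lambda>v. L *\<^sub>v v"] unfolding c_def by simp
    then have "unit_vec m i $ i = (unit_vec m j :: 'k vec) $ i" by simp
    then show "i = j" using ij by (simp split: if_splits)
  qed
  have ci: "c j $ i = B $$ (i, j)" if "i < n" "j < m" for i j
    using that B by (simp add: c_def)
  define a where "a u = vec_index w (inv_into {..<m} c u)" for u
  have "x = vec n (\<lambda>i. \<Sum>u\<in>c ` {..<m}. a u * to_ac (u $ i))"
  proof (rule eq_vecI)
    fix i assume "i < dim_vec (vec n (\<lambda>i. \<Sum>u\<in>c ` {..<m}. a u * to_ac (u $ i)))"
    then have i: "i < n" by simp
    have "(\<Sum>u\<in>c ` {..<m}. a u * to_ac (u $ i)) = (\<Sum>j<m. w $ j * to_ac (B $$ (i, j)))"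
      by (subst sum.reindex[OF inj]) (auto simp: a_def inv_into_f_f[OF inj] ci[OF i] intro!: sum.cong)
    then show "x $ i = vec n (\<lambda>i. \<Sum>u\<in>c ` {..<m}. a u * to_ac (u $ i)) $ i"
      using i B w by (simp add: scalar_prod_def lessThan_atLeast0 mult.commute)
  qed (use B w in simp)
  moreover have "c ` {..<m} \<subseteq> V" by (auto simp: c_def intro!: BV)
  ultimately show "x \<in> span_ac n V" unfolding span_ac_def by blast
qed

lemma to_ac_pev:
  fixes a b :: "'k vec"
  assumes "a \<in> carrier_vec m" "b \<in> carrier_vec m" "set zs \<subseteq> carrier_vec m" "f \<in> salg m"
  shows "pev (vec_ac a) (vec_ac b) (map vec_ac zs) (salg_ac f) = to_ac (pev a b zs f)"
proof -
  interpret h: comm_ring_hom "to_ac :: 'k \<Rightarrow> _" by unfold_locales simp_all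
  show ?thesis
    unfolding pev_def lin_def keys_salg_ac lookup_salg_ac to_ac_sum
    by (rule sum.cong) (simp_all add: h.ev_hom[OF assms(1-3)] fst_letters_of_salg[OF assms(4)])
qed

text \<open>Points with natural number coordinates and unit vectors come from k and separate forms
  over K, so a form over k has only one base change, the one with the same coefficients.\<close>

lemma extends_form_iff:
  assumes f: "f \<in> salg m" and f': "f' \<in> salg m"
  shows "extends_form V (form_of V L f) (form_of K.V LK f') \<longleftrightarrow> f' = salg_ac f"
proof
  have car: "set (mult_vecs L \<zeta>s) \<subseteq> carrier_vec m" if "set \<zeta>s \<subseteq> V" for \<zeta>s
    using that LV_carrier by auto
  have val: "form_of K.V LK g (vec_ac \<xi>) (vec_ac \<eta>) (map vec_ac \<zeta>s) =
      pev (vec_ac (L *\<^sub>v \<xi>)) (vec_ac (L *\<^sub>v \<eta>)) (map vec_ac (mult_vecs L \<zeta>s)) g"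
    if "\<xi> \<in> V" "\<eta> \<in> V" "set \<zeta>s \<subseteq> V" for \<xi> \<eta> \<zeta>s g
  proof -
    have c: "\<zeta> \<in> carrier_vec n" if "\<zeta> \<in> V" for \<zeta> using that V_carrier by blast
    have "mult_vecs LK (map vec_ac \<zeta>s) = map vec_ac (mult_vecs L \<zeta>s)"
      using that(3) c by (auto simp: LK_vec_ac)
    moreover have "set (map vec_ac \<zeta>s) \<subseteq> K.V" using that(3) vec_ac_V by auto
    ultimately show ?thesis using that c vec_ac_V by (simp add: form_of_def LK_vec_ac del: map_map)
  qed
  {
    assume ext: "extends_form V (form_of V L f) (form_of K.V LK f')"
    have "f' - salg_ac f = 0"
    proof (rule coeff_hom.ev_inject[OF coeff_hom_id])
      show "f' - salg_ac f \<in> salg m" by (intro salg_diff f' salg_ac_in_salg f)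
      fix \<alpha> \<beta> :: "nat \<Rightarrow> nat" and zs :: "'k alg_closure vec list"
      assume zs: "set zs \<subseteq> unit_vec m ` {..<m}"
      have "\<exists>ys. set ys \<subseteq> unit_vec m ` {..<m} \<and> zs = map vec_ac ys"
        using zs
      proof (induction zs)
        case (Cons z zs)
        then obtain ys i where "set ys \<subseteq> unit_vec m ` {..<m}" "zs = map vec_ac ys" "i < m" "z = unit_vec m i"
          by auto
        then show ?case by (intro exI[of _ "unit_vec m i # ys"]) auto
      qed simp
      then obtain ys where ys: "set ys \<subseteq> unit_vec m ` {..<m}" "zs = map vec_ac ys" by blast
      have yc: "set ys \<subseteq> carrier_vec m" using ys by auto
      have nv: "vec_ac (nat_vec m \<gamma>) = nat_vec m \<gamma>" for \<gamma>
        unfolding nat_vec_def by (rule eq_vecI) auto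
      let ?\<zeta>s = "mult_vecs B ys"
      have \<zeta>s: "set ?\<zeta>s \<subseteq> V" using yc BV by auto
      have Ly: "mult_vecs L ?\<zeta>s = ys" unfolding map_map using yc by (intro map_idI) auto
      have "form_of K.V LK f' (vec_ac (B *\<^sub>v nat_vec m \<alpha>)) (vec_ac (B *\<^sub>v nat_vec m \<beta>)) (map vec_ac ?\<zeta>s) =
        to_ac (form_of V L f (B *\<^sub>v nat_vec m \<alpha>) (B *\<^sub>v nat_vec m \<beta>) ?\<zeta>s)"
        using ext[unfolded extends_form_def, rule_format, OF BV BV \<zeta>s] by simp
      then have "pev (vec_ac (nat_vec m \<alpha>)) (vec_ac (nat_vec m \<beta>)) zs f' = to_ac (pev (nat_vec m \<alpha>) (nat_vec m \<beta>) ys f)"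
        using \<zeta>s BV by (subst (asm) val) (simp_all add: form_of_def Ly ys(2) del: map_map)
      also have "\<dots> = pev (vec_ac (nat_vec m \<alpha>)) (vec_ac (nat_vec m \<beta>)) zs (salg_ac f)"
        unfolding ys(2) by (rule to_ac_pev[symmetric]) (use yc f in auto)
      finally show "lin (\<lambda>c. c) (ev (nat_vec m \<alpha>) (nat_vec m \<beta>) zs) (f' - salg_ac f) = 0"
        unfolding pev_def[symmetric] pev_diff nv by simp
    qed
    then show "f' = salg_ac f" by simp
  }
  assume eq: "f' = salg_ac f"
  show "extends_form V (form_of V L f) (form_of K.V LK f')"
    unfolding extends_form_def
  proof (intro ballI allI impI)
    fix \<xi> \<eta> \<zeta>s assume V: "\<xi> \<in> V" "\<eta> \<in> V" "set \<zeta>s \<subseteq> V"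
    show "form_of K.V LK f' (vec_ac \<xi>) (vec_ac \<eta>) (map vec_ac \<zeta>s) = to_ac (form_of V L f \<xi> \<eta> \<zeta>s)"
      unfolding val[OF V] eq using to_ac_pev[OF LV_carrier[OF V(1)] LV_carrier[OF V(2)] car[OF V(3)] f] V
      by (simp add: form_of_def)
  qed
qed

end

section \<open>Quasi-isomorphisms and isomorphisms of complexes\<close>

text \<open>\<psi> is injective on an ambient group D that contains all components and the images of
  the differential, so equations such as x - y = d c can be pulled back along \<psi>.\<close>

locale complex_iso =
  fixes A :: "nat \<Rightarrow> 'a::ab_group_add set" and d :: "'a \<Rightarrow> 'a"
    and A' :: "nat \<Rightarrow> 'b::ab_group_add set" and d' :: "'b \<Rightarrow> 'b"
    and D :: "'a set" and \<psi> :: "'a \<Rightarrow> 'b"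
  assumes diff: "\<psi> (x - y) = \<psi> x - \<psi> y"
    and D_diff: "x \<in> D \<Longrightarrow> y \<in> D \<Longrightarrow> x - y \<in> D"
    and inj: "inj_on \<psi> D" and AD: "A i \<subseteq> D" and dD: "a \<in> A i \<Longrightarrow> d a \<in> D" and D0: "0 \<in> D"
    and onto: "\<psi> ` A i = A' i"
    and comm: "a \<in> A i \<Longrightarrow> \<psi> (d a) = d' (\<psi> a)"
begin

lemma \<psi>_0: "\<psi> 0 = 0"
  using diff[of 0 0] by simp

lemma \<psi>_eq_0_iff: "x \<in> D \<Longrightarrow> \<psi> x = 0 \<longleftrightarrow> x = 0"
  using inj D0 \<psi>_0 by (metis inj_on_eq_iff)

lemma in_A'_iff: "x \<in> D \<Longrightarrow> \<psi> x \<in> A' i \<longleftrightarrow> x \<in> A i"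
  unfolding onto[symmetric] using AD inj by (meson image_eqI inj_on_image_mem_iff)

lemma cycles_iff: "x \<in> D \<Longrightarrow> \<psi> x \<in> cycles A' d' i \<longleftrightarrow> x \<in> cycles A d i"
  unfolding cycles_def using in_A'_iff comm[of x i] \<psi>_eq_0_iff[of "d x"] dD[of x i] by auto

lemma homologous_iff:
  assumes "x \<in> D" "y \<in> D"
  shows "(\<psi> x, \<psi> y) \<in> homologous A' d' i \<longleftrightarrow> (x, y) \<in> homologous A d i"
proof -
  have "\<psi> x - \<psi> y \<in> d' ` A' (Suc i) \<longleftrightarrow> x - y \<in> d ` A (Suc i)"
  proof
    assume "\<psi> x - \<psi> y \<in> d' ` A' (Suc i)"
    then obtain c where c: "c \<in> A (Suc i)" "\<psi> (x - y) = \<psi> (d c)"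
      unfolding onto[symmetric] using comm by (auto simp: diff)
    then have "x - y = d c"
      using inj_onD[OF inj c(2)] D_diff[OF assms] dD by blast
    then show "x - y \<in> d ` A (Suc i)" using c by blast
  next
    assume "x - y \<in> d ` A (Suc i)"
    then obtain c where "c \<in> A (Suc i)" "x - y = d c" by blast
    then show "\<psi> x - \<psi> y \<in> d' ` A' (Suc i)"
      unfolding diff[symmetric] onto[symmetric] using comm by auto
  qed
  then show ?thesis using cycles_iff assms by (simp add: homologous_def)
qed

lemma class_image:
  assumes "x \<in> D"
  shows "homologous A' d' i `` {\<psi> x} = \<psi> ` (homologous A d i `` {x})"
proof (intro equalityI subsetI)
  fix z assume z: "z \<in> homologous A' d' i `` {\<psi> x}"
  then have "z \<in> A' i" by (auto simp: homologous_def cycles_def)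
  then obtain y where y: "y \<in> A i" "z = \<psi> y" unfolding onto[symmetric] by blast
  then have "y \<in> D" using AD by blast
  then show "z \<in> \<psi> ` (homologous A d i `` {x})"
    using z y homologous_iff[OF assms] by auto
next
  fix z assume "z \<in> \<psi> ` (homologous A d i `` {x})"
  then obtain y where y: "z = \<psi> y" "(x, y) \<in> homologous A d i" by blast
  then have "y \<in> D" using AD by (auto simp: homologous_def cycles_def)
  then show "z \<in> homologous A' d' i `` {\<psi> x}" using y homologous_iff[OF assms] by simp
qed

lemma class_image_set:
  assumes "S \<subseteq> D"
  shows "homologous A' d' i `` (\<psi> ` S) = \<psi> ` (homologous A d i `` S)"
proof -
  have "homologous A' d' i `` (\<psi> ` S) = (\<Union>x\<in>S. homologous A' d' i `` {\<psi> x})" by blast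
  also have "\<dots> = (\<Union>x\<in>S. \<psi> ` (homologous A d i `` {x}))"
    by (rule SUP_cong[OF refl]) (rule class_image, use assms in blast)
  also have "\<dots> = \<psi> ` (homologous A d i `` S)" by blast
  finally show ?thesis .
qed

lemma homologous_subset: "homologous A d i `` S \<subseteq> D"
  using AD by (auto simp: homologous_def cycles_def)

lemma homology_subset: "homology A d i \<subseteq> Pow D"
  unfolding homology_def quotient_def using homologous_subset by blast

lemma homology_image: "homology A' d' i = (`) \<psi> ` homology A d i"
proof -
  have cyc: "cycles A' d' i = \<psi> ` cycles A d i"
  proof (intro equalityI subsetI)
    fix z assume z: "z \<in> cycles A' d' i"
    then obtain x where x: "x \<in> A i" "z = \<psi> x" unfolding cycles_def onto[symmetric] by blast
    then show "z \<in> \<psi> ` cycles A d i" using z cycles_iff[of x i] AD by blast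
  next
    fix z assume "z \<in> \<psi> ` cycles A d i"
    then obtain x where "x \<in> cycles A d i" "z = \<psi> x" by blast
    then show "z \<in> cycles A' d' i" using cycles_iff[of x i] AD by (auto simp: cycles_def)
  qed
  have cD: "x \<in> D" if "x \<in> cycles A d i" for x using that AD by (auto simp: cycles_def)
  have "(\<Union>x\<in>\<psi> ` cycles A d i. {homologous A' d' i `` {x}}) =
      (\<Union>x\<in>cycles A d i. {\<psi> ` (homologous A d i `` {x})})"
    using class_image[OF cD] by simp
  also have "\<dots> = (`) \<psi> ` (\<Union>x\<in>cycles A d i. {homologous A d i `` {x}})" by blast
  finally show ?thesis unfolding homology_def quotient_def cyc .
qed

lemma inj_on_image_Pow: "inj_on ((`) \<psi>) (Pow D)"
  using inj by (simp add: inj_on_image_Pow)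

end

text \<open>The isomorphisms send homology classes to homology classes bijectively and intertwine
  \<Phi> with \<Phi>', so the two maps on homology differ by bijections on both sides.\<close>

lemma quasi_iso_transport:
  assumes "complex_iso A dA A' dA' D \<psi>" "complex_iso B (\<lambda>_. 0) B' (\<lambda>_. 0) E \<chi>"
    and \<Phi>E: "\<And>x. x \<in> D \<Longrightarrow> \<Phi> x \<in> E" and \<Phi>': "\<And>x. x \<in> D \<Longrightarrow> \<Phi>' (\<psi> x) = \<chi> (\<Phi> x)"
  shows "quasi_iso A dA B (\<lambda>_. 0) \<Phi> \<longleftrightarrow> quasi_iso A' dA' B' (\<lambda>_. 0) \<Phi>'"
proof -
  interpret a: complex_iso A dA A' dA' D \<psi> by fact
  interpret b: complex_iso B "\<lambda>_. 0" B' "\<lambda>_. 0" E \<chi> by fact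
  have 1: "(\<forall>a\<in>A i. \<Phi> a \<in> B i \<and> \<Phi> (dA a) = 0) \<longleftrightarrow> (\<forall>a\<in>A' i. \<Phi>' a \<in> B' i \<and> \<Phi>' (dA' a) = 0)" for i
  proof -
    have "(\<forall>a\<in>A' i. \<Phi>' a \<in> B' i \<and> \<Phi>' (dA' a) = 0) \<longleftrightarrow>
        (\<forall>a\<in>A i. \<Phi>' (\<psi> a) \<in> B' i \<and> \<Phi>' (dA' (\<psi> a)) = 0)"
      unfolding a.onto[symmetric] by blast
    also have "\<dots> \<longleftrightarrow> (\<forall>a\<in>A i. \<Phi> a \<in> B i \<and> \<Phi> (dA a) = 0)"
    proof (rule ball_cong[OF refl])
      fix x assume x: "x \<in> A i"
      then have "x \<in> D" "dA x \<in> D" using a.AD a.dD by blast+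
      then show "(\<Phi>' (\<psi> x) \<in> B' i \<and> \<Phi>' (dA' (\<psi> x)) = 0) \<longleftrightarrow> (\<Phi> x \<in> B i \<and> \<Phi> (dA x) = 0)"
        using \<Phi>' \<Phi>E b.in_A'_iff b.\<psi>_eq_0_iff a.comm[OF x, symmetric] by simp
    qed
    finally show ?thesis by blast
  qed
  have 2: "bij_betw (\<lambda>c. homologous B (\<lambda>_. 0) i `` (\<Phi> ` c)) (homology A dA i) (homology B (\<lambda>_. 0) i) \<longleftrightarrow>
    bij_betw (\<lambda>c. homologous B' (\<lambda>_. 0) i `` (\<Phi>' ` c)) (homology A' dA' i) (homology B' (\<lambda>_. 0) i)" for i
  proof -
    let ?F = "\<lambda>c. homologous B (\<lambda>_. 0) i `` (\<Phi> ` c)"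
    let ?F' = "\<lambda>c. homologous B' (\<lambda>_. 0) i `` (\<Phi>' ` c)"
    let ?H = "homology A dA i" and ?HB = "homology B (\<lambda>_. 0) i"
    have comm: "?F' (\<psi> ` c) = \<chi> ` ?F c" if "c \<in> ?H" for c
    proof -
      have c: "c \<subseteq> D" using a.homology_subset that by blast
      have "\<Phi>' ` \<psi> ` c = \<chi> ` \<Phi> ` c" using c \<Phi>' by (auto simp: image_image intro!: image_cong)
      moreover have "\<Phi> ` c \<subseteq> E" using c \<Phi>E by blast
      ultimately show ?thesis using b.class_image_set by simp
    qed
    have bijA: "bij_betw ((`) \<psi>) ?H (homology A' dA' i)"
      unfolding a.homology_image bij_betw_def
      using inj_on_subset[OF a.inj_on_image_Pow a.homology_subset] by blast
    have FE: "?F c \<in> Pow E" for c using b.homologous_subset by blast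
    have "bij_betw ?F' (homology A' dA' i) (homology B' (\<lambda>_. 0) i) \<longleftrightarrow>
        bij_betw (?F' \<circ> (`) \<psi>) ?H (homology B' (\<lambda>_. 0) i)"
      using bij_betw_comp_iff[OF bijA] .
    also have "\<dots> \<longleftrightarrow> bij_betw ((`) \<chi> \<circ> ?F) ?H ((`) \<chi> ` ?HB)"
      unfolding b.homology_image by (rule bij_betw_cong) (simp add: comm)
    also have "\<dots> \<longleftrightarrow> bij_betw ?F ?H ?HB"
    proof -
      have "inj_on ((`) \<chi> \<circ> ?F) ?H \<longleftrightarrow> inj_on ?F ?H"
        using inj_on_subset[OF b.inj_on_image_Pow, of "?F ` ?H"] FE
        by (meson comp_inj_on inj_on_imageI2 image_subsetI)
      moreover have "((`) \<chi> \<circ> ?F) ` ?H = (`) \<chi> ` ?HB \<longleftrightarrow> ?F ` ?H = ?HB"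
        unfolding image_comp[symmetric]
        by (rule inj_on_image_eq_iff[OF b.inj_on_image_Pow]) (use FE b.homology_subset in auto)
      ultimately show ?thesis unfolding bij_betw_def by blast
    qed
    finally show ?thesis by blast
  qed
  show ?thesis unfolding quasi_iso_def using 1 2 by simp
qed

section \<open>Comparison of the two models\<close>

lemma frame_one: "frame n n (1\<^sub>m n) (1\<^sub>m n :: 'k::field_char_0 mat)"
  by unfold_locales auto

lemma frame_one_V: "frame.V n (1\<^sub>m n :: 'k::field_char_0 mat) = carrier_vec n"
  unfolding frame.V_def[OF frame_one] by (auto simp: image_iff)

lemma map_one_mult:
  fixes \<zeta>s :: "'k::field vec list"
  shows "set \<zeta>s \<subseteq> carrier_vec n \<Longrightarrow> mult_vecs (1\<^sub>m n) \<zeta>s = \<zeta>s"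
  by (rule map_idI) auto

abbreviation full_form :: "nat \<Rightarrow> 'k::field_char_0 salg \<Rightarrow> 'k form" where
  "full_form n \<equiv> form_of (carrier_vec n) (1\<^sub>m n)"

lemma full_form_value:
  "\<xi> \<in> carrier_vec n \<Longrightarrow> \<eta> \<in> carrier_vec n \<Longrightarrow> set \<zeta>s \<subseteq> carrier_vec n \<Longrightarrow> full_form n f \<xi> \<eta> \<zeta>s = pev \<xi> \<eta> \<zeta>s f"
  by (simp add: form_of_def map_one_mult)

lemma map_one_ac: "map_mat to_ac (1\<^sub>m n) = 1\<^sub>m n"
  by (rule eq_matI) auto

text \<open>Surjectivity of \<open>form_of\<close> gives coefficients both to a form and to its base
  change; uniqueness of the base change identifies the latter with \<open>salg_ac f\<close>, after
  which the group condition is the one in \<open>Ad_group_invariant_iff\<close>.\<close>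

lemma (in lie) full_form_ce_rel:
  assumes red: "reductive n br"
  shows "full_form n ` ce_rel C2 n br p = forms_G n br p"
proof -
  interpret fr: frame_ext n n "1\<^sub>m n" "1\<^sub>m n :: 'k mat" by (rule frame_ext.intro[OF frame_one])
  interpret K: lie_ac n brK by unfold_locales (rule lie_brK)
  note V = frame_one_V[where 'k='k] and VK = frame_one_V[where 'k="'k alg_closure"]
  note ext = fr.extends_form_iff[unfolded map_one_ac V VK]
  have inv: "(\<forall>\<gamma>\<in>Ad_group n br. preserves_form (carrier_vec n) \<gamma> (full_form n (salg_ac f))) \<longleftrightarrow>
      (\<forall>x\<in>carrier_vec n. coad x f = 0)" if f: "f \<in> salg n" for f
  proof -
    have "preserves_form (carrier_vec n) \<gamma> (full_form n (salg_ac f)) \<longleftrightarrow>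
      (\<forall>a\<in>carrier_vec n. \<forall>b\<in>carrier_vec n. \<forall>zs. set zs \<subseteq> carrier_vec n \<longrightarrow>
        pev (\<gamma> *\<^sub>v a) (\<gamma> *\<^sub>v b) (mult_vecs \<gamma> zs) (salg_ac f) = pev a b zs (salg_ac f))"
      if "\<gamma> \<in> Ad_group n br" for \<gamma>
    proof -
      have \<gamma>: "\<gamma> \<in> carrier_mat n n" using that K.inner_auts_carrier unfolding Ad_group_def by blast
      have "set (mult_vecs \<gamma> zs) \<subseteq> carrier_vec n" if "set zs \<subseteq> carrier_vec n" for zs
        using \<gamma> that by auto
      then show ?thesis
        unfolding preserves_form_def using \<gamma> by (simp add: full_form_value)
    qed
    then show ?thesis using Ad_group_invariant_iff[OF red f] by simp
  qed
  show ?thesis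
  proof (intro equalityI subsetI)
    fix F assume "F \<in> full_form n ` ce_rel C2 n br p"
    then obtain f where f: "F = full_form n f" "f \<in> sym_alg C2 n p" "\<forall>x\<in>carrier_vec n. coad x f = 0"
      unfolding ce_rel_def by blast
    have fs: "f \<in> salg n" using f(2) sym_alg_subset_salg by blast
    have "full_form n (salg_ac f) \<in> forms (carrier_vec n) p"
      using frame.form_of_in_forms[OF frame_one salg_ac_in_sym_alg[OF f(2)]] unfolding VK .
    moreover have "F \<in> forms (carrier_vec n) p"
      using fr.form_of_in_forms[OF f(2)] unfolding V f(1) .
    moreover have "extends_form (carrier_vec n) F (full_form n (salg_ac f))"
      using ext[OF fs salg_ac_in_salg[OF fs]] f(1) by simp
    ultimately show "F \<in> forms_G n br p"
      using inv[OF fs] f(3) unfolding forms_G_def by blast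
  next
    fix F assume "F \<in> forms_G n br p"
    then obtain F' where F: "F \<in> forms (carrier_vec n) p" "F' \<in> forms (carrier_vec n) p"
        "extends_form (carrier_vec n) F F'" "\<forall>\<gamma>\<in>Ad_group n br. preserves_form (carrier_vec n) \<gamma> F'"
      unfolding forms_G_def by blast
    obtain f where f: "f \<in> sym_alg C2 n p" "F = full_form n f"
      using fr.form_of_surj[unfolded V, OF F(1)] by blast
    obtain f' where f': "f' \<in> sym_alg C2 n p" "F' = full_form n f'"
      using frame.form_of_surj[OF frame_one[where 'k="'k alg_closure"], unfolded VK, OF F(2)] by blast
    have s: "f \<in> salg n" "f' \<in> salg n" using f f' sym_alg_subset_salg by blast+
    have "f' = salg_ac f" using ext[OF s] F(3) f(2) f'(2) by simp
    then have "\<forall>x\<in>carrier_vec n. coad x f = 0"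
      using inv[OF s(1)] F(4) f'(2) by blast
    then show "F \<in> full_form n ` ce_rel C2 n br p" using f unfolding ce_rel_def by blast
  qed
qed

lemma (in lie) full_form_ce_diff:
  assumes f: "f \<in> salg n"
  shows "full_form n (ce_diff C2 n br f) = koszul_diff br (full_form n f)"
proof (intro ext)
  fix \<xi> \<eta> \<zeta>s
  show "full_form n (ce_diff C2 n br f) \<xi> \<eta> \<zeta>s = koszul_diff br (full_form n f) \<xi> \<eta> \<zeta>s"
  proof (cases "\<xi> \<in> carrier_vec n \<and> \<eta> \<in> carrier_vec n \<and> set \<zeta>s \<subseteq> carrier_vec n")
    case True
    have "pev \<xi> \<eta> \<zeta>s (ce_diff C2 n br f) = pev \<xi> \<eta> (br \<xi> \<eta> # \<zeta>s) f"
      unfolding pev_def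
      by (rule coeff_hom.lin_ev_ce_diff[OF coeff_hom_id _ _ f])
         (use True in \<open>auto intro!: br_anti_index br_expand\<close>)
    then show ?thesis using True by (simp add: koszul_diff_def full_form_value)
  next
    case False
    then show ?thesis by (auto simp: koszul_diff_def form_of_def)
  qed
qed

lemma (in lie) complex_iso_G:
  assumes red: "reductive n br"
  shows "complex_iso (ce_rel C2 n br) (ce_diff C2 n br) (forms_G n br) (koszul_diff br) (salg n) (full_form n)"
proof
  have sub: "ce_rel C2 n br i \<subseteq> salg n" for i
    unfolding ce_rel_def using sym_alg_subset_salg by blast
  then show "ce_rel C2 n br i \<subseteq> salg n" for i .
  show "inj_on (full_form n :: 'k salg \<Rightarrow> 'k form) (salg n)"
    using frame.form_of_inject[OF frame_one, unfolded frame_one_V] by (intro inj_onI)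
  show "ce_diff C2 n br a \<in> salg n" if "a \<in> ce_rel C2 n br i" for a i
    using sub that salg_ce_diff by blast
  show "full_form n (ce_diff C2 n br a) = koszul_diff br (full_form n a)" if "a \<in> ce_rel C2 n br i" for a i
    using sub that full_form_ce_diff by blast
qed (simp_all add: form_of_diff salg_diff full_form_ce_rel[OF red])

text \<open>Elements of the normalizer are compared with matrices w in the basis B through \<gamma>
  B = B w: moving a point by \<gamma> moves its coordinates by w, and \<open>sym_map\<close> is
  pullback along w. Every w arises from some \<gamma> by definition, and every \<gamma> has such a w
  since it preserves the span.\<close>

lemma (in frame_ext) form_of_weyl_inv:
  assumes lie: "lie_algebra n br"
  shows "form_of V L ` sym_weyl_inv n br V m B p = forms_W n br V p"
proof -
  interpret lie n br by unfold_locales (rule lie)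
  interpret G: lie_ac n brK by unfold_locales (rule lie_brK)
  have inv: "(\<forall>\<gamma>\<in>cartan_normalizer n br V. preserves_form K.V \<gamma> (form_of K.V LK g)) \<longleftrightarrow>
      (\<forall>w\<in>weyl_group n br V m B. sym_map C2 w g = g)" if g: "g \<in> salg m" for g
  proof -
    have key: "preserves_form K.V \<gamma> (form_of K.V LK g) \<longleftrightarrow> sym_map C2 w g = g"
      if w: "w \<in> carrier_mat m m" and \<gamma>: "\<gamma> \<in> carrier_mat n n" and \<gamma>B: "\<gamma> * BK = BK * w" for \<gamma> w
    proof -
      have wc: "w *\<^sub>v a \<in> carrier_vec m" if "a \<in> carrier_vec m" for a using w that by simp
      have \<gamma>Ba: "\<gamma> *\<^sub>v (BK *\<^sub>v a) = BK *\<^sub>v (w *\<^sub>v a)" if "a \<in> carrier_vec m" for a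
        using assoc_mult_mat_vec[OF \<gamma> K.B that] assoc_mult_mat_vec[OF K.B w that] \<gamma>B by simp
      have sm: "pev a b zs (sym_map C2 w g) = pev (w *\<^sub>v a) (w *\<^sub>v b) (mult_vecs w zs) g"
        if "a \<in> carrier_vec m" "b \<in> carrier_vec m" "set zs \<subseteq> carrier_vec m" for a b zs
      proof -
        have "map_mat (\<lambda>c. c) w = w" by (rule eq_matI) auto
        then show ?thesis
          using coeff_hom.lin_ev_sym_map[OF coeff_hom_id w that fst_letters_of_salg[OF g]]
          unfolding pev_def by simp
      qed
      have val: "form_of K.V LK g (BK *\<^sub>v a) (BK *\<^sub>v b) (mult_vecs BK zs) = pev a b zs g"
        if "a \<in> carrier_vec m" "b \<in> carrier_vec m" "set zs \<subseteq> carrier_vec m" for a b zs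
      proof -
        have "mult_vecs LK (mult_vecs BK zs) = zs"
          unfolding map_map using that(3) by (intro map_idI) auto
        moreover have "set (mult_vecs BK zs) \<subseteq> K.V" using that(3) K.BV by auto
        ultimately show ?thesis using that K.BV by (simp add: form_of_def del: map_map)
      qed
      have val\<gamma>: "form_of K.V LK g (\<gamma> *\<^sub>v (BK *\<^sub>v a)) (\<gamma> *\<^sub>v (BK *\<^sub>v b)) (mult_vecs \<gamma> (mult_vecs BK zs)) =
          pev a b zs (sym_map C2 w g)"
        if "a \<in> carrier_vec m" "b \<in> carrier_vec m" "set zs \<subseteq> carrier_vec m" for a b zs
      proof -
        have e: "mult_vecs \<gamma> (mult_vecs BK zs) = mult_vecs BK (mult_vecs w zs)"
          using that(3) \<gamma>Ba by auto
        have "set (mult_vecs w zs) \<subseteq> carrier_vec m" using that(3) wc by auto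
        then show ?thesis
          unfolding e \<gamma>Ba[OF that(1)] \<gamma>Ba[OF that(2)] sm[OF that]
          by (rule val[OF wc[OF that(1)] wc[OF that(2)]])
      qed
      show ?thesis
      proof
        assume pres: "preserves_form K.V \<gamma> (form_of K.V LK g)"
        have "sym_map C2 w g - g = 0"
        proof (rule salg_eq_0I)
          show "sym_map C2 w g - g \<in> salg m" by (intro salg_diff salg_sym_map[OF w] g)
          fix a b :: "'k alg_closure vec" and zs :: "'k alg_closure vec list"
          assume c: "a \<in> carrier_vec m" "b \<in> carrier_vec m" "set zs \<subseteq> carrier_vec m"
          have "set (mult_vecs BK zs) \<subseteq> K.V" using c K.BV by auto
          then show "pev a b zs (sym_map C2 w g - g) = 0"
            using pres K.BV[OF c(1)] K.BV[OF c(2)] val[OF c] val\<gamma>[OF c]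
            unfolding preserves_form_def pev_diff by (metis diff_self)
        qed
        then show "sym_map C2 w g = g" by simp
      next
        assume eq: "sym_map C2 w g = g"
        show "preserves_form K.V \<gamma> (form_of K.V LK g)"
          unfolding preserves_form_def
        proof (intro ballI allI impI)
          fix \<xi> \<eta> \<zeta>s assume "\<xi> \<in> K.V" "\<eta> \<in> K.V" "set \<zeta>s \<subseteq> K.V"
          moreover from this have "mult_vecs BK (mult_vecs LK \<zeta>s) = \<zeta>s"
            unfolding map_map by (intro map_idI) (use K.BLv in auto)
          moreover have "set (mult_vecs LK \<zeta>s) \<subseteq> carrier_vec m"
            using \<open>set \<zeta>s \<subseteq> K.V\<close> K.LV_carrier by auto
          ultimately show "form_of K.V LK g (\<gamma> *\<^sub>v \<xi>) (\<gamma> *\<^sub>v \<eta>) (mult_vecs \<gamma> \<zeta>s) = form_of K.V LK g \<xi> \<eta> \<zeta>s"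
            using val[of "LK *\<^sub>v \<xi>" "LK *\<^sub>v \<eta>" "mult_vecs LK \<zeta>s"]
              val\<gamma>[of "LK *\<^sub>v \<xi>" "LK *\<^sub>v \<eta>" "mult_vecs LK \<zeta>s"] K.BLv K.LV_carrier eq
            by simp
        qed
      qed
    qed
    have nc: "\<gamma> \<in> carrier_mat n n" if "\<gamma> \<in> cartan_normalizer n br V" for \<gamma>
      using that G.inner_auts_carrier unfolding cartan_normalizer_def Ad_group_def by blast
    show ?thesis
    proof
      assume *: "\<forall>\<gamma>\<in>cartan_normalizer n br V. preserves_form K.V \<gamma> (form_of K.V LK g)"
      show "\<forall>w\<in>weyl_group n br V m B. sym_map C2 w g = g"
      proof
        fix w assume "w \<in> weyl_group n br V m B"
        then obtain \<gamma> where "w \<in> carrier_mat m m" "\<gamma> \<in> cartan_normalizer n br V" "\<gamma> * BK = BK * w"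
          unfolding weyl_group_def by blast
        then show "sym_map C2 w g = g" using key nc * by blast
      qed
    next
      assume *: "\<forall>w\<in>weyl_group n br V m B. sym_map C2 w g = g"
      show "\<forall>\<gamma>\<in>cartan_normalizer n br V. preserves_form K.V \<gamma> (form_of K.V LK g)"
      proof
        fix \<gamma> assume \<gamma>: "\<gamma> \<in> cartan_normalizer n br V"
        note \<gamma>c = nc[OF \<gamma>]
        have img: "(\<lambda>v. \<gamma> *\<^sub>v v) ` K.V = K.V"
          using \<gamma> unfolding cartan_normalizer_def span_ac_V by blast
        \<comment> \<open>The matrix of \<gamma> in the basis. That B w recovers \<gamma> B uses
          that \<gamma> maps the span into itself, where B L is the identity.\<close>
        define w where "w = LK * (\<gamma> * BK)"
        have gB: "\<gamma> * BK \<in> carrier_mat n m" using mult_carrier_mat[OF \<gamma>c K.B] .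
        have w: "w \<in> carrier_mat m m" unfolding w_def by (rule mult_carrier_mat[OF K.L gB])
        have Bw: "BK * w \<in> carrier_mat n m" by (rule mult_carrier_mat[OF K.B w])
        have col: "(\<gamma> * BK) *\<^sub>v unit_vec m j = (BK * w) *\<^sub>v unit_vec m j" for j
        proof -
          have u: "unit_vec m j \<in> carrier_vec m" by simp
          have "\<gamma> *\<^sub>v (BK *\<^sub>v unit_vec m j) \<in> K.V" using img K.BV[OF u] by blast
          then have "BK *\<^sub>v (LK *\<^sub>v (\<gamma> *\<^sub>v (BK *\<^sub>v unit_vec m j))) = \<gamma> *\<^sub>v (BK *\<^sub>v unit_vec m j)"
            by (rule K.BLv)
          then show ?thesis
            unfolding w_def
            by (simp only: assoc_mult_mat_vec[OF K.B w[unfolded w_def] u] assoc_mult_mat_vec[OF K.L gB u]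
                assoc_mult_mat_vec[OF \<gamma>c K.B u])
        qed
        have "\<gamma> * BK = BK * w"
        proof (rule eq_matI)
          fix i j assume "i < dim_row (BK * w)" "j < dim_col (BK * w)"
          then have ij: "i < n" "j < m" by (simp_all only: carrier_matD[OF Bw])
          have "M $$ (i, j) = (M *\<^sub>v unit_vec m j) $ i" if "M \<in> carrier_mat n m" for M :: "'k alg_closure mat"
            using that ij by simp
          then show "(\<gamma> * BK) $$ (i, j) = (BK * w) $$ (i, j)" using col gB Bw by metis
        qed (simp_all only: carrier_matD[OF gB] carrier_matD[OF Bw])
        moreover from this have "w \<in> weyl_group n br V m B" using w \<gamma> unfolding weyl_group_def by blast
        ultimately show "preserves_form K.V \<gamma> (form_of K.V LK g)" using key[OF w \<gamma>c] * by blast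
      qed
    qed
  qed
  show ?thesis
  proof (intro equalityI subsetI)
    fix F assume "F \<in> form_of V L ` sym_weyl_inv n br V m B p"
    then obtain f where f: "F = form_of V L f" "f \<in> sym_alg C2 m p" "\<forall>w\<in>weyl_group n br V m B. sym_map C2 w (salg_ac f) = salg_ac f"
      unfolding sym_weyl_inv_def by blast
    have fs: "f \<in> salg m" using f(2) sym_alg_subset_salg by blast
    have "form_of K.V LK (salg_ac f) \<in> forms (span_ac n V) p"
      unfolding span_ac_V by (rule K.form_of_in_forms[OF salg_ac_in_sym_alg[OF f(2)]])
    moreover have "F \<in> forms V p" unfolding f(1) by (rule form_of_in_forms[OF f(2)])
    moreover have "extends_form V F (form_of K.V LK (salg_ac f))"
      using extends_form_iff[OF fs salg_ac_in_salg[OF fs]] f(1) by simp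
    ultimately show "F \<in> forms_W n br V p"
      using inv[OF salg_ac_in_salg[OF fs]] f(3) unfolding forms_W_def span_ac_V by blast
  next
    fix F assume "F \<in> forms_W n br V p"
    then obtain F' where F: "F \<in> forms V p" "F' \<in> forms K.V p"
        "extends_form V F F'" "\<forall>\<gamma>\<in>cartan_normalizer n br V. preserves_form K.V \<gamma> F'"
      unfolding forms_W_def span_ac_V by blast
    obtain f where f: "f \<in> sym_alg C2 m p" "F = form_of V L f"
      using form_of_surj[OF F(1)] by blast
    obtain f' where f': "f' \<in> sym_alg C2 m p" "F' = form_of K.V LK f'"
      using K.form_of_surj[OF F(2)] by blast
    have s: "f \<in> salg m" "f' \<in> salg m" using f f' sym_alg_subset_salg by blast+
    have "f' = salg_ac f" using extends_form_iff[OF s] F(3) f(2) f'(2) by simp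
    then have "\<forall>w\<in>weyl_group n br V m B. sym_map C2 w (salg_ac f) = salg_ac f"
      using inv[OF s(2)] F(4) f'(2) by blast
    then show "F \<in> form_of V L ` sym_weyl_inv n br V m B p" using f unfolding sym_weyl_inv_def by blast
  qed
qed

lemma (in frame_ext) complex_iso_W:
  assumes lie: "lie_algebra n br"
  shows "complex_iso (sym_weyl_inv n br V m B) (\<lambda>_. 0) (forms_W n br V) (\<lambda>_. 0) (salg m) (form_of V L)"
proof
  show "sym_weyl_inv n br V m B i \<subseteq> salg m" for i
    unfolding sym_weyl_inv_def using sym_alg_subset_salg by blast
  show "inj_on (form_of V L) (salg m)" using form_of_inject by (intro inj_onI)
qed (simp_all add: form_of_diff salg_diff form_of_weyl_inv[OF lie])

text \<open>Pullback along B evaluates at B (L \<xi>), which is \<xi> itself on V.\<close>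

lemma (in frame) restrict_full_form:
  assumes f: "f \<in> salg n"
  shows "restrict_form V (full_form n f) = form_of V L (sym_map C2 B f)"
proof (intro ext)
  fix \<xi> \<eta> \<zeta>s
  show "restrict_form V (full_form n f) \<xi> \<eta> \<zeta>s = form_of V L (sym_map C2 B f) \<xi> \<eta> \<zeta>s"
  proof (cases "\<xi> \<in> V \<and> \<eta> \<in> V \<and> set \<zeta>s \<subseteq> V")
    case True
    have M: "map_mat (\<lambda>c. c) B = B" by (rule eq_matI) auto
    have z: "mult_vecs B (mult_vecs L \<zeta>s) = \<zeta>s"
      unfolding map_map by (intro map_idI) (use True BLv in auto)
    have c: "set (mult_vecs L \<zeta>s) \<subseteq> carrier_vec m" using True LV_carrier by auto
    have "pev (L *\<^sub>v \<xi>) (L *\<^sub>v \<eta>) (mult_vecs L \<zeta>s) (sym_map C2 B f) = pev \<xi> \<eta> \<zeta>s f"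
      using coeff_hom.lin_ev_sym_map[OF coeff_hom_id B LV_carrier LV_carrier c fst_letters_of_salg[OF f], of \<xi> \<eta>] True
      unfolding M z pev_def by (simp add: BLv)
    moreover have "full_form n f \<xi> \<eta> \<zeta>s = pev \<xi> \<eta> \<zeta>s f"
      by (rule full_form_value) (use True V_carrier in auto)
    ultimately show ?thesis using True by (simp add: restrict_form_def form_of_def[of V])
  next
    case False
    then show ?thesis by (auto simp: restrict_form_def form_of_def[of V])
  qed
qed

text \<open>The derived side quantifies over all bases of h while the restriction side mentions
  none. For each basis the two are equivalent, and the existence of one basis removes the
  quantifier.\<close>

lemma derived_hc_iff_restriction:
  assumes red: "reductive n br" and cartan: "cartan_subalgebra n br h"
  shows "derived_hc_quasi_iso n br h \<longleftrightarrow> restriction_quasi_iso n br h"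
proof -
  have lie: "lie_algebra n br" using red by (simp add: reductive_def)
  then interpret lie n br by unfold_locales
  have "quasi_iso (ce_rel C2 n br) (ce_diff C2 n br) (sym_weyl_inv n br h m B) (\<lambda>_. 0) (sym_map C2 B) \<longleftrightarrow>
      restriction_quasi_iso n br h" if "is_basis n h m B" for m B
  proof -
    obtain L where L: "frame n m B L" "frame.V m B = h" using is_basis_frame[OF \<open>is_basis n h m B\<close>] by blast
    interpret fr: frame_ext n m B L by (rule frame_ext.intro[OF L(1)])
    show ?thesis
      unfolding restriction_quasi_iso_def L(2)[symmetric]
      by (rule quasi_iso_transport[OF complex_iso_G[OF red] fr.complex_iso_W[OF lie]])
         (simp_all add: salg_sym_map[OF fr.B] fr.restrict_full_form)
  qed
  moreover have "\<exists>m B. is_basis n h m B"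
    using cartan is_basis_exists unfolding cartan_subalgebra_def by blast
  ultimately show ?thesis unfolding derived_hc_quasi_iso_def by blast
qed

text \<open>The equivalence holds for each algebra separately, so it survives both with and without
  the proviso.\<close>

theorem proposition8p1:
  shows
    "((\<forall>n (br :: 'k::field_char_0 vec \<Rightarrow> 'k vec \<Rightarrow> 'k vec) h.
         reductive n br \<and> cartan_subalgebra n br h \<longrightarrow> derived_hc_quasi_iso n br h)
      \<longleftrightarrow>
      (\<forall>n (br :: 'k::field_char_0 vec \<Rightarrow> 'k vec \<Rightarrow> 'k vec) h.
         reductive n br \<and> cartan_subalgebra n br h \<longrightarrow> restriction_quasi_iso n br h))
     \<and>
     ((\<forall>n (br :: 'k::field_char_0 vec \<Rightarrow> 'k vec \<Rightarrow> 'k vec) h.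
         reductive n br \<and> cartan_subalgebra n br h \<and> quotient_commuting_scheme_reduced n br
           \<longrightarrow> derived_hc_quasi_iso n br h)
      \<longleftrightarrow>
      (\<forall>n (br :: 'k::field_char_0 vec \<Rightarrow> 'k vec \<Rightarrow> 'k vec) h.
         reductive n br \<and> cartan_subalgebra n br h \<and> quotient_commuting_scheme_reduced n br
           \<longrightarrow> restriction_quasi_iso n br h))"
  using derived_hc_iff_restriction by blast

end
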